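(* Let $\mathfrak X$ be a Banach space, $p\in(0,\infty)$, $q\in(0,\infty]$, $s\in\mathbb R$, and $a$-type $\dot a\in\{\dot b,\dot f\}$. Suppose $\rho=\{\rho_Q\}_{Q\in\mathscr D}$ is a family of $(u,a,b,c)$-norms on $\mathfrak X$ with some $u\in(0,1]$ and $a,b,c\in[0,\infty)$. If $B=\{b_{QR}\}_{Q,R\in\mathscr D}$ is $(D,E,F)$-almost diagonal with $$D>J^{(u)}+c,\qquad E>\frac n2+s+a,\qquad F>J^{(u)}-\frac n2-s+b,$$ where $$J^{(u)}:=\begin{cases}n/\min\{p,q,u\}&\text{in the Triebel--Lizorkin case }\dot a=\dot f,\\ n/\min\{p,u\}&\text{in the Besov case }\dot a=\dot b,\end{cases}$$ then $B$ is bounded on $\dot a^s_{p,q}(\rho)$.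
   Context: Dyadic cubes. $\mathscr D_j=\{2^{-j}([0,1)^n+k):k\in\mathbb Z^n\}$, $\mathscr D=\bigcup_{j\in\mathbb Z}\mathscr D_j$; $\ell(Q)$ is the side length and $x_Q$ the lower-left vertex of $Q$. For real $a,b,c$, $$B_{a,b,c}(Q,R):=\Big(1+\frac{\ell(R)}{\ell(Q)}\Big)^a\Big(1+\frac{\ell(Q)}{\ell(R)}\Big)^b\Big(1+\frac{|x_Q-x_R|}{\max\{\ell(Q),\ell(R)\}}\Big)^c.$$ Almost diagonal matrices. A scalar matrix $B=\{b_{QR}\}_{Q,R\in\mathscr D}$ is $(D,E,F)$-almost diagonal if there is $C<\infty$ with $|b_{QR}|\le C\,B_{-E,-F,-D}(Q,R)$ for all $Q,R\in\mathscr D$. It acts on sequences $t=\{t_Q\}_{Q\in\mathscr D}$ of vectors in $\mathfrak X$ by $(Bt)_Q:=\sum_{R\in\mathscr D}b_{QR}t_R$. $(u,a,b,c)$-norms. $\rho=\{\rho_Q\}_{Q\in\mathscr D}$ is a family of $(u,a,b,c)$-norms if: each $\rho_Q$ is a $u$-norm on $\mathfrak X$ (like a norm but with $\rho_Q(\mathfrak e+\mathfrak e')^u\le\rho_Q(\mathfrak e)^u+\rho_Q(\mathfrak e')^u$ instead of the triangle inequality); each $\rho_Q$ is equivalent to $\|\cdot\|_{\mathfrak X}$ with constants possibly depending on $Q$; and there is $C<\infty$ with $\rho_Q(\mathfrak e)\le C\,B_{a,b,c}(Q,R)\rho_R(\mathfrak e)$ for all $Q,R\in\mathscr D$ and $\mathfrak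 e\in\mathfrak X$. Sequence spaces. $\dot f^s_{p,q}(\rho)$ (Triebel--Lizorkin case) and $\dot b^s_{p,q}(\rho)$ (Besov case) are the spaces of sequences $t=\{t_Q\}_{Q\in\mathscr D}$ in $\mathfrak X$ with finite quasi-norm $$\Big\|\Big(\sum_{j\in\mathbb Z}g_j^q\Big)^{1/q}\Big\|_{L^p(\mathbb R^n)}\quad\text{resp.}\quad\Big(\sum_{j\in\mathbb Z}\|g_j\|_{L^p(\mathbb R^n)}^q\Big)^{1/q},\qquad g_j:=2^{js}\sum_{Q\in\mathscr D_j}\rho_Q(t_Q)|Q|^{-1/2}\mathbf 1_Q,$$ with the usual modification if $q=\infty$. (The symbol $\dot a$ for the type of space is unrelated to the number $a$.) *)

theory Defs
  imports "HOL-Analysis.Analysis"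
begin

section \<open>Banach spaces over the real or complex scalars\<close>

text \<open>
  The type class \<^class>\<open>banach\<close> only provides real scalars. The scalar multiplication is therefore
  a parameter, over a type of class \<^class>\<open>real_normed_field\<close>; up to isomorphism such a field is
  \<^typ>\<open>real\<close> or \<^typ>\<open>complex\<close> (its norm is multiplicative), so this covers real and complex Banach
  spaces.
\<close>

locale banach_over = vector_space smul
  for smul :: "'k::real_normed_field \<Rightarrow> 'a::banach \<Rightarrow> 'a" +
  assumes smul_of_real: "smul (of_real r) x = r *\<^sub>R x"
    and norm_smul: "norm (smul c x) = norm c * norm x"

lemma banach_over_scaleR: "banach_over (scaleR :: real \<Rightarrow> 'a::banach \<Rightarrow> 'a)"
  by unfold_locales (auto simp: algebra_simps)

lemma banach_over_complex_mult: "banach_over ((*) :: complex \<Rightarrow> complex \<Rightarrow> complex)"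
  by unfold_locales (auto simp: algebra_simps norm_mult scaleR_conv_of_real)

section \<open>Dyadic cubes\<close>

definition dyadic_cube :: "int \<Rightarrow> int ^ 'n \<Rightarrow> (real ^ 'n) set" where
  "dyadic_cube j k =
     (\<lambda>x. (2 powi (- j)) *\<^sub>R (x + (\<chi> i. of_int (k $ i)))) ` {x. \<forall>i. 0 \<le> x $ i \<and> x $ i < 1}"

definition dyadic_level :: "int \<Rightarrow> (real ^ 'n) set set" where
  "dyadic_level j = range (dyadic_cube j)"

definition dyadic :: "(real ^ 'n) set set" where
  "dyadic = (\<Union>j. dyadic_level j)"

definition side_length :: "(real ^ 'n) set \<Rightarrow> real" where
  "side_length Q = 2 powi (- (THE j. Q \<in> dyadic_level j))"

definition lower_left :: "(real ^ 'n) set \<Rightarrow> real ^ 'n" where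
  "lower_left Q = (\<chi> i. Inf ((\<lambda>x. x $ i) ` Q))"

lemma mem_dyadic_cube:
  fixes x :: "real ^ 'n"
  shows "x \<in> dyadic_cube j k \<longleftrightarrow>
    (\<forall>i. 2 powi (- j) * of_int (k $ i) \<le> x $ i \<and> x $ i < 2 powi (- j) * (of_int (k $ i) + 1))"
    (is "_ \<longleftrightarrow> ?R")
proof
  assume "x \<in> dyadic_cube j k"
  then obtain y where y: "\<forall>i. 0 \<le> y $ i \<and> y $ i < 1"
    and x: "x = (2 powi (- j)) *\<^sub>R (y + (\<chi> i. of_int (k $ i)))"
    unfolding dyadic_cube_def by blast
  have "(2::real) powi (- j) > 0" by simp
  then show ?R using y by (auto simp: x)
next
  assume R: ?R
  define c :: real where "c = 2 powi (- j)"
  have c: "c > 0" by (simp add: c_def)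
  define y where "y = (inverse c) *\<^sub>R x - (\<chi> i. of_int (k $ i))"
  have "x = c *\<^sub>R (y + (\<chi> i. of_int (k $ i)))"
    using c by (simp add: y_def)
  moreover have "0 \<le> y $ i \<and> y $ i < 1" for i
    using R[rule_format, of i] c
    by (simp add: y_def field_simps flip: c_def)
  ultimately show "x \<in> dyadic_cube j k"
    unfolding dyadic_cube_def c_def by blast
qed

lemma coordinate_image_dyadic_cube:
  fixes k :: "int ^ 'n"
  shows "(\<lambda>x. x $ i) ` dyadic_cube j k =
    {2 powi (- j) * of_int (k $ i) ..< 2 powi (- j) * (of_int (k $ i) + 1)}" (is "_ = ?I")
proof
  show "(\<lambda>x. x $ i) ` dyadic_cube j k \<subseteq> ?I" by (auto simp: mem_dyadic_cube)
  show "?I \<subseteq> (\<lambda>x. x $ i) ` dyadic_cube j k"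
  proof
    fix r assume r: "r \<in> ?I"
    define x :: "real ^ 'n" where
      "x = (\<chi> m. if m = i then r else 2 powi (- j) * of_int (k $ m))"
    have "x \<in> dyadic_cube j k" using r by (auto simp: mem_dyadic_cube x_def)
    then show "r \<in> (\<lambda>x. x $ i) ` dyadic_cube j k"
      by (intro image_eqI[of _ _ x]) (simp_all add: x_def)
  qed
qed

lemma lower_left_dyadic_cube:
  "lower_left (dyadic_cube j k) = (2 powi (- j)) *\<^sub>R (\<chi> i. of_int (k $ i))"
  by (simp add: lower_left_def coordinate_image_dyadic_cube vec_eq_iff)

lemma side_length_dyadic_cube:
  fixes k :: "int ^ 'n"
  shows "side_length (dyadic_cube j k) = 2 powi (- j)"
proof -
  have "j' = j" if "dyadic_cube j k \<in> dyadic_level j'" for j'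
  proof -
    obtain k' :: "int ^ 'n" where eq: "dyadic_cube j k = dyadic_cube j' k'"
      using \<open>dyadic_cube j k \<in> dyadic_level j'\<close> by (auto simp: dyadic_level_def)
    fix i :: 'n
    have "2 powi (- j) = Sup ((\<lambda>x. x $ i) ` dyadic_cube j k) - Inf ((\<lambda>x. x $ i) ` dyadic_cube j k)"
      by (simp add: coordinate_image_dyadic_cube algebra_simps)
    also have "\<dots> = 2 powi (- j')"
      unfolding eq by (simp add: coordinate_image_dyadic_cube algebra_simps)
    finally have eq': "(2::real) powi (- j) = 2 powi (- j')" .
    show ?thesis
      using power_int_strict_increasing[of "- j" "- j'" "2::real"]
        power_int_strict_increasing[of "- j'" "- j" "2::real"] eq'
      by (cases j j' rule: linorder_cases) auto
  qed
  then have "(THE j'. dyadic_cube j k \<in> dyadic_level j') = j"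
    by (intro the_equality) (auto simp: dyadic_level_def)
  then show ?thesis by (simp add: side_length_def)
qed

section \<open>Almost diagonal matrices\<close>

definition B_fun :: "real \<Rightarrow> real \<Rightarrow> real \<Rightarrow> (real ^ 'n) set \<Rightarrow> (real ^ 'n) set \<Rightarrow> real" where
  "B_fun a b c Q R =
     (1 + side_length R / side_length Q) powr a *
     (1 + side_length Q / side_length R) powr b *
     (1 + norm (lower_left Q - lower_left R) / max (side_length Q) (side_length R)) powr c"

text \<open>
  A sequence indexed by the dyadic cubes is a function on all sets; its values outside
  \<^const>\<open>dyadic\<close> play no role. Likewise for matrices and for families of \<open>u\<close>-norms.
\<close>

definition almost_diagonal ::
  "real \<Rightarrow> real \<Rightarrow> real \<Rightarrow> ((real ^ 'n) set \<Rightarrow> (real ^ 'n) set \<Rightarrow> 'k::real_normed_field) \<Rightarrow> bool" where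
  "almost_diagonal D E F B \<longleftrightarrow>
     (\<exists>C. \<forall>Q\<in>dyadic. \<forall>R\<in>dyadic. norm (B Q R) \<le> C * B_fun (- E) (- F) (- D) Q R)"

definition matrix_action ::
  "('k \<Rightarrow> 'a \<Rightarrow> 'a) \<Rightarrow> ((real ^ 'n) set \<Rightarrow> (real ^ 'n) set \<Rightarrow> 'k) \<Rightarrow>
   ((real ^ 'n) set \<Rightarrow> 'a::banach) \<Rightarrow> (real ^ 'n) set \<Rightarrow> 'a" where
  "matrix_action smul B t Q = (\<Sum>\<^sub>\<infinity>R\<in>dyadic. smul (B Q R) (t R))"

section \<open>Families of norms\<close>

definition u_norm :: "('k::real_normed_field \<Rightarrow> 'a::banach \<Rightarrow> 'a) \<Rightarrow> real \<Rightarrow> ('a \<Rightarrow> real) \<Rightarrow> bool" where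
  "u_norm smul u \<rho> \<longleftrightarrow>
     (\<forall>e. 0 \<le> \<rho> e) \<and>
     (\<forall>e. \<rho> e = 0 \<longleftrightarrow> e = 0) \<and>
     (\<forall>l e. \<rho> (smul l e) = norm l * \<rho> e) \<and>
     (\<forall>e e'. \<rho> (e + e') powr u \<le> \<rho> e powr u + \<rho> e' powr u)"

definition equivalent_to_norm :: "('a::real_normed_vector \<Rightarrow> real) \<Rightarrow> bool" where
  "equivalent_to_norm \<rho> \<longleftrightarrow>
     (\<exists>m M. 0 < m \<and> 0 < M \<and> (\<forall>e. m * norm e \<le> \<rho> e \<and> \<rho> e \<le> M * norm e))"

definition uabc_norms ::
  "('k::real_normed_field \<Rightarrow> 'a::banach \<Rightarrow> 'a) \<Rightarrow> real \<Rightarrow> real \<Rightarrow> real \<Rightarrow> real \<Rightarrow>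
   ((real ^ 'n) set \<Rightarrow> 'a \<Rightarrow> real) \<Rightarrow> bool" where
  "uabc_norms smul u a b c \<rho> \<longleftrightarrow>
     (\<forall>Q\<in>dyadic. u_norm smul u (\<rho> Q)) \<and>
     (\<forall>Q\<in>dyadic. equivalent_to_norm (\<rho> Q)) \<and>
     (\<exists>C. \<forall>Q\<in>dyadic. \<forall>R\<in>dyadic. \<forall>e. \<rho> Q e \<le> C * B_fun a b c Q R * \<rho> R e)"

section \<open>Sequence spaces\<close>

text \<open>Power of an extended nonnegative number, used for positive exponents only.\<close>

definition ennpow :: "ennreal \<Rightarrow> real \<Rightarrow> ennreal" where
  "ennpow x r = (if x = \<infinity> then \<infinity> else ennreal (enn2real x powr r))"

definition Lp_norm :: "real \<Rightarrow> (real ^ 'n \<Rightarrow> ennreal) \<Rightarrow> ennreal" where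
  "Lp_norm p f = ennpow (\<integral>\<^sup>+ x. ennpow (f x) p \<partial>lborel) (1 / p)"

definition lq_norm :: "ennreal \<Rightarrow> (int \<Rightarrow> ennreal) \<Rightarrow> ennreal" where
  "lq_norm q f =
     (if q = \<infinity> then (SUP j. f j)
      else ennpow (\<Sum>\<^sub>\<infinity>j\<in>UNIV. ennpow (f j) (enn2real q)) (1 / enn2real q))"

definition level_fun ::
  "real \<Rightarrow> ((real ^ 'n) set \<Rightarrow> 'a \<Rightarrow> real) \<Rightarrow> ((real ^ 'n) set \<Rightarrow> 'a) \<Rightarrow> int \<Rightarrow> real ^ 'n \<Rightarrow> ennreal" where
  "level_fun s \<rho> t j x =
     ennreal (2 powr (real_of_int j * s)) *
     (\<Sum>\<^sub>\<infinity>Q\<in>dyadic_level j. ennreal (\<rho> Q (t Q) * measure lborel Q powr (- 1 / 2)) * indicator Q x)"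

datatype space_type = Besov | Triebel_Lizorkin

definition seq_norm ::
  "space_type \<Rightarrow> real \<Rightarrow> real \<Rightarrow> ennreal \<Rightarrow> ((real ^ 'n) set \<Rightarrow> 'a \<Rightarrow> real) \<Rightarrow>
   ((real ^ 'n) set \<Rightarrow> 'a) \<Rightarrow> ennreal" where
  "seq_norm ty s p q \<rho> t =
     (case ty of
        Triebel_Lizorkin \<Rightarrow> Lp_norm p (\<lambda>x. lq_norm q (\<lambda>j. level_fun s \<rho> t j x))
      | Besov \<Rightarrow> lq_norm q (\<lambda>j. Lp_norm p (level_fun s \<rho> t j)))"

definition seq_space ::
  "space_type \<Rightarrow> real \<Rightarrow> real \<Rightarrow> ennreal \<Rightarrow> ((real ^ 'n) set \<Rightarrow> 'a \<Rightarrow> real) \<Rightarrow>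
   ((real ^ 'n) set \<Rightarrow> 'a) set" where
  "seq_space ty s p q \<rho> = {t. seq_norm ty s p q \<rho> t < \<infinity>}"

text \<open>
  Boundedness includes that the series defining the action converge. They are sums over an
  unordered countable index set, so convergence is unconditional convergence in the Banach space.
\<close>

definition bounded_on_seq_space ::
  "('k \<Rightarrow> 'a \<Rightarrow> 'a) \<Rightarrow> ((real ^ 'n) set \<Rightarrow> (real ^ 'n) set \<Rightarrow> 'k) \<Rightarrow>
   space_type \<Rightarrow> real \<Rightarrow> real \<Rightarrow> ennreal \<Rightarrow> ((real ^ 'n) set \<Rightarrow> 'a::banach \<Rightarrow> real) \<Rightarrow> bool" where
  "bounded_on_seq_space smul B ty s p q \<rho> \<longleftrightarrow>
     (\<exists>C::real. \<forall>t\<in>seq_space ty s p q \<rho>.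
        (\<forall>Q\<in>dyadic. (\<lambda>R. smul (B Q R) (t R)) summable_on dyadic) \<and>
        matrix_action smul B t \<in> seq_space ty s p q \<rho> \<and>
        seq_norm ty s p q \<rho> (matrix_action smul B t) \<le> ennreal C * seq_norm ty s p q \<rho> t)"

text \<open>Since \<open>p\<close> and \<open>u\<close> are finite, so are the minima below, also for infinite \<open>q\<close>.\<close>

definition J_index :: "space_type \<Rightarrow> nat \<Rightarrow> real \<Rightarrow> ennreal \<Rightarrow> real \<Rightarrow> real" where
  "J_index ty n p q u =
     (case ty of
        Triebel_Lizorkin \<Rightarrow> real n / enn2real (min (ennreal p) (min q (ennreal u)))
      | Besov \<Rightarrow> real n / min p u)"

end

theory Submission
  imports Defs
begin

text \<open>
  Let \<open>J = n / r0\<close> and fix \<open>r\<close> slightly below \<open>r0\<close>; every \<open>u\<close>-norm is an \<open>r\<close>-norm. Taking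
  \<open>r\<close>-th powers of the level functions turns the matrix into a positive linear operator on
  \<open>L\<^sup>P(\<ell>\<^sup>Q)\<close>, where \<open>P = p / r > 1\<close> and \<open>Q = q / r\<close> (\<open>Q > 1\<close> in the Triebel--Lizorkin case). Its
  kernel is dominated by a rapidly convergent superposition of averages over the cells of dyadic
  grids that are at least as coarse as the function being averaged; by the one-third trick
  finitely many shifts of the grids suffice. It remains to bound \<open>(f\<^sub>j) \<mapsto> (E\<^sub>j f\<^sub>j)\<close> on
  \<open>L\<^sup>P(\<ell>\<^sup>Q)\<close> for the averages \<open>E\<^sub>j\<close> over nested partitions. This takes the place of the
  Fefferman--Stein maximal inequality and follows from the dual Doob inequality, which bounds
  \<open>\<Sum>\<^sub>j E\<^sub>j f\<^sub>j\<close> by \<open>\<Sum>\<^sub>j f\<^sub>j\<close> in \<open>L\<^sup>\<kappa>\<close> for nonnegative \<open>f\<^sub>j\<close> and \<open>\<kappa> \<ge> 1\<close>: directly if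
  \<open>Q \<le> P\<close>, and by duality if \<open>P < Q\<close>.
\<close>

text \<open>Where the thresholds come from. Put g = s + n / 2 and let i and j be the levels of the
  source and the target cube. Level i carries the weight 2^(i g), and passing from
  \<open>\<rho> Q\<close> to \<open>\<rho> R\<close> turns \<open>D\<close>, \<open>E\<close>,
  \<open>F\<close> into D - c, E - a, F - b. After r-th powers the kernel is compared with averages.
  Sums over cubes of level i have density 2^(i n), and an average over a cell 2^l times larger than
  the larger cube costs 2^(l n), which asks for (D - c) r > n. A source finer than the target costs
  a further 2^((i - j) n), which asks for (F - b + g) r > n. A coarser source costs nothing more,
  and E - a > g is enough whatever r is. The strict inequalities leave room for some r < r0, and
  then the exponents P and, in the Triebel--Lizorkin case, Q exceed 1, as duality and Jensen's
  inequality inside the sequence norm demand. Averaging is a contraction at each single level, and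
  in the Besov case this is all that is used: hence q does not enter J there.\<close>

lemma infsum_eq_nn_integral:
  fixes f :: "'i \<Rightarrow> ennreal"
  assumes "countable A"
  shows "infsum f A = (\<integral>\<^sup>+i. f i \<partial>count_space A)"
proof (cases "finite A")
  case True
  then show ?thesis by (simp add: nn_integral_count_space_finite)
next
  case False
  have eq: "infsum f A = (SUP F\<in>{F. finite F \<and> F \<subseteq> A}. sum f F)"
    by (simp add: nonneg_infsum_complete)
  note bij = bij_betw_from_nat_into[OF assms False]
  show ?thesis
  proof (rule antisym)
    have "sum f F \<le> (\<integral>\<^sup>+i. f i \<partial>count_space A)" if "finite F" "F \<subseteq> A" for F
    proof -
      have "sum f F = (\<integral>\<^sup>+i. f i * indicator F i \<partial>count_space A)"
        using that by (subst nn_integral_count_space'[of F]) (auto simp: indicator_def)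
      also have "\<dots> \<le> (\<integral>\<^sup>+i. f i \<partial>count_space A)"
        by (intro nn_integral_mono) (auto simp: indicator_def)
      finally show ?thesis .
    qed
    then show "infsum f A \<le> (\<integral>\<^sup>+i. f i \<partial>count_space A)"
      unfolding eq by (auto intro!: SUP_least)
    have "(\<integral>\<^sup>+i. f i \<partial>count_space A) = (\<Sum>n. f (from_nat_into A n))"
      by (simp add: nn_integral_bij_count_space[symmetric, OF bij] nn_integral_count_space_nat)
    also have "\<dots> = (SUP n. \<Sum>i<n. f (from_nat_into A i))"
      by (simp add: suminf_eq_SUP)
    also have "\<dots> \<le> infsum f A" unfolding eq
    proof (rule SUP_mono)
      fix n :: nat
      have "(\<Sum>i<n. f (from_nat_into A i)) = sum f (from_nat_into A ` {..<n})"
        using bij by (subst sum.reindex) (auto simp: bij_betw_def inj_on_def)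
      then show "\<exists>F\<in>{F. finite F \<and> F \<subseteq> A}. (\<Sum>i<n. f (from_nat_into A i)) \<le> sum f F"
        using bij by (intro bexI[of _ "from_nat_into A ` {..<n}"]) (auto simp: bij_betw_def)
    qed
    finally show "(\<integral>\<^sup>+i. f i \<partial>count_space A) \<le> infsum f A" .
  qed
qed

lemma nn_integral_count_space_eq_SUP:
  fixes f :: "'i \<Rightarrow> ennreal"
  assumes "countable A"
  shows "(\<integral>\<^sup>+i. f i \<partial>count_space A) = (SUP F\<in>{F. finite F \<and> F \<subseteq> A}. sum f F)"
  by (simp flip: infsum_eq_nn_integral[OF assms] add: nonneg_infsum_complete)

section \<open>Powers of extended nonnegative numbers\<close>

lemma ennpow_top [simp]: "ennpow top r = top"
  by (simp add: ennpow_def)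

lemma ennpow_ennreal: "0 \<le> x \<Longrightarrow> ennpow (ennreal x) r = ennreal (x powr r)"
  by (simp add: ennpow_def)

lemma ennpow_0 [simp]: "ennpow 0 r = 0"
  by (simp add: ennpow_def)

lemma ennpow_1 [simp]: "ennpow x 1 = x"
  by (cases x) (auto simp: ennpow_def)

lemma ennpow_mono: "0 < r \<Longrightarrow> x \<le> y \<Longrightarrow> ennpow x r \<le> ennpow y r"
  by (cases x; cases y) (auto simp: ennpow_def top_unique intro!: ennreal_leI powr_mono2)

text \<open>\<open>ennpow\<close> fixes 0 and \<open>top\<close> for every real exponent, negative
  ones and 0 included, so the laws for products of exponents and for sums of exponents hold without
  side conditions.\<close>

lemma ennpow_ennpow: "ennpow (ennpow x r) s = ennpow x (r * s)"
  by (cases x) (auto simp: ennpow_def powr_powr)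

lemma ennpow_inverse [simp]: "r \<noteq> 0 \<Longrightarrow> ennpow (ennpow x r) (1 / r) = x"
  "r \<noteq> 0 \<Longrightarrow> ennpow (ennpow x (1 / r)) r = x"
  by (simp_all add: ennpow_ennpow)

lemma ennpow_eq_0_iff [simp]: "ennpow x r = 0 \<longleftrightarrow> x = 0"
  by (cases x) (auto simp: ennpow_def)

lemma ennpow_eq_top_iff [simp]: "ennpow x r = top \<longleftrightarrow> x = top"
  by (cases x) (auto simp: ennpow_def)

lemma ennpow_less_top_iff [simp]: "ennpow x r < top \<longleftrightarrow> x < top"
  by (metis ennpow_eq_top_iff less_top)

lemma ennpow_mult: "ennpow (x * y) r = ennpow x r * ennpow y r"
proof (cases "x = top \<or> y = top")
  case True
  then show ?thesis by (cases "x = 0"; cases "y = 0") (auto simp: ennreal_mult_top ennreal_top_mult)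
next
  case False
  then show ?thesis
    by (cases x; cases y) (auto simp: ennpow_ennreal powr_mult simp flip: ennreal_mult)
qed

lemma ennpow_add: "ennpow x (r + s) = ennpow x r * ennpow x s"
  by (cases x) (auto simp: ennpow_ennreal powr_add ennreal_mult_top simp flip: ennreal_mult)

lemma ennpow_le_iff: "0 < r \<Longrightarrow> ennpow x r \<le> ennpow y r \<longleftrightarrow> x \<le> y"
  by (metis ennpow_inverse(1) ennpow_mono less_numeral_extra(3) zero_less_divide_1_iff)

lemma ennpow_le_swap: "0 < r \<Longrightarrow> ennpow x r \<le> y \<longleftrightarrow> x \<le> ennpow y (1 / r)"
  using ennpow_le_iff[of r x "ennpow y (1 / r)"] by simp

lemma ennpow_SUP:
  assumes "0 < r"
  shows "ennpow (SUP i\<in>I. f i) r = (SUP i\<in>I. ennpow (f i) r)"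
proof (rule antisym)
  have "(SUP i\<in>I. f i) \<le> ennpow (SUP i\<in>I. ennpow (f i) r) (1 / r)"
    using assms by (intro SUP_least, subst ennpow_le_swap[symmetric]) (auto intro: SUP_upper)
  then show "ennpow (SUP i\<in>I. f i) r \<le> (SUP i\<in>I. ennpow (f i) r)"
    using assms by (simp add: ennpow_le_swap)
  show "(SUP i\<in>I. ennpow (f i) r) \<le> ennpow (SUP i\<in>I. f i) r"
    using assms by (intro SUP_least ennpow_mono SUP_upper)
qed

lemma borel_measurable_ennpow [measurable (raw)]:
  assumes [measurable]: "f \<in> borel_measurable M"
  shows "(\<lambda>x. ennpow (f x) r) \<in> borel_measurable M"
  unfolding ennpow_def by measurable

text \<open>Apply t \<le> t powr r for 0 < t \<le> 1 to the shares a / (a + b) and b / (a + b),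
  which add up to 1.\<close>

lemma ennpow_add_le:
  assumes "0 < r" "r \<le> 1"
  shows "ennpow (x + y) r \<le> ennpow x r + ennpow y r"
proof (cases "x = top \<or> y = top \<or> x = 0 \<or> y = 0")
  case False
  then obtain a b where xy: "x = ennreal a" "y = ennreal b" "a > 0" "b > 0"
    by (cases x; cases y) auto
  have 1: "t \<le> t powr r" if "0 < t" "t \<le> 1" for t :: real
    using powr_mono'[of r 1 t] assms that by simp
  have "(a + b) powr r = (a + b) powr r * (a / (a + b) + b / (a + b))"
    using xy by (simp flip: add_divide_distrib)
  also have "\<dots> \<le> (a + b) powr r * ((a / (a + b)) powr r + (b / (a + b)) powr r)"
    using xy by (intro mult_left_mono add_mono 1) (auto simp: field_simps)
  also have "\<dots> = a powr r + b powr r"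
    using xy by (simp add: powr_divide field_simps)
  finally show ?thesis using xy
    by (simp add: ennpow_ennreal flip: ennreal_plus)
qed auto

lemma ennpow_sum_le:
  assumes "0 < r" "r \<le> 1"
  shows "ennpow (\<Sum>i\<in>I. f i) r \<le> (\<Sum>i\<in>I. ennpow (f i) r)"
proof (induction I rule: infinite_finite_induct)
  case (insert i I)
  then show ?case using ennpow_add_le[OF assms, of "f i" "sum f I"]
    by (auto intro: order_trans add_left_mono)
qed auto

lemma ennpow_nn_integral_count_space_le:
  assumes "countable A" "0 < r" "r \<le> 1"
  shows "ennpow (\<integral>\<^sup>+i. f i \<partial>count_space A) r \<le> (\<integral>\<^sup>+i. ennpow (f i) r \<partial>count_space A)"
  unfolding nn_integral_count_space_eq_SUP[OF assms(1)] ennpow_SUP[OF assms(2)]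
  by (intro SUP_mono) (auto intro!: ennpow_sum_le assms)

section \<open>Convexity of powers: tangents and Jensen's inequality\<close>

lemma young_powr:
  fixes x y k :: real
  assumes "1 < k" "0 \<le> x" "0 \<le> y"
  shows "k * (x * y powr (k - 1)) \<le> x powr k + (k - 1) * y powr k"
proof -
  have "x * y powr (k - 1) \<le> x powr k / k + (y powr (k - 1)) powr (k / (k - 1)) / (k / (k - 1))"
    using assms by (intro Youngs_inequality) (auto simp: field_simps)
  also have "(y powr (k - 1)) powr (k / (k - 1)) = y powr k"
    using assms by (simp add: powr_powr)
  finally show ?thesis using assms by (simp add: field_simps)
qed

text \<open>The tangent to the k-th power at the upper point x + a lies below the graph at x. This
  endpoint puts the full new partial sum into the derivative when \<open>dual_doob_aux\<close>
  telescopes.\<close>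

lemma ennpow_add_le_telescope:
  assumes "1 < k"
  shows "ennpow (x + a) k \<le> ennpow x k + ennreal k * (a * ennpow (x + a) (k - 1))"
proof (cases "x = top \<or> a = top")
  case False
  then obtain x' a' where xa: "x = ennreal x'" "a = ennreal a'" "x' \<ge> 0" "a' \<ge> 0"
    by (cases x; cases a) auto
  define y where "y = x' + a'"
  have y: "y \<ge> 0" using xa by (simp add: y_def)
  have "y * y powr (k - 1) = y powr k"
    using y by (cases "y = 0") (auto simp: powr_diff)
  moreover have "a' * y powr (k - 1) = y * y powr (k - 1) - x' * y powr (k - 1)"
    by (simp add: y_def algebra_simps)
  ultimately have "y powr k \<le> x' powr k + k * (a' * y powr (k - 1))"
  proof -
    have "k * (a' * y powr (k - 1)) = k * y powr k - k * (x' * y powr (k - 1))"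
      using \<open>y * y powr (k - 1) = y powr k\<close>
      by (simp only: \<open>a' * y powr (k - 1) = _\<close> right_diff_distrib)
    then show ?thesis
      using young_powr[OF assms, of x' y] xa y unfolding left_diff_distrib by linarith
  qed
  then show ?thesis using xa assms
    by (simp add: ennpow_ennreal y_def flip: ennreal_plus ennreal_mult)
qed (use assms in \<open>auto simp: ennreal_mult_top ennreal_top_mult\<close>)

lemma ennpow_tangent:
  assumes "1 < k" "0 \<le> a"
  shows "ennreal (k * a powr (k - 1)) * x \<le> ennpow x k + ennreal ((k - 1) * a powr k)"
proof (cases "x = top")
  case False
  then obtain x' where x: "x = ennreal x'" "x' \<ge> 0" by (cases x) auto
  show ?thesis
    using young_powr[OF assms(1) x(2) assms(2)] x assms
    by (simp add: ennpow_ennreal mult_ac flip: ennreal_plus ennreal_mult)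
qed (use assms in auto)

text \<open>Jensen's inequality, via the tangent of the power function at the mean.\<close>

lemma ennpow_nn_integral_le:
  assumes k: "1 \<le> k"
    and [measurable]: "w \<in> borel_measurable M" "f \<in> borel_measurable M"
    and w: "(\<integral>\<^sup>+x. w x \<partial>M) \<le> 1"
  shows "ennpow (\<integral>\<^sup>+x. w x * f x \<partial>M) k \<le> (\<integral>\<^sup>+x. w x * ennpow (f x) k \<partial>M)"
proof (cases "k = 1")
  case False
  with k have k: "1 < k" by simp
  show ?thesis
  proof (cases "\<integral>\<^sup>+x. w x * f x \<partial>M")
    case (real a)
    let ?I = "\<integral>\<^sup>+x. w x * ennpow (f x) k \<partial>M"
    have a: "a \<ge> 0" using real by simp
    have "ennreal (k * a powr k) = ennreal (k * a powr (k - 1)) * ennreal a"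
      using a k by (cases "a = 0") (auto simp: powr_diff simp flip: ennreal_mult)
    also have "\<dots> = ennreal (k * a powr (k - 1)) * (\<integral>\<^sup>+x. w x * f x \<partial>M)"
      by (simp only: real)
    also have "\<dots> = (\<integral>\<^sup>+x. ennreal (k * a powr (k - 1)) * (w x * f x) \<partial>M)"
      by (simp add: nn_integral_cmult)
    also have "\<dots> = (\<integral>\<^sup>+x. w x * (ennreal (k * a powr (k - 1)) * f x) \<partial>M)"
      by (simp add: mult_ac)
    also have "\<dots> \<le> (\<integral>\<^sup>+x. w x * (ennpow (f x) k + ennreal ((k - 1) * a powr k)) \<partial>M)"
      by (intro nn_integral_mono mult_left_mono ennpow_tangent k a) auto
    also have "\<dots> = ?I + (\<integral>\<^sup>+x. w x \<partial>M) * ennreal ((k - 1) * a powr k)"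
      by (simp add: distrib_left nn_integral_add nn_integral_multc)
    also have "\<dots> \<le> ?I + 1 * ennreal ((k - 1) * a powr k)"
      by (intro add_left_mono mult_right_mono w) auto
    finally have "ennreal (k * a powr k) \<le> ?I + ennreal ((k - 1) * a powr k)" by simp
    then have "ennreal (a powr k) + ennreal ((k - 1) * a powr k) \<le> ?I + ennreal ((k - 1) * a powr k)"
    proof -
      have "a powr k + (k - 1) * a powr k = k * a powr k" by (simp add: algebra_simps)
      then show ?thesis
        using k a \<open>ennreal (k * a powr k) \<le> _\<close> by (simp flip: ennreal_plus)
    qed
    then have "ennreal (a powr k) \<le> ?I"
      by (simp add: add.commute[of _ "ennreal ((k - 1) * a powr k)"] ennreal_add_left_cancel_le)
    then show ?thesis using real by (simp add: ennpow_ennreal)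
  next
    case top
    \<comment> \<open>An infinite mean has no tangent. Comparing f with 1 + f powr k shows that the
      right-hand side is infinite as well.\<close>
    have "x \<le> 1 + ennpow x k" for x
    proof (cases x)
      case (real r)
      have "r \<le> 1 + r powr k"
      proof (cases "r \<le> 1")
        case False
        then have "r powr 1 \<le> r powr k" using k by (intro powr_mono) auto
        then show ?thesis using False by simp
      qed (use powr_ge_zero[of r k] in linarith)
      then show ?thesis using real
        by (simp add: ennpow_ennreal flip: ennreal_1 ennreal_plus)
    qed simp
    then have "(\<integral>\<^sup>+x. w x * f x \<partial>M) \<le> (\<integral>\<^sup>+x. w x * (1 + ennpow (f x) k) \<partial>M)"
      by (intro nn_integral_mono mult_left_mono) auto
    also have "\<dots> = (\<integral>\<^sup>+x. w x \<partial>M) + (\<integral>\<^sup>+x. w x * ennpow (f x) k \<partial>M)"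
      by (simp add: distrib_left nn_integral_add)
    also have "\<dots> \<le> 1 + (\<integral>\<^sup>+x. w x * ennpow (f x) k \<partial>M)"
      by (intro add_right_mono w)
    finally show ?thesis using top by (auto simp: top_unique)
  qed
qed (use assms in simp)

text \<open>A substitute for Minkowski's inequality that covers all positive exponents.\<close>

lemma ennpow_weighted_sum:
  fixes c :: "'i \<Rightarrow> real"
  assumes A: "countable A" and r: "0 < r" and c: "\<And>i. i \<in> A \<Longrightarrow> 0 < c i"
    and fin: "(\<integral>\<^sup>+i. ennreal (c i) \<partial>count_space A) < \<infinity>"
  shows "\<exists>C>0. \<forall>x :: 'i \<Rightarrow> ennreal. ennpow (\<integral>\<^sup>+i. ennreal (c i) * x i \<partial>count_space A) r \<le>
    ennreal C * (\<integral>\<^sup>+i. ennreal (c i powr min 1 r) * ennpow (x i) r \<partial>count_space A)"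
proof (cases "r \<le> 1")
  case True
  have "ennpow (\<integral>\<^sup>+i. ennreal (c i) * x i \<partial>count_space A) r \<le>
    (\<integral>\<^sup>+i. ennreal (c i powr r) * ennpow (x i) r \<partial>count_space A)" for x :: "'i \<Rightarrow> ennreal"
    by (rule order.trans[OF ennpow_nn_integral_count_space_le[OF A r True]])
       (auto intro!: nn_integral_mono simp: ennpow_mult ennpow_ennreal c less_imp_le)
  with True show ?thesis by (intro exI[of _ 1]) (auto simp: min_def)
next
  case False
  then have r1: "1 \<le> r" by simp
  obtain s where s: "(\<integral>\<^sup>+i. ennreal (c i) \<partial>count_space A) = ennreal s" "0 \<le> s"
    using fin by (cases "\<integral>\<^sup>+i. ennreal (c i) \<partial>count_space A") auto
  \<comment> \<open>\<open>s\<close> is 0 when \<open>A\<close> is empty; adding 1 keeps the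
    division by \<open>S\<close> legitimate.\<close>
  define S where "S = s + 1"
  have S: "S > 0" "(\<integral>\<^sup>+i. ennreal (c i) \<partial>count_space A) \<le> ennreal S"
    using s by (auto simp: S_def intro!: ennreal_leI)
  show ?thesis
  proof (intro exI[of _ "S powr r / S"] conjI allI)
    fix x :: "'i \<Rightarrow> ennreal"
    have inv: "(\<integral>\<^sup>+i. ennreal (c i) * g i \<partial>count_space A) =
        ennreal S * (\<integral>\<^sup>+i. ennreal (c i / S) * g i \<partial>count_space A)" for g
    proof -
      have "ennreal S * (ennreal (c i / S) * g i) = ennreal (c i) * g i" if "i \<in> A" for i
        using S c[OF that] by (simp flip: mult.assoc ennreal_mult)
      then show ?thesis
        by (simp flip: nn_integral_cmult cong: nn_integral_cong_simp)
    qed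
    have "(\<integral>\<^sup>+i. ennreal (c i / S) \<partial>count_space A)
        = (\<integral>\<^sup>+i. ennreal (1 / S) * ennreal (c i) \<partial>count_space A)"
      using S c by (intro nn_integral_cong) (auto simp: less_imp_le simp flip: ennreal_mult)
    also have "\<dots> = ennreal (1 / S) * (\<integral>\<^sup>+i. ennreal (c i) \<partial>count_space A)"
      by (simp add: nn_integral_cmult)
    also have "\<dots> \<le> ennreal (1 / S) * ennreal S"
      by (intro mult_left_mono S) auto
    also have "\<dots> = 1" using S by (simp flip: ennreal_mult)
    finally have le1: "(\<integral>\<^sup>+i. ennreal (c i / S) \<partial>count_space A) \<le> 1" .
    have "ennpow (\<integral>\<^sup>+i. ennreal (c i) * x i \<partial>count_space A) r
      = ennreal (S powr r) * ennpow (\<integral>\<^sup>+i. ennreal (c i / S) * x i \<partial>count_space A) r"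
      using S by (subst inv) (simp add: ennpow_mult ennpow_ennreal)
    also have "\<dots> \<le> ennreal (S powr r) * (\<integral>\<^sup>+i. ennreal (c i / S) * ennpow (x i) r \<partial>count_space A)"
      by (intro mult_left_mono ennpow_nn_integral_le r1 le1) auto
    also have "\<dots> = ennreal (S powr r / S * S) * (\<integral>\<^sup>+i. ennreal (c i / S) * ennpow (x i) r \<partial>count_space A)"
      using S by simp
    also have "\<dots> = ennreal (S powr r / S) * (ennreal S * (\<integral>\<^sup>+i. ennreal (c i / S) * ennpow (x i) r \<partial>count_space A))"
      using S by (subst ennreal_mult) (auto simp: mult.assoc)
    also have "\<dots> = ennreal (S powr r / S) * (\<integral>\<^sup>+i. ennreal (c i) * ennpow (x i) r \<partial>count_space A)"
      by (simp only: inv[symmetric])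
    also have "\<dots> = ennreal (S powr r / S) * (\<integral>\<^sup>+i. ennreal (c i powr min 1 r) * ennpow (x i) r \<partial>count_space A)"
      using False c by (auto simp: min_def less_imp_le cong: nn_integral_cong_simp)
    finally show "ennpow (\<integral>\<^sup>+i. ennreal (c i) * x i \<partial>count_space A) r \<le> \<dots>" .
  qed (use S in auto)
qed

text \<open>Young's inequality with a weight \<open>e\<close> and without sharp constants: cut at x
  = e * y powr (1 / (p - 1)). Below the cut replace x by this bound, above it solve for y; each case
  leaves one of the two terms. The argument covers 0 and \<open>top\<close>, and a small
  \<open>e\<close> later makes one term absorbable.\<close>

lemma mult_le_ennpow_add_ennpow:
  assumes "1 < p" "0 < e"
  shows "x * y \<le> ennreal (e powr (1 - p)) * ennpow x p + ennreal e * ennpow y (p / (p - 1))"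
proof (cases "x \<le> ennreal e * ennpow y (1 / (p - 1))")
  case True
  have "x * y \<le> ennreal e * ennpow y (1 / (p - 1)) * ennpow y 1"
    using True by (intro mult_mono) auto
  also have "\<dots> = ennreal e * ennpow y (1 / (p - 1) + 1)"
    by (simp only: ennpow_add mult.assoc)
  also have "1 / (p - 1) + 1 = p / (p - 1)" using assms by (simp add: field_simps)
  finally show ?thesis by (simp add: add_increasing)
next
  case False
  have "y = ennpow (ennreal (1 / e) * (ennreal e * ennpow y (1 / (p - 1)))) (p - 1)"
    using assms by (simp add: ennreal_mult[symmetric] mult.assoc[symmetric])
  also have "\<dots> \<le> ennpow (ennreal (1 / e) * x) (p - 1)"
    using False assms by (intro ennpow_mono mult_left_mono) auto
  also have "\<dots> = ennreal (e powr (1 - p)) * ennpow x (p - 1)"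
    using assms by (simp add: ennpow_mult ennpow_ennreal powr_divide powr_diff)
  finally have "x * y \<le> ennpow x 1 * (ennreal (e powr (1 - p)) * ennpow x (p - 1))"
    by (intro mult_mono) auto
  also have "\<dots> = ennreal (e powr (1 - p)) * ennpow x (1 + (p - 1))"
    by (simp only: ennpow_add mult_ac)
  finally show ?thesis by (simp add: add_increasing2)
qed

text \<open>Normalise both sequences and apply \<open>mult_le_ennpow_add_ennpow\<close> termwise
  with weight 1. Each normalised sum is 1, and that form of Young's inequality lacks the weights 1/q
  and 1/q', hence the factor 2.\<close>

lemma holder_sum:
  fixes f g :: "nat \<Rightarrow> ennreal"
  assumes q: "1 < q"
  shows "(\<Sum>i\<in>I. f i * g i) \<le> 2 * (ennpow (\<Sum>i\<in>I. ennpow (f i) q) (1 / q) *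
    ennpow (\<Sum>i\<in>I. ennpow (g i) (q / (q - 1))) ((q - 1) / q))"
proof (cases "finite I")
  case I: True
  define q' where "q' = q / (q - 1)"
  have q': "q' > 1" "(q - 1) / q = 1 / q'" using q by (auto simp: q'_def field_simps)
  define F where "F = ennpow (\<Sum>i\<in>I. ennpow (f i) q) (1 / q)"
  define G where "G = ennpow (\<Sum>i\<in>I. ennpow (g i) q') (1 / q')"
  have F0: "f i = 0" if "F = 0" "i \<in> I" for i
    using that I by (auto simp: F_def)
  have G0: "g i = 0" if "G = 0" "i \<in> I" for i
    using that I by (auto simp: G_def)
  have FF: "(\<Sum>i\<in>I. ennpow (f i) q) = ennpow F q" using q by (simp add: F_def)
  have GG: "(\<Sum>i\<in>I. ennpow (g i) q') = ennpow G q'" using q' by (simp add: G_def)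
  have "(\<Sum>i\<in>I. f i * g i) \<le> 2 * (F * G)"
  \<comment> \<open>If \<open>F\<close> or \<open>G\<close> vanishes, so do all products; otherwise
    an infinite factor makes the right-hand side infinite.\<close>
  proof (cases "F = 0 \<or> G = 0 \<or> F = top \<or> G = top")
    case True
    then show ?thesis using F0 G0 
      by (cases "F = 0"; cases "G = 0") (auto simp: ennreal_mult_top ennreal_top_mult)
  next
    case False
    then obtain F' G' where F': "F = ennreal F'" "F' > 0" and G': "G = ennreal G'" "G' > 0"
      by (cases F; cases G) auto
    have *: "ennpow (ennreal (1 / a) * x) s = ennreal (1 / a powr s) * ennpow x s" if "a > 0" for a s x
      using that by (simp add: ennpow_mult ennpow_ennreal powr_divide)
    have "f i * g i = F * G * ((ennreal (1 / F') * f i) * (ennreal (1 / G') * g i))" for i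
    proof -
      have "F * G * ((ennreal (1 / F') * f i) * (ennreal (1 / G') * g i)) =
        (F * ennreal (1 / F')) * (G * ennreal (1 / G')) * (f i * g i)" by (simp add: mult_ac)
      then show ?thesis using F' G' by (simp flip: ennreal_mult)
    qed
    moreover have "(ennreal (1 / F') * f i) * (ennreal (1 / G') * g i) \<le>
      ennreal (1 / F' powr q) * ennpow (f i) q + ennreal (1 / G' powr q') * ennpow (g i) q'" for i
      using mult_le_ennpow_add_ennpow[OF q, of 1 "ennreal (1 / F') * f i" "ennreal (1 / G') * g i"] F' G'
      by (simp add: * flip: q'_def)
    ultimately have "(\<Sum>i\<in>I. f i * g i) \<le> (\<Sum>i\<in>I. F * G *
        (ennreal (1 / F' powr q) * ennpow (f i) q + ennreal (1 / G' powr q') * ennpow (g i) q'))"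
      by (intro sum_mono) (metis mult_left_mono zero_le)
    also have "\<dots> = F * G * (ennreal (1 / F' powr q) * ennpow F q + ennreal (1 / G' powr q') * ennpow G q')"
      by (simp add: sum_distrib_left[symmetric] sum.distrib FF GG)
    also have "\<dots> = F * G * (1 + 1)"
      using F' G' by (simp add: ennpow_ennreal flip: ennreal_mult)
    finally show ?thesis by (simp add: mult_ac)
  qed
  then show ?thesis by (simp add: F_def G_def q'_def)
qed simp

lemma ennpow_add_le_2:
  assumes "0 < r"
  shows "ennpow (x + y) r \<le> ennreal (2 powr r) * (ennpow x r + ennpow y r)"
proof -
  have "x + y \<le> 2 * max x y"
    by (metis add_mono max.cobounded1 max.cobounded2 mult_2)
  then have "ennpow (x + y) r \<le> ennpow (ennreal 2 * max x y) r"
    using assms by (intro ennpow_mono) auto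
  also have "\<dots> = ennreal (2 powr r) * ennpow (max x y) r"
    by (simp add: ennpow_mult ennpow_ennreal del: ennreal_numeral)
  also have "\<dots> \<le> ennreal (2 powr r) * (ennpow x r + ennpow y r)"
    by (intro mult_left_mono) (auto simp: max_def)
  finally show ?thesis .
qed

text \<open>The finiteness hypothesis is the reason why the estimates for averages are first proved
  for finitely many levels and for data of finite norm.\<close>

lemma ennreal_absorb:
  assumes "X \<le> C + ennreal (1 / 2) * X" "X < top"
  shows "X \<le> 2 * C"
proof (cases X)
  case (real x)
  then show ?thesis
  proof (cases C)
    case (real c)
    have "x \<le> c + 1 / 2 * x"
    proof -
      have "ennreal (1 / 2) * X = ennreal (1 / 2 * x)"
        using \<open>X = _\<close> \<open>0 \<le> x\<close> by (simp only: ennreal_mult)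
      then have "ennreal x \<le> ennreal c + ennreal (1 / 2 * x)"
        using assms \<open>X = _\<close> real by simp
      then show ?thesis
        using real \<open>0 \<le> x\<close> by (simp flip: ennreal_plus)
    qed
    then have "x \<le> 2 * c" by simp
    then show ?thesis
      using real \<open>X = _\<close> by (simp flip: ennreal_numeral ennreal_mult)
  qed (simp add: ennreal_mult_top)
qed (use assms in simp)

text \<open>The constants are explicit functions of the exponents, so that one value serves all
  kernels, truncations and grids at once. Here 1 / (2 * r) is the Young weight that turns the factor
  r of \<open>dual_doob_aux\<close> into 1/2, and absorption doubles the remaining term.\<close>

definition doob_const :: "real \<Rightarrow> real" where
  "doob_const r = (if r = 1 then 1 else 2 * r * (1 / (2 * r)) powr (1 - r))"

lemma doob_const_pos: "1 \<le> r \<Longrightarrow> 0 < doob_const r"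
  by (auto simp: doob_const_def)

text \<open>\<open>c\<close> is the constant of the estimate on the dual side. The Young weight e =
  1 / (4 * c) makes the absorbed coefficient 2 * e * c equal to 1/2. Of the factor 4, one 2 stems
  from \<open>holder_sum\<close> and one from absorption.\<close>

definition duality_const :: "real \<Rightarrow> real \<Rightarrow> real" where
  "duality_const p c = 4 * (1 / (4 * c)) powr (1 - p)"

text \<open>For p < q the dual exponents are in the opposite order, so their quotient is an
  admissible argument of \<open>doob_const\<close>.\<close>

definition lq_const :: "real \<Rightarrow> real \<Rightarrow> real" where
  "lq_const p q = (if q \<le> p then doob_const (p / q)
     else duality_const p (doob_const (p / (p - 1) / (q / (q - 1)))))"

text \<open>The duality branch of \<open>lq_const\<close> at q = \<infinity>, where the dual
  exponent q / (q - 1) becomes 1.\<close>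

definition SUP_const :: "real \<Rightarrow> real" where
  "SUP_const p = duality_const p (doob_const (p / (p - 1)))"

lemma duality_const_pos: "0 < c \<Longrightarrow> 0 < duality_const p c"
  by (simp add: duality_const_def)

lemma lq_const_pos: "1 < p \<Longrightarrow> 1 < q \<Longrightarrow> 0 < lq_const p q"
proof -
  assume *: "1 < p" "1 < q"
  show ?thesis
  proof (cases "q \<le> p")
    case False
    then have "1 \<le> p / (p - 1) / (q / (q - 1))"
      using * by (simp add: field_simps)
    then show ?thesis using False * by (simp add: lq_const_def doob_const_pos duality_const_pos)
  qed (use * in \<open>simp add: lq_const_def doob_const_pos\<close>)
qed

lemma SUP_const_pos: "1 < p \<Longrightarrow> 0 < SUP_const p"
  by (simp add: SUP_const_def doob_const_pos duality_const_pos)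

section \<open>Averaging over nested partitions\<close>

text \<open>Conditional expectations onto ever finer partitions, encoded by symmetric kernels. A
  nonzero value of \<open>K k x y\<close> is to be read as x and y sharing a cell of level k;
  \<open>K_nested\<close> then says that they cannot be told apart at any coarser level. Averages
  become plain integrals, defined at every point, and no sub-sigma-algebras enter.\<close>

locale nested_kernels = sigma_finite_measure M for M :: "'x measure" +
  fixes K :: "nat \<Rightarrow> 'x \<Rightarrow> 'x \<Rightarrow> ennreal"
  assumes space_UNIV [simp]: "space M = UNIV"
    and K_measurable [measurable]: "(\<lambda>(x, y). K k x y) \<in> borel_measurable (M \<Otimes>\<^sub>M M)"
    and K_sym: "K k x y = K k y x"
    and K_mass: "(\<integral>\<^sup>+y. K k x y \<partial>M) \<le> 1"
    and K_nested: "j \<le> k \<Longrightarrow> K k x y \<noteq> 0 \<Longrightarrow> K j x z = K j y z"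
begin

lemma K_section [measurable]: "K k x \<in> borel_measurable M"
  using measurable_Pair2[OF K_measurable, of x k] by simp

definition E :: "nat \<Rightarrow> ('x \<Rightarrow> ennreal) \<Rightarrow> 'x \<Rightarrow> ennreal" where
  "E k f x = (\<integral>\<^sup>+y. K k x y * f y \<partial>M)"

lemma E_measurable [measurable (raw)]:
  assumes [measurable]: "f \<in> borel_measurable M"
  shows "E k f \<in> borel_measurable M"
  unfolding E_def by measurable

lemma E_sym:
  assumes [measurable]: "f \<in> borel_measurable M" "g \<in> borel_measurable M"
  shows "(\<integral>\<^sup>+x. E k f x * g x \<partial>M) = (\<integral>\<^sup>+x. f x * E k g x \<partial>M)"
proof -
  interpret P: pair_sigma_finite M M by unfold_locales
  have "(\<integral>\<^sup>+x. E k f x * g x \<partial>M) = (\<integral>\<^sup>+x. (\<integral>\<^sup>+y. K k x y * f y * g x \<partial>M) \<partial>M)"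
    unfolding E_def by (intro nn_integral_cong) (simp add: nn_integral_multc)
  also have "\<dots> = (\<integral>\<^sup>+y. (\<integral>\<^sup>+x. K k x y * f y * g x \<partial>M) \<partial>M)"
    by (intro P.Fubini') measurable
  also have "\<dots> = (\<integral>\<^sup>+y. f y * E k g y \<partial>M)"
    unfolding E_def
    by (intro nn_integral_cong) (simp add: mult_ac K_sym[of k _ y for y] flip: nn_integral_cmult)
  finally show ?thesis .
qed

text \<open>The mass may be below 1, hence an inequality in place of the invariance of a conditional
  expectation.\<close>

lemma E_le_invariant:
  assumes "\<And>y. K k x y \<noteq> 0 \<Longrightarrow> g y = g x"
  shows "E k g x \<le> g x"
proof -
  have "E k g x = (\<integral>\<^sup>+y. K k x y * g x \<partial>M)"
    unfolding E_def using assms by (intro nn_integral_cong) (metis mult_zero_left)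
  also have "\<dots> = (\<integral>\<^sup>+y. K k x y \<partial>M) * g x"
    by (simp add: nn_integral_multc)
  also have "\<dots> \<le> 1 * g x" by (intro mult_right_mono K_mass) auto
  finally show ?thesis by simp
qed

lemma E_invariant: "j \<le> k \<Longrightarrow> K k x y \<noteq> 0 \<Longrightarrow> E j f y = E j f x"
  unfolding E_def by (intro nn_integral_cong) (metis K_nested)

lemma ennpow_E_le:
  assumes "1 \<le> r" and [measurable]: "f \<in> borel_measurable M"
  shows "ennpow (E k f x) r \<le> E k (\<lambda>y. ennpow (f y) r) x"
  unfolding E_def by (intro ennpow_nn_integral_le assms K_mass) measurable

lemma nn_integral_E_le:
  assumes [measurable]: "f \<in> borel_measurable M"
  shows "(\<integral>\<^sup>+x. E k f x \<partial>M) \<le> (\<integral>\<^sup>+x. f x \<partial>M)"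
proof -
  have "(\<integral>\<^sup>+x. E k f x \<partial>M) = (\<integral>\<^sup>+x. f x * E k (\<lambda>_. 1) x \<partial>M)"
    using E_sym[of f "\<lambda>_. 1" k] by simp
  also have "\<dots> \<le> (\<integral>\<^sup>+x. f x * 1 \<partial>M)"
    using K_mass by (intro nn_integral_mono mult_left_mono) (auto simp: E_def)
  finally show ?thesis by simp
qed

lemma nn_integral_ennpow_E_le:
  assumes "1 \<le> r" and [measurable]: "f \<in> borel_measurable M"
  shows "(\<integral>\<^sup>+x. ennpow (E k f x) r \<partial>M) \<le> (\<integral>\<^sup>+x. ennpow (f x) r \<partial>M)"
  by (rule order.trans[OF nn_integral_mono[OF ennpow_E_le[OF assms]] nn_integral_E_le]) simp

text \<open>A qualitative statement, with a bound that deteriorates as N grows. It licenses the use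
  of \<open>ennreal_absorb\<close>.\<close>

lemma nn_integral_sum_E_finite:
  assumes "1 \<le> r" and [measurable]: "\<And>k. f k \<in> borel_measurable M"
    and "\<And>k. k < N \<Longrightarrow> (\<integral>\<^sup>+x. ennpow (f k x) r \<partial>M) < top"
  shows "(\<integral>\<^sup>+x. ennpow (\<Sum>k<N. E k (f k) x) r \<partial>M) < top"
  using assms(3)
proof (induction N)
  case (Suc N)
  let ?S = "\<lambda>x. \<Sum>k<N. E k (f k) x"
  have "(\<integral>\<^sup>+x. ennpow (\<Sum>k<Suc N. E k (f k) x) r \<partial>M) \<le>
    (\<integral>\<^sup>+x. ennreal (2 powr r) * (ennpow (?S x) r + ennpow (E N (f N) x) r) \<partial>M)"
    using assms(1) by (intro nn_integral_mono) (auto intro!: ennpow_add_le_2)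
  also have "\<dots> = ennreal (2 powr r) *
      ((\<integral>\<^sup>+x. ennpow (?S x) r \<partial>M) + (\<integral>\<^sup>+x. ennpow (E N (f N) x) r \<partial>M))"
    by (simp add: nn_integral_cmult nn_integral_add)
  also have "\<dots> < top"
    using Suc nn_integral_ennpow_E_le[OF assms(1,2), of N N]
    by (auto simp: ennreal_mult_less_top le_less_trans)
  finally show ?case .
qed simp

text \<open>Writing \<open>S m\<close> for the partial sums of \<open>E k (f k)\<close>, the power \<open>S N powr r\<close> telescopes into
  \<open>r \<cdot> E m (f m) \<cdot> S (m + 1) powr (r - 1)\<close>; since \<open>S (m + 1)\<close> is constant on the cells of level
  \<open>m\<close>, self-adjointness removes the averaging.\<close>

lemma dual_doob_aux:
  assumes r: "1 < r" and [measurable]: "\<And>k. f k \<in> borel_measurable M"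
  shows "(\<integral>\<^sup>+x. ennpow (\<Sum>k<N. E k (f k) x) r \<partial>M) \<le>
    ennreal r * (\<integral>\<^sup>+x. (\<Sum>k<N. f k x) * ennpow (\<Sum>k<N. E k (f k) x) (r - 1) \<partial>M)"
proof (induction N)
  case (Suc N)
  define S where "S m x = (\<Sum>k<m. E k (f k) x)" for m x
  have [measurable]: "S m \<in> borel_measurable M" for m
    unfolding S_def by measurable
  have S_Suc: "S (Suc N) x = S N x + E N (f N) x" for x
    by (simp add: S_def)
  have S_mono: "S N x \<le> S (Suc N) x" for x
    by (simp add: S_Suc)
  have inv: "S (Suc N) y = S (Suc N) x" if "K N x y \<noteq> 0" for x y
    unfolding S_def using that by (intro sum.cong E_invariant) auto
  have "(\<integral>\<^sup>+x. ennpow (S (Suc N) x) r \<partial>M) \<le>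
    (\<integral>\<^sup>+x. ennpow (S N x) r + ennreal r * (E N (f N) x * ennpow (S (Suc N) x) (r - 1)) \<partial>M)"
    unfolding S_Suc using r by (intro nn_integral_mono ennpow_add_le_telescope)
  also have "\<dots> = (\<integral>\<^sup>+x. ennpow (S N x) r \<partial>M) +
      ennreal r * (\<integral>\<^sup>+x. E N (f N) x * ennpow (S (Suc N) x) (r - 1) \<partial>M)"
    by (simp add: nn_integral_add nn_integral_cmult)
  also have "(\<integral>\<^sup>+x. E N (f N) x * ennpow (S (Suc N) x) (r - 1) \<partial>M) =
      (\<integral>\<^sup>+x. f N x * E N (\<lambda>x. ennpow (S (Suc N) x) (r - 1)) x \<partial>M)"
    by (intro E_sym) auto
  also have "\<dots> \<le> (\<integral>\<^sup>+x. f N x * ennpow (S (Suc N) x) (r - 1) \<partial>M)"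
    by (intro nn_integral_mono mult_left_mono E_le_invariant) (simp_all add: inv)
  also have "(\<integral>\<^sup>+x. ennpow (S N x) r \<partial>M) \<le>
      ennreal r * (\<integral>\<^sup>+x. (\<Sum>k<N. f k x) * ennpow (S N x) (r - 1) \<partial>M)"
    using Suc by (simp add: S_def)
  also have "(\<integral>\<^sup>+x. (\<Sum>k<N. f k x) * ennpow (S N x) (r - 1) \<partial>M) \<le>
      (\<integral>\<^sup>+x. (\<Sum>k<N. f k x) * ennpow (S (Suc N) x) (r - 1) \<partial>M)"
    using r by (intro nn_integral_mono mult_left_mono ennpow_mono S_mono) auto
  finally have "(\<integral>\<^sup>+x. ennpow (S (Suc N) x) r \<partial>M) \<le>
     ennreal r * (\<integral>\<^sup>+x. (\<Sum>k<N. f k x) * ennpow (S (Suc N) x) (r - 1) \<partial>M) +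
     ennreal r * (\<integral>\<^sup>+x. f N x * ennpow (S (Suc N) x) (r - 1) \<partial>M)"
    by (simp add: add_mono mult_left_mono)
  also have "\<dots> = ennreal r * (\<integral>\<^sup>+x. (\<Sum>k<Suc N. f k x) * ennpow (S (Suc N) x) (r - 1) \<partial>M)"
    by (simp add: distrib_right nn_integral_add flip: distrib_left)
  finally show ?case unfolding S_def .
qed simp

text \<open>Young's inequality separates the two factors in the bound of
  \<open>dual_doob_aux\<close>, and the power of the sum of averages is absorbed on the left. For r
  = 1 it is the contraction property, level by level.\<close>

lemma dual_doob:
  assumes r: "1 \<le> r" and [measurable]: "\<And>k. f k \<in> borel_measurable M"
  shows "(\<integral>\<^sup>+x. ennpow (\<Sum>k<N. E k (f k) x) r \<partial>M) \<le>
    ennreal (doob_const r) * (\<integral>\<^sup>+x. ennpow (\<Sum>k<N. f k x) r \<partial>M)"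
proof (cases "r = 1")
  case True
  then show ?thesis
    by (auto simp: doob_const_def nn_integral_sum intro!: sum_mono nn_integral_E_le)
next
  case False
  with r have r: "1 < r" by simp
  let ?S = "\<lambda>x. \<Sum>k<N. E k (f k) x" and ?F = "\<lambda>x. \<Sum>k<N. f k x"
  show ?thesis
  proof (cases "(\<integral>\<^sup>+x. ennpow (?F x) r \<partial>M) < top")
    case fin: True
    define e where "e = 1 / (2 * r)"
    have e: "e > 0" using r by (simp add: e_def)
    have "(\<integral>\<^sup>+x. ennpow (f k x) r \<partial>M) \<le> (\<integral>\<^sup>+x. ennpow (?F x) r \<partial>M)" if "k < N" for k
      using r that by (intro nn_integral_mono ennpow_mono) (auto intro: member_le_sum)
    then have finS: "(\<integral>\<^sup>+x. ennpow (?S x) r \<partial>M) < top"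
      using r fin by (intro nn_integral_sum_E_finite) (auto intro: le_less_trans)
    have "(\<integral>\<^sup>+x. ennpow (?S x) r \<partial>M) \<le>
        ennreal r * (\<integral>\<^sup>+x. ?F x * ennpow (?S x) (r - 1) \<partial>M)"
      by (intro dual_doob_aux r) auto
    also have "(\<integral>\<^sup>+x. ?F x * ennpow (?S x) (r - 1) \<partial>M) \<le>
        (\<integral>\<^sup>+x. ennreal (e powr (1 - r)) * ennpow (?F x) r + ennreal e * ennpow (?S x) r \<partial>M)"
      using r
      by (intro nn_integral_mono order.trans[OF mult_le_ennpow_add_ennpow[OF r e]])
         (simp add: ennpow_ennpow)
    also have "\<dots> = ennreal (e powr (1 - r)) * (\<integral>\<^sup>+x. ennpow (?F x) r \<partial>M) +
        ennreal e * (\<integral>\<^sup>+x. ennpow (?S x) r \<partial>M)"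
      by (simp add: nn_integral_add nn_integral_cmult)
    also have "ennreal r * \<dots> = ennreal (r * e powr (1 - r)) * (\<integral>\<^sup>+x. ennpow (?F x) r \<partial>M) +
        ennreal (1 / 2) * (\<integral>\<^sup>+x. ennpow (?S x) r \<partial>M)"
      using r e by (simp add: distrib_left ennreal_mult mult.assoc[symmetric] e_def
          flip: ennreal_mult)
    finally have "(\<integral>\<^sup>+x. ennpow (?S x) r \<partial>M) \<le>
        2 * (ennreal (r * e powr (1 - r)) * (\<integral>\<^sup>+x. ennpow (?F x) r \<partial>M))"
      using finS by (intro ennreal_absorb) (auto simp: mult_left_mono)
    also have "\<dots> = ennreal (doob_const r) * (\<integral>\<^sup>+x. ennpow (?F x) r \<partial>M)"
      using r False by (simp add: doob_const_def e_def ennreal_mult mult.assoc)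
    finally show ?thesis .
  next
    case False
    then show ?thesis
      using doob_const_pos[of r] r by (simp add: not_less top_unique ennreal_mult_top)
  qed
qed

section \<open>Sequences of averages in mixed norms\<close>

lemma nn_integral_lq_E_le_ge:
  assumes r: "1 \<le> r" "1 \<le> q" and [measurable]: "\<And>k. f k \<in> borel_measurable M"
  shows "(\<integral>\<^sup>+x. ennpow (\<Sum>k<N. ennpow (E k (f k) x) q) r \<partial>M) \<le>
    ennreal (doob_const r) * (\<integral>\<^sup>+x. ennpow (\<Sum>k<N. ennpow (f k x) q) r \<partial>M)"
proof -
  have "(\<integral>\<^sup>+x. ennpow (\<Sum>k<N. ennpow (E k (f k) x) q) r \<partial>M) \<le>
    (\<integral>\<^sup>+x. ennpow (\<Sum>k<N. E k (\<lambda>y. ennpow (f k y) q) x) r \<partial>M)"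
    using r by (intro nn_integral_mono ennpow_mono sum_mono ennpow_E_le) auto
  also have "\<dots> \<le> ennreal (doob_const r) * (\<integral>\<^sup>+x. ennpow (\<Sum>k<N. ennpow (f k x) q) r \<partial>M)"
    by (intro dual_doob r) measurable
  finally show ?thesis .
qed

text \<open>The common core of the cases of finite and infinite q. \<open>A\<close> is the norm to
  be bounded, \<open>v\<close> a sequence that norms it, \<open>H\<close> the norm of the data and
  \<open>Z\<close> the dual norm of the averaged \<open>v\<close>. Self-adjointness moves the
  averages from \<open>f\<close> to \<open>v\<close>; after Hoelder and Young the term with
  \<open>Z\<close> is half of the left-hand side.\<close>

lemma duality_bound:
  assumes p: "1 < p" and c: "0 < c"
    and [measurable]: "\<And>k. f k \<in> borel_measurable M" "\<And>k. v k \<in> borel_measurable M"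
      "A \<in> borel_measurable M" "H \<in> borel_measurable M" "Z \<in> borel_measurable M"
    and A: "AE x in M. ennpow (A x) p \<le> (\<Sum>k<N. E k (f k) x * v k x)"
    and HZ: "\<And>x. (\<Sum>k<N. f k x * E k (v k) x) \<le> 2 * (H x * Z x)"
    and Z: "(\<integral>\<^sup>+x. ennpow (Z x) (p / (p - 1)) \<partial>M) \<le> ennreal c * (\<integral>\<^sup>+x. ennpow (A x) p \<partial>M)"
    and fin: "(\<integral>\<^sup>+x. ennpow (A x) p \<partial>M) < top"
  shows "(\<integral>\<^sup>+x. ennpow (A x) p \<partial>M) \<le> ennreal (duality_const p c) * (\<integral>\<^sup>+x. ennpow (H x) p \<partial>M)"
proof -
  define e where "e = 1 / (4 * c)"
  have e: "e > 0" using c by (simp add: e_def)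
  have "(\<integral>\<^sup>+x. ennpow (A x) p \<partial>M) \<le> (\<integral>\<^sup>+x. (\<Sum>k<N. E k (f k) x * v k x) \<partial>M)"
    by (intro nn_integral_mono_AE A)
  also have "\<dots> = (\<integral>\<^sup>+x. (\<Sum>k<N. f k x * E k (v k) x) \<partial>M)"
    by (simp add: nn_integral_sum E_sym)
  also have "\<dots> \<le> (\<integral>\<^sup>+x. 2 * (ennreal (e powr (1 - p)) * ennpow (H x) p +
      ennreal e * ennpow (Z x) (p / (p - 1))) \<partial>M)"
    by (intro nn_integral_mono order.trans[OF HZ] mult_left_mono mult_le_ennpow_add_ennpow p e) auto
  also have "\<dots> = 2 * (ennreal (e powr (1 - p)) * (\<integral>\<^sup>+x. ennpow (H x) p \<partial>M) +
      ennreal e * (\<integral>\<^sup>+x. ennpow (Z x) (p / (p - 1)) \<partial>M))"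
    by (simp add: nn_integral_add nn_integral_cmult)
  also have "\<dots> \<le> 2 * (ennreal (e powr (1 - p)) * (\<integral>\<^sup>+x. ennpow (H x) p \<partial>M) +
      ennreal e * (ennreal c * (\<integral>\<^sup>+x. ennpow (A x) p \<partial>M)))"
    by (intro mult_left_mono add_left_mono Z) auto
  also have "\<dots> = 2 * (ennreal (e powr (1 - p)) * (\<integral>\<^sup>+x. ennpow (H x) p \<partial>M)) +
      ennreal (2 * e * c) * (\<integral>\<^sup>+x. ennpow (A x) p \<partial>M)"
    using c e by (simp add: ennreal_mult distrib_left mult.assoc)
  also have "2 * e * c = 1 / 2" using c by (simp add: e_def)
  finally have "(\<integral>\<^sup>+x. ennpow (A x) p \<partial>M) \<le>
      2 * (2 * (ennreal (e powr (1 - p)) * (\<integral>\<^sup>+x. ennpow (H x) p \<partial>M)))"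
    by (intro ennreal_absorb fin)
  also have "\<dots> = ennreal (2 * (2 * e powr (1 - p))) * (\<integral>\<^sup>+x. ennpow (H x) p \<partial>M)"
    by (simp add: ennreal_mult mult.assoc)
  finally show ?thesis by (simp add: duality_const_def e_def)
qed

text \<open>For p < q the dual exponents satisfy q' < p', the range in which
  \<open>nn_integral_lq_E_le_ge\<close> applies directly, and duality carries its bound
  back.\<close>

lemma nn_integral_lq_E_le:
  assumes p: "1 < p" and q: "1 < q" and [measurable]: "\<And>k. f k \<in> borel_measurable M"
  shows "(\<integral>\<^sup>+x. ennpow (\<Sum>k<N. ennpow (E k (f k) x) q) (p / q) \<partial>M) \<le>
    ennreal (lq_const p q) * (\<integral>\<^sup>+x. ennpow (\<Sum>k<N. ennpow (f k x) q) (p / q) \<partial>M)"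
proof (cases "q \<le> p")
  case True
  then show ?thesis
    using nn_integral_lq_E_le_ge[of "p / q" q f N] q by (simp add: lq_const_def)
next
  case False
  define q' where "q' = q / (q - 1)"
  define p' where "p' = p / (p - 1)"
  have q': "1 < q'" using q by (simp add: q'_def)
  have p': "1 < p'" using p by (simp add: p'_def)
  have pq: "1 \<le> p' / q'"
    using p q False by (simp add: p'_def q'_def field_simps)
  define H where "H x = ennpow (\<Sum>k<N. ennpow (f k x) q) (1 / q)" for x
  define A where "A x = ennpow (\<Sum>k<N. ennpow (E k (f k) x) q) (1 / q)" for x
  \<comment> \<open>the extremal element for the duality of \<open>L\<^sup>p(\<ell>\<^sup>q)\<close> at the sequence \<open>E k (f k)\<close>\<close>
  define v where "v k x = ennreal (enn2real (E k (f k) x) powr (q - 1) * enn2real (A x) powr (p - q))" for k x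
  define Z where "Z x = ennpow (\<Sum>k<N. ennpow (E k (v k) x) q') (1 / q')" for x
  have [measurable]: "H \<in> borel_measurable M" "A \<in> borel_measurable M"
    unfolding H_def A_def by measurable
  have [measurable]: "v k \<in> borel_measurable M" for k
    unfolding v_def by measurable
  have [measurable]: "Z \<in> borel_measurable M"
    unfolding Z_def by measurable
  have H: "ennpow (\<Sum>k<N. ennpow (f k x) q) (p / q) = ennpow (H x) p" for x
    by (simp add: H_def ennpow_ennpow)
  have Aq: "(\<Sum>k<N. ennpow (E k (f k) x) q) = ennpow (A x) q" for x
    using q by (simp add: A_def)
  have A: "ennpow (\<Sum>k<N. ennpow (E k (f k) x) q) (p / q) = ennpow (A x) p" for x
    by (simp add: A_def ennpow_ennpow)
  show ?thesis
  proof (cases "(\<integral>\<^sup>+x. ennpow (H x) p \<partial>M) < top")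
    case fin: True
    have "(\<integral>\<^sup>+x. ennpow (f k x) p \<partial>M) \<le> (\<integral>\<^sup>+x. ennpow (H x) p \<partial>M)" if "k < N" for k
    proof (intro nn_integral_mono)
      fix x
      have "ennpow (f k x) p = ennpow (ennpow (f k x) q) (p / q)"
        using q by (simp add: ennpow_ennpow)
      also have "\<dots> \<le> ennpow (H x) p"
        unfolding H[symmetric] using p q that by (intro ennpow_mono member_le_sum) auto
      finally show "ennpow (f k x) p \<le> ennpow (H x) p" .
    qed
    then have S: "(\<integral>\<^sup>+x. ennpow (\<Sum>k<N. E k (f k) x) p \<partial>M) < top"
      using p fin by (intro nn_integral_sum_E_finite) (auto intro: le_less_trans)
    have "A x \<le> (\<Sum>k<N. E k (f k) x)" for x
      unfolding A_def using ennpow_sum_le[of "1 / q" "\<lambda>k. ennpow (E k (f k) x) q" "{..<N}"] q by simp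
    then have "(\<integral>\<^sup>+x. ennpow (A x) p \<partial>M) \<le> (\<integral>\<^sup>+x. ennpow (\<Sum>k<N. E k (f k) x) p \<partial>M)"
      using p by (intro nn_integral_mono ennpow_mono) auto
    with S have finA: "(\<integral>\<^sup>+x. ennpow (A x) p \<partial>M) < top" by (simp add: le_less_trans)
    \<comment> \<open>\<open>enn2real\<close> sends \<open>top\<close> to 0, so \<open>v\<close>
      vanishes and the pairing fails where \<open>A\<close> is infinite; \<open>finA\<close>
      confines this to a null set. The exponent p - q is negative, but at \<alpha> = 0 all
      \<open>a k\<close> vanish and 0 powr (p - q) = 0, so the identities survive.\<close>
    have pair: "ennpow (A x) p \<le> (\<Sum>k<N. E k (f k) x * v k x)"
      and vsum: "(\<Sum>k<N. ennpow (v k x) q') \<le> ennpow (A x) ((p - 1) * q')" if nt: "A x \<noteq> top" for x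
    proof -
      obtain \<alpha> where \<alpha>: "A x = ennreal \<alpha>" "\<alpha> \<ge> 0" using nt by (cases "A x") auto
      have "E k (f k) x \<noteq> top" if "k < N" for k
      proof
        assume "E k (f k) x = top"
        then have "ennpow (A x) q = top"
          using that by (auto simp flip: Aq intro!: bexI[of _ k])
        then show False using \<alpha> by simp
      qed
      then have "\<exists>r. E k (f k) x = ennreal r \<and> 0 \<le> r" if "k < N" for k
        using that by (cases "E k (f k) x") auto
      then obtain a where a: "E k (f k) x = ennreal (a k)" "a k \<ge> 0" if "k < N" for k
        by metis
      have v: "v k x = ennreal (a k powr (q - 1) * \<alpha> powr (p - q))" if "k < N" for k
        using that by (simp add: v_def a \<alpha>)
      have "ennreal (\<Sum>k<N. a k powr q) = ennreal (\<alpha> powr q)"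
        using Aq[of x] by (simp add: a \<alpha> ennpow_ennreal)
      then have sum_a: "(\<Sum>k<N. a k powr q) = \<alpha> powr q"
        by (simp add: sum_nonneg)
      have "\<alpha> powr p = \<alpha> powr q * \<alpha> powr (p - q)"
        using \<alpha> by (simp flip: powr_add)
      also have "\<dots> = (\<Sum>k<N. a k powr q * \<alpha> powr (p - q))"
        by (simp add: sum_distrib_right flip: sum_a)
      also have "\<dots> = (\<Sum>k<N. a k * (a k powr (q - 1) * \<alpha> powr (p - q)))"
        using a by (intro sum.cong) (auto simp: powr_diff)
      finally have \<alpha>_p: "\<alpha> powr p = (\<Sum>k<N. a k * (a k powr (q - 1) * \<alpha> powr (p - q)))" .
      have "ennpow (A x) p = (\<Sum>k<N. E k (f k) x * v k x)"
      proof -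
        have "(\<Sum>k<N. E k (f k) x * v k x) =
            (\<Sum>k<N. ennreal (a k * (a k powr (q - 1) * \<alpha> powr (p - q))))"
          by (intro sum.cong) (auto simp: a v ennreal_mult)
        also have "\<dots> = ennreal (\<Sum>k<N. a k * (a k powr (q - 1) * \<alpha> powr (p - q)))"
          by (intro sum_ennreal mult_nonneg_nonneg a) auto
        finally show ?thesis
          using \<alpha> by (simp add: ennpow_ennreal flip: \<alpha>_p)
      qed
      then show "ennpow (A x) p \<le> (\<Sum>k<N. E k (f k) x * v k x)" by simp
      have "(\<Sum>k<N. (a k powr (q - 1) * \<alpha> powr (p - q)) powr q') =
          (\<Sum>k<N. a k powr q * \<alpha> powr ((p - q) * q'))"
        using q by (simp add: powr_mult powr_powr q'_def)
      also have "\<dots> = \<alpha> powr q * \<alpha> powr ((p - q) * q')"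
        by (simp add: sum_distrib_right flip: sum_a)
      also have "\<dots> = \<alpha> powr (q + (p - q) * q')" by (simp add: powr_add)
      also have "q + (p - q) * q' = (p - 1) * q'"
        using q by (simp add: q'_def field_simps)
      finally show "(\<Sum>k<N. ennpow (v k x) q') \<le> ennpow (A x) ((p - 1) * q')"
        by (simp add: v \<alpha> ennpow_ennreal)
    qed
    have "(\<integral>\<^sup>+x. ennpow (A x) p \<partial>M) \<noteq> top" using finA by simp
    from nn_integral_PInf_AE[OF _ this[folded infinity_ennreal_def]]
    have finA_AE: "AE x in M. A x \<noteq> top" by simp
    have "(\<integral>\<^sup>+x. ennpow (Z x) p' \<partial>M) = (\<integral>\<^sup>+x. ennpow (\<Sum>k<N. ennpow (E k (v k) x) q') (p' / q') \<partial>M)"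
      by (simp add: Z_def ennpow_ennpow)
    also have "\<dots> \<le> ennreal (doob_const (p' / q')) *
        (\<integral>\<^sup>+x. ennpow (\<Sum>k<N. ennpow (v k x) q') (p' / q') \<partial>M)"
      using pq q' by (intro nn_integral_lq_E_le_ge) auto
    also have "(\<integral>\<^sup>+x. ennpow (\<Sum>k<N. ennpow (v k x) q') (p' / q') \<partial>M) \<le>
        (\<integral>\<^sup>+x. ennpow (ennpow (A x) ((p - 1) * q')) (p' / q') \<partial>M)"
      using finA_AE pq by (intro nn_integral_mono_AE) (auto elim!: eventually_mono intro!: ennpow_mono vsum)
    also have "\<dots> = (\<integral>\<^sup>+x. ennpow (A x) p \<partial>M)"
      using p q' by (simp add: ennpow_ennpow p'_def)
    finally have Z: "(\<integral>\<^sup>+x. ennpow (Z x) p' \<partial>M) \<le>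
        ennreal (doob_const (p' / q')) * (\<integral>\<^sup>+x. ennpow (A x) p \<partial>M)"
      by (simp add: mult_left_mono)
    have "(\<integral>\<^sup>+x. ennpow (A x) p \<partial>M) \<le>
        ennreal (duality_const p (doob_const (p' / q'))) * (\<integral>\<^sup>+x. ennpow (H x) p \<partial>M)"
    proof (rule duality_bound[where v = v and Z = Z and f = f and N = N])
      show "AE x in M. ennpow (A x) p \<le> (\<Sum>k<N. E k (f k) x * v k x)"
        using finA_AE by (auto elim!: eventually_mono intro!: pair)
      show "(\<Sum>k<N. f k x * E k (v k) x) \<le> 2 * (H x * Z x)" for x
        using holder_sum[OF q, of "\<lambda>k. f k x" "\<lambda>k. E k (v k) x" "{..<N}"]
        by (simp add: H_def Z_def q'_def)
    qed (use p finA doob_const_pos[OF pq] Z in \<open>auto simp: p'_def\<close>)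
    then show ?thesis
      using False by (simp add: H A lq_const_def p'_def q'_def)
  next
    case nfin: False
    then show ?thesis
      using lq_const_pos[OF p q] by (simp add: H not_less top_unique ennreal_mult_top)
  qed
qed

text \<open>The case q = \<infinity>. The norming sequence now lives in the l^1 side of the duality,
  where \<open>dual_doob\<close> at the exponent p' bounds its averages.\<close>

lemma nn_integral_SUP_E_le:
  assumes p: "1 < p" and [measurable]: "\<And>k. f k \<in> borel_measurable M"
  shows "(\<integral>\<^sup>+x. ennpow (SUP k\<in>{..<N}. E k (f k) x) p \<partial>M) \<le>
    ennreal (SUP_const p) * (\<integral>\<^sup>+x. ennpow (SUP k\<in>{..<N}. f k x) p \<partial>M)"
proof (cases "(\<integral>\<^sup>+x. ennpow (SUP k\<in>{..<N}. f k x) p \<partial>M) < top")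
  case fin: True
  define p' where "p' = p / (p - 1)"
  have p': "1 < p'" using p by (simp add: p'_def)
  define H where "H x = (SUP k\<in>{..<N}. f k x)" for x
  define A where "A x = (SUP k\<in>{..<N}. E k (f k) x)" for x
  \<comment> \<open>All mass sits on the first index at which the supremum is attained. Ties count
    once, so the \<open>v k x\<close> add up to at most the (p - 1)-th power of
    \<open>A x\<close>.\<close>
  define v where "v k x = (if E k (f k) x = A x \<and> (\<forall>i<k. E i (f i) x \<noteq> A x)
    then ennpow (A x) (p - 1) else 0)" for k x
  define Z where "Z x = (\<Sum>k<N. E k (v k) x)" for x
  have [measurable]: "H \<in> borel_measurable M" "A \<in> borel_measurable M"
    unfolding H_def A_def by measurable
  have [measurable]: "v k \<in> borel_measurable M" for k
    unfolding v_def by measurable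
  have [measurable]: "Z \<in> borel_measurable M"
    unfolding Z_def by measurable
  have "(\<integral>\<^sup>+x. ennpow (f k x) p \<partial>M) \<le> (\<integral>\<^sup>+x. ennpow (H x) p \<partial>M)" if "k < N" for k
    using p that by (intro nn_integral_mono ennpow_mono) (auto simp: H_def intro: SUP_upper)
  then have S: "(\<integral>\<^sup>+x. ennpow (\<Sum>k<N. E k (f k) x) p \<partial>M) < top"
    using p fin by (intro nn_integral_sum_E_finite) (auto simp: H_def intro: le_less_trans)
  have "A x \<le> (\<Sum>k<N. E k (f k) x)" for x
    unfolding A_def by (intro SUP_least member_le_sum) auto
  then have "(\<integral>\<^sup>+x. ennpow (A x) p \<partial>M) \<le> (\<integral>\<^sup>+x. ennpow (\<Sum>k<N. E k (f k) x) p \<partial>M)"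
    using p by (intro nn_integral_mono ennpow_mono) auto
  with S have finA: "(\<integral>\<^sup>+x. ennpow (A x) p \<partial>M) < top" by (simp add: le_less_trans)
  have pair: "ennpow (A x) p \<le> (\<Sum>k<N. E k (f k) x * v k x)" for x
  proof (cases "N = 0")
    case True
    then show ?thesis by (simp add: A_def bot_ennreal)
  next
    case False
    then have "A x \<in> (\<lambda>k. E k (f k) x) ` {..<N}"
      unfolding A_def by (subst Max_Sup[symmetric]) (auto intro!: Max_in)
    then obtain k where k: "k < N" "E k (f k) x = A x" by auto
    define m where "m = (LEAST k. E k (f k) x = A x)"
    have m: "E m (f m) x = A x" "\<forall>i<m. E i (f i) x \<noteq> A x" "m < N"
      unfolding m_def using LeastI[of "\<lambda>k. E k (f k) x = A x", OF k(2)]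
        not_less_Least[of _ "\<lambda>k. E k (f k) x = A x"]
        le_less_trans[OF Least_le[of "\<lambda>k. E k (f k) x = A x", OF k(2)] k(1)] by blast+
    have "ennpow (A x) p = ennpow (A x) (1 + (p - 1))" by simp
    also have "\<dots> = A x * ennpow (A x) (p - 1)" by (simp only: ennpow_add ennpow_1)
    also have "\<dots> = E m (f m) x * v m x" using m by (simp add: v_def)
    also have "\<dots> \<le> (\<Sum>k<N. E k (f k) x * v k x)" using m by (intro member_le_sum) auto
    finally show ?thesis .
  qed
  have vsum: "(\<Sum>k<N. v k x) \<le> ennpow (A x) (p - 1)" for x
  proof -
    define J where "J = {k\<in>{..<N}. E k (f k) x = A x \<and> (\<forall>i<k. E i (f i) x \<noteq> A x)}"
    have "i = j" if "i \<in> J" "j \<in> J" for i j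
      using that by (cases i j rule: linorder_cases) (auto simp: J_def)
    then have "card J \<le> 1"
      using card_le_Suc0_iff_eq[of J] by (simp add: J_def)
    moreover have "(\<Sum>k<N. v k x) = of_nat (card J) * ennpow (A x) (p - 1)"
      unfolding v_def J_def by (simp flip: sum.inter_filter)
    ultimately show ?thesis by (cases "card J") auto
  qed
  have "(\<integral>\<^sup>+x. ennpow (Z x) p' \<partial>M) \<le> ennreal (doob_const p') * (\<integral>\<^sup>+x. ennpow (\<Sum>k<N. v k x) p' \<partial>M)"
    unfolding Z_def using p' by (intro dual_doob) auto
  also have "(\<integral>\<^sup>+x. ennpow (\<Sum>k<N. v k x) p' \<partial>M) \<le> (\<integral>\<^sup>+x. ennpow (ennpow (A x) (p - 1)) p' \<partial>M)"
    using p' by (intro nn_integral_mono ennpow_mono vsum) auto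
  also have "\<dots> = (\<integral>\<^sup>+x. ennpow (A x) p \<partial>M)"
    using p by (simp add: ennpow_ennpow p'_def)
  finally have Z: "(\<integral>\<^sup>+x. ennpow (Z x) p' \<partial>M) \<le> ennreal (doob_const p') * (\<integral>\<^sup>+x. ennpow (A x) p \<partial>M)"
    by (simp add: mult_left_mono)
  have "(\<integral>\<^sup>+x. ennpow (A x) p \<partial>M) \<le>
      ennreal (duality_const p (doob_const p')) * (\<integral>\<^sup>+x. ennpow (H x) p \<partial>M)"
  proof (rule duality_bound[where v = v and Z = Z and f = f and N = N])
    show "(\<Sum>k<N. f k x * E k (v k) x) \<le> 2 * (H x * Z x)" for x
    proof -
      have "(\<Sum>k<N. f k x * E k (v k) x) \<le> (\<Sum>k<N. H x * E k (v k) x)"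
        by (intro sum_mono mult_right_mono) (auto simp: H_def intro: SUP_upper)
      also have "\<dots> = 1 * (H x * Z x)" by (simp add: Z_def sum_distrib_left)
      also have "\<dots> \<le> 2 * (H x * Z x)" by (intro mult_right_mono) auto
      finally show ?thesis .
    qed
  qed (use p finA doob_const_pos[of p'] p' Z pair in \<open>auto simp: p'_def\<close>)
  then show ?thesis by (simp add: A_def H_def SUP_const_def p'_def)
next
  case False
  then show ?thesis
    using SUP_const_pos[OF p] by (simp add: not_less top_unique ennreal_mult_top)
qed

end

section \<open>Superpositions with rapidly decaying coefficients\<close>

lemma borel_measurable_nn_integral_count_space [measurable (raw)]:
  fixes f :: "'i::countable \<Rightarrow> 'x \<Rightarrow> ennreal"
  assumes [measurable]: "\<And>i. f i \<in> borel_measurable M"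
  shows "(\<lambda>x. \<integral>\<^sup>+i. f i x \<partial>count_space UNIV) \<in> borel_measurable M"
proof -
  interpret sigma_finite_measure "count_space (UNIV :: 'i set)"
    by (rule sigma_finite_measure_count_space)
  have "(\<lambda>(x, i). f i x) \<in> borel_measurable (M \<Otimes>\<^sub>M count_space UNIV)"
    using measurable_compose_countable'[where f = "\<lambda>i z. f i (fst z)" and I = UNIV and g = snd
        and M = "M \<Otimes>\<^sub>M count_space UNIV" and N = borel]
    by (simp add: case_prod_beta)
  then show ?thesis by (rule borel_measurable_nn_integral)
qed

text \<open>Every positive power of \<open>c\<close> has to be summable because
  \<open>ennpow_weighted_sum\<close> replaces \<open>c i\<close> by \<open>c i powr min 1 p\<close>,
  which may decay more slowly. The constant is fixed before the measure and the functions and is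
  thus uniform in them.\<close>

lemma superposition_Lp:
  fixes c :: "'i::countable \<Rightarrow> real"
  assumes p: "0 < p" and c: "\<And>i. 0 < c i"
    and fin: "\<And>e. 0 < e \<Longrightarrow> (\<integral>\<^sup>+i. ennreal (c i powr e) \<partial>count_space UNIV) < top"
  obtains C where "0 < C"
    "\<And>(M :: 'x measure) (a :: 'i \<Rightarrow> 'x \<Rightarrow> ennreal) B. (\<And>i. a i \<in> borel_measurable M) \<Longrightarrow>
      (\<And>i. (\<integral>\<^sup>+x. ennpow (a i x) p \<partial>M) \<le> B) \<Longrightarrow>
      (\<integral>\<^sup>+x. ennpow (\<integral>\<^sup>+i. ennreal (c i) * a i x \<partial>count_space UNIV) p \<partial>M) \<le> ennreal C * B"
proof -
  define d where "d i = c i powr min 1 p" for i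
  have "(\<integral>\<^sup>+i. ennreal (c i) \<partial>count_space UNIV) < \<infinity>"
    using fin[of 1] c by (simp add: abs_of_pos)
  from ennpow_weighted_sum[OF countableI_type p c this] obtain C1 where C1: "C1 > 0"
    "\<And>x. ennpow (\<integral>\<^sup>+i. ennreal (c i) * x i \<partial>count_space UNIV) p \<le>
      ennreal C1 * (\<integral>\<^sup>+i. ennreal (d i) * ennpow (x i) p \<partial>count_space UNIV)"
    by (auto simp: d_def)
  obtain D where D: "(\<integral>\<^sup>+i. ennreal (d i) \<partial>count_space UNIV) = ennreal D" "D \<ge> 0"
    using fin[of "min 1 p"] p by (cases "\<integral>\<^sup>+i. ennreal (d i) \<partial>count_space UNIV") (auto simp: d_def)
  show ?thesis
  proof (rule that[of "C1 * (D + 1)"])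
    fix M :: "'x measure" and a :: "'i \<Rightarrow> 'x \<Rightarrow> ennreal" and B
    assume [measurable]: "\<And>i. a i \<in> borel_measurable M"
      and B: "\<And>i. (\<integral>\<^sup>+x. ennpow (a i x) p \<partial>M) \<le> B"
    have "(\<integral>\<^sup>+x. ennpow (\<integral>\<^sup>+i. ennreal (c i) * a i x \<partial>count_space UNIV) p \<partial>M) \<le>
      (\<integral>\<^sup>+x. ennreal C1 * (\<integral>\<^sup>+i. ennreal (d i) * ennpow (a i x) p \<partial>count_space UNIV) \<partial>M)"
      by (intro nn_integral_mono C1)
    also have "\<dots> = ennreal C1 * (\<integral>\<^sup>+x. (\<integral>\<^sup>+i. ennreal (d i) * ennpow (a i x) p \<partial>count_space UNIV) \<partial>M)"
      by (rule nn_integral_cmult) measurable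
    also have "\<dots> = ennreal C1 * (\<integral>\<^sup>+i. ennreal (d i) * (\<integral>\<^sup>+x. ennpow (a i x) p \<partial>M) \<partial>count_space UNIV)"
      by (subst nn_integral_count_space_nn_integral) (auto simp: nn_integral_cmult)
    also have "\<dots> \<le> ennreal C1 * (\<integral>\<^sup>+i. ennreal (d i) * B \<partial>count_space UNIV)"
      by (intro mult_left_mono nn_integral_mono B) auto
    also have "\<dots> = ennreal (C1 * D) * B"
      using C1 D by (simp add: nn_integral_multc ennreal_mult mult.assoc)
    also have "\<dots> \<le> ennreal (C1 * (D + 1)) * B"
      using C1 by (intro mult_right_mono ennreal_leI) auto
    finally show "(\<integral>\<^sup>+x. ennpow (\<integral>\<^sup>+i. ennreal (c i) * a i x \<partial>count_space UNIV) p \<partial>M) \<le>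
      ennreal (C1 * (D + 1)) * B" .
  qed (use C1 D in auto)
qed

text \<open>\<open>ennpow_weighted_sum\<close> treats the inner power pointwise, and
  \<open>superposition_Lp\<close> with the new coefficients \<open>d\<close> treats the outer one,
  which may be below 1. Both measures are arbitrary because points and levels exchange roles between
  the Triebel--Lizorkin and the Besov case.\<close>

lemma superposition_mixed:
  fixes c :: "'i::countable \<Rightarrow> real"
  assumes q: "0 < q" and r: "0 < r" and c: "\<And>i. 0 < c i"
    and fin: "\<And>e. 0 < e \<Longrightarrow> (\<integral>\<^sup>+i. ennreal (c i powr e) \<partial>count_space UNIV) < top"
  obtains C where "0 < C"
    "\<And>(M :: 'x measure) (N :: 'y measure) (a :: 'i \<Rightarrow> 'y \<Rightarrow> 'x \<Rightarrow> ennreal) B.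
      (\<And>i x. (\<lambda>y. a i y x) \<in> borel_measurable N) \<Longrightarrow>
      (\<And>i. (\<lambda>x. \<integral>\<^sup>+y. ennpow (a i y x) q \<partial>N) \<in> borel_measurable M) \<Longrightarrow>
      (\<And>i. (\<integral>\<^sup>+x. ennpow (\<integral>\<^sup>+y. ennpow (a i y x) q \<partial>N) r \<partial>M) \<le> B) \<Longrightarrow>
      (\<integral>\<^sup>+x. ennpow (\<integral>\<^sup>+y. ennpow (\<integral>\<^sup>+i. ennreal (c i) * a i y x \<partial>count_space UNIV) q \<partial>N) r \<partial>M) \<le> ennreal C * B"
proof -
  define d where "d i = c i powr min 1 q" for i
  have "(\<integral>\<^sup>+i. ennreal (c i) \<partial>count_space UNIV) < \<infinity>"
    using fin[of 1] c by (simp add: abs_of_pos)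
  from ennpow_weighted_sum[OF countableI_type q c this] obtain C1 where C1: "C1 > 0"
    "\<And>x. ennpow (\<integral>\<^sup>+i. ennreal (c i) * x i \<partial>count_space UNIV) q \<le>
      ennreal C1 * (\<integral>\<^sup>+i. ennreal (d i) * ennpow (x i) q \<partial>count_space UNIV)"
    by (auto simp: d_def)
  have d: "0 < d i" for i using c[of i] by (simp add: d_def)
  have dfin: "(\<integral>\<^sup>+i. ennreal (d i powr e) \<partial>count_space UNIV) < top" if "0 < e" for e
    using fin[of "min 1 q * e"] that q by (simp add: d_def powr_powr)
  show ?thesis
  proof (rule superposition_Lp[where ?'x = 'x, OF r d dfin])
    fix C2 assume C2: "0 < C2"
      "\<And>(M :: 'x measure) (a :: 'i \<Rightarrow> 'x \<Rightarrow> ennreal) B. (\<And>i. a i \<in> borel_measurable M) \<Longrightarrow>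
        (\<And>i. (\<integral>\<^sup>+x. ennpow (a i x) r \<partial>M) \<le> B) \<Longrightarrow>
        (\<integral>\<^sup>+x. ennpow (\<integral>\<^sup>+i. ennreal (d i) * a i x \<partial>count_space UNIV) r \<partial>M) \<le> ennreal C2 * B"
    show ?thesis
    proof (rule that[of "C1 powr r * C2"])
      fix M :: "'x measure" and N :: "'y measure" and a :: "'i \<Rightarrow> 'y \<Rightarrow> 'x \<Rightarrow> ennreal" and B
      assume [measurable]: "\<And>i x. (\<lambda>y. a i y x) \<in> borel_measurable N"
        "\<And>i. (\<lambda>x. \<integral>\<^sup>+y. ennpow (a i y x) q \<partial>N) \<in> borel_measurable M"
        and B: "\<And>i. (\<integral>\<^sup>+x. ennpow (\<integral>\<^sup>+y. ennpow (a i y x) q \<partial>N) r \<partial>M) \<le> B"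
      have "(\<integral>\<^sup>+y. ennpow (\<integral>\<^sup>+i. ennreal (c i) * a i y x \<partial>count_space UNIV) q \<partial>N) \<le>
          ennreal C1 * (\<integral>\<^sup>+i. ennreal (d i) * (\<integral>\<^sup>+y. ennpow (a i y x) q \<partial>N) \<partial>count_space UNIV)" for x
      proof -
        have "(\<integral>\<^sup>+y. ennpow (\<integral>\<^sup>+i. ennreal (c i) * a i y x \<partial>count_space UNIV) q \<partial>N) \<le>
          (\<integral>\<^sup>+y. ennreal C1 * (\<integral>\<^sup>+i. ennreal (d i) * ennpow (a i y x) q \<partial>count_space UNIV) \<partial>N)"
          by (intro nn_integral_mono C1)
        also have "\<dots> = ennreal C1 * (\<integral>\<^sup>+y. (\<integral>\<^sup>+i. ennreal (d i) * ennpow (a i y x) q \<partial>count_space UNIV) \<partial>N)"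
          by (rule nn_integral_cmult) measurable
        also have "\<dots> = ennreal C1 * (\<integral>\<^sup>+i. ennreal (d i) * (\<integral>\<^sup>+y. ennpow (a i y x) q \<partial>N) \<partial>count_space UNIV)"
          by (subst nn_integral_count_space_nn_integral) (auto simp: nn_integral_cmult)
        finally show ?thesis .
      qed
      then have "(\<integral>\<^sup>+x. ennpow (\<integral>\<^sup>+y. ennpow (\<integral>\<^sup>+i. ennreal (c i) * a i y x \<partial>count_space UNIV) q \<partial>N) r \<partial>M) \<le>
        (\<integral>\<^sup>+x. ennpow (ennreal C1 * (\<integral>\<^sup>+i. ennreal (d i) * (\<integral>\<^sup>+y. ennpow (a i y x) q \<partial>N) \<partial>count_space UNIV)) r \<partial>M)"
        by (intro nn_integral_mono ennpow_mono r)
      also have "\<dots> = ennreal (C1 powr r) *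
          (\<integral>\<^sup>+x. ennpow (\<integral>\<^sup>+i. ennreal (d i) * (\<integral>\<^sup>+y. ennpow (a i y x) q \<partial>N) \<partial>count_space UNIV) r \<partial>M)"
        using C1 by (simp add: ennpow_mult ennpow_ennreal nn_integral_cmult)
      also have "\<dots> \<le> ennreal (C1 powr r) * (ennreal C2 * B)"
        using B by (intro mult_left_mono C2) auto
      also have "\<dots> = ennreal (C1 powr r * C2) * B"
        using C1 C2 by (simp add: ennreal_mult mult.assoc)
      finally show "(\<integral>\<^sup>+x. ennpow (\<integral>\<^sup>+y. ennpow (\<integral>\<^sup>+i. ennreal (c i) * a i y x \<partial>count_space UNIV) q \<partial>N) r \<partial>M) \<le>
        ennreal (C1 powr r * C2) * B" .
    qed (use C1 C2 in auto)
  qed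
qed

section \<open>Shifted dyadic grids\<close>

definition grid_shift :: "int \<Rightarrow> real" where
  "grid_shift m = (if even m then 1 / 3 else - 1 / 3)"

text \<open>A cell is represented by its integer index, so that sharing a cell is an equation.
  \<open>\<sigma>\<close> marks the coordinates that are shifted, which makes 2^n grids.\<close>

definition grid_cell :: "('n \<Rightarrow> bool) \<Rightarrow> int \<Rightarrow> real ^ 'n \<Rightarrow> int ^ 'n" where
  "grid_cell \<sigma> m x = (\<chi> i. \<lfloor>2 powi m * x $ i + (if \<sigma> i then grid_shift m else 0)\<rfloor>)"

definition grid_kernel :: "('n \<Rightarrow> bool) \<Rightarrow> int \<Rightarrow> real ^ 'n \<Rightarrow> real ^ 'n \<Rightarrow> ennreal" where
  "grid_kernel \<sigma> m x y = ennreal ((2 powi m) ^ CARD('n)) * of_bool (grid_cell \<sigma> m x = grid_cell \<sigma> m y)"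

definition grid_avg :: "('n \<Rightarrow> bool) \<Rightarrow> int \<Rightarrow> (real ^ 'n \<Rightarrow> ennreal) \<Rightarrow> real ^ 'n \<Rightarrow> ennreal" where
  "grid_avg \<sigma> m f x = (\<integral>\<^sup>+y. grid_kernel \<sigma> m x y * f y \<partial>lborel)"

lemma borel_measurable_vec_nth [measurable]: "(\<lambda>x :: real ^ 'n. x $ i) \<in> borel_measurable borel"
  by (intro borel_measurable_continuous_onI continuous_intros)

lemma grid_cell_eq_iff:
  "grid_cell \<sigma> m x = grid_cell \<sigma> m y \<longleftrightarrow>
    (\<forall>i. \<lfloor>2 powi m * x $ i + (if \<sigma> i then grid_shift m else 0)\<rfloor> =
         \<lfloor>2 powi m * y $ i + (if \<sigma> i then grid_shift m else 0)\<rfloor>)"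
  by (simp add: grid_cell_def vec_eq_iff)

lemma grid_kernel_measurable [measurable]:
  "(\<lambda>(x, y). grid_kernel \<sigma> m x y) \<in> borel_measurable (lborel \<Otimes>\<^sub>M lborel)"
  unfolding grid_kernel_def grid_cell_eq_iff by measurable

text \<open>The alternating sign of the shift makes the shifted grids nested.\<close>

lemma floor_shift_half:
  fixes x y :: real and m :: int
  assumes "\<lfloor>2 powi (m + 1) * x + (if b then grid_shift (m + 1) else 0)\<rfloor> =
    \<lfloor>2 powi (m + 1) * y + (if b then grid_shift (m + 1) else 0)\<rfloor>"
  shows "\<lfloor>2 powi m * x + (if b then grid_shift m else 0)\<rfloor> =
    \<lfloor>2 powi m * y + (if b then grid_shift m else 0)\<rfloor>"
proof -
  \<comment> \<open>Halving reproduces the shift of the coarser level up to an integer: 1/3 = (-1/3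
    + 1) / 2 and -1/3 = (1/3 - 1) / 2. The floor at the coarser level is therefore a function of the
    floor at the finer one.\<close>
  define s :: int where "s = (if b then (if even m then 1 else - 1) else 0)"
  have half: "2 powi m * z + (if b then grid_shift m else 0) =
      (2 powi (m + 1) * z + (if b then grid_shift (m + 1) else 0) + of_int s) / of_int 2" for z :: real
    by (cases b; cases "even m") (simp_all add: s_def grid_shift_def power_int_add add_divide_distrib)
  have floor: "\<lfloor>(w + of_int s) / of_int 2\<rfloor> = (\<lfloor>w\<rfloor> + s) div 2" for w :: real
    using floor_divide_real_eq_div[of 2 "w + of_int s"] by simp
  show ?thesis
    unfolding half floor assms ..
qed

lemma grid_cell_nested:
  assumes "m' \<le> m" "grid_cell \<sigma> m x = grid_cell \<sigma> m y"
  shows "grid_cell \<sigma> m' x = grid_cell \<sigma> m' y"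
proof -
  have "grid_cell \<sigma> (m - int k) x = grid_cell \<sigma> (m - int k) y" for k
  proof (induction k)
    case (Suc k)
    have eq: "m - int (Suc k) + 1 = m - int k" by simp
    show ?case
      unfolding grid_cell_eq_iff
      by (intro allI, rule floor_shift_half) (use Suc in \<open>simp only: eq grid_cell_eq_iff\<close>)
  qed (use assms in simp)
  from this[of "nat (m - m')"] assms(1) show ?thesis by simp
qed

lemma grid_kernel_mass:
  fixes x :: "real ^ 'n"
  shows "(\<integral>\<^sup>+y. grid_kernel \<sigma> m x y \<partial>lborel) \<le> 1"
proof -
  define c :: real where "c = 2 powi m"
  have c: "c > 0" by (simp add: c_def)
  define s where "s i = (if \<sigma> i then grid_shift m else 0)" for i
  define l :: "real ^ 'n" where "l = (\<chi> i. (of_int (grid_cell \<sigma> m x $ i) - s i) / c)"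
  have sub: "{y. grid_cell \<sigma> m x = grid_cell \<sigma> m y} \<subseteq> cbox l (l + (\<chi> i. 1 / c))"
  proof
    fix y assume "y \<in> {y. grid_cell \<sigma> m x = grid_cell \<sigma> m y}"
    then have "grid_cell \<sigma> m x $ i = \<lfloor>c * y $ i + s i\<rfloor>" for i
      by (simp add: grid_cell_def c_def s_def)
    then have "of_int (grid_cell \<sigma> m x $ i) \<le> c * y $ i + s i"
      "c * y $ i + s i < of_int (grid_cell \<sigma> m x $ i) + 1" for i
      by (simp_all add: floor_correct)
    then show "y \<in> cbox l (l + (\<chi> i. 1 / c))"
      using c by (auto simp: mem_box_cart l_def field_simps less_imp_le add_increasing algebra_simps)
  qed
  have "(\<integral>\<^sup>+y. grid_kernel \<sigma> m x y \<partial>lborel) \<le>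
      (\<integral>\<^sup>+y. ennreal (c ^ CARD('n)) * indicator (cbox l (l + (\<chi> i. 1 / c))) y \<partial>lborel)"
    unfolding grid_kernel_def c_def[symmetric] using sub
    by (intro nn_integral_mono mult_left_mono) (auto simp: indicator_def)
  also have "\<dots> = ennreal (c ^ CARD('n)) * emeasure lborel (cbox l (l + (\<chi> i. 1 / c)))"
    by (simp add: nn_integral_cmult)
  also have "emeasure lborel (cbox l (l + (\<chi> i. 1 / c))) = ennreal ((1 / c) ^ CARD('n))"
  proof -
    have "((\<chi> i. 1 / c) :: real ^ 'n) \<bullet> b = 1 / c" if "b \<in> Basis" for b
      using that by (auto simp: Basis_vec_def inner_axis)
    then show ?thesis
      using c by (subst emeasure_lborel_cbox) (auto simp: inner_add_left)
  qed
  also have "ennreal (c ^ CARD('n)) * ennreal ((1 / c) ^ CARD('n)) = 1"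
    using c by (simp add: power_one_over flip: ennreal_mult)
  finally show ?thesis .
qed

text \<open>The offset \<open>m\<close> lets the natural-number levels of the locale start at any
  integer level.\<close>

lemma nested_kernels_grid:
  "nested_kernels (lborel :: (real ^ 'n) measure) (\<lambda>k. grid_kernel \<sigma> (int k + m))"
proof (intro nested_kernels.intro sigma_finite_lborel nested_kernels_axioms.intro)
  show "grid_kernel \<sigma> (int k + m) x y = grid_kernel \<sigma> (int k + m) y x" for k x y
    by (auto simp: grid_kernel_def)
  show "grid_kernel \<sigma> (int j + m) x z = grid_kernel \<sigma> (int j + m) y z"
    if "j \<le> k" "grid_kernel \<sigma> (int k + m) x y \<noteq> 0" for j k x y z
    using that grid_cell_nested[of "int j + m" "int k + m" \<sigma> x y] by (auto simp: grid_kernel_def)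
qed (simp_all add: grid_kernel_mass)

lemma grid_avg_eq_E:
  "nested_kernels.E lborel (\<lambda>k. grid_kernel \<sigma> (int k + m)) k f = grid_avg \<sigma> (int k + m) f"
  using nested_kernels.E_def[OF nested_kernels_grid] by (auto simp: grid_avg_def fun_eq_iff)

lemma grid_avg_measurable [measurable (raw)]:
  assumes "f \<in> borel_measurable lborel"
  shows "grid_avg \<sigma> m f \<in> borel_measurable lborel"
  using nested_kernels.E_measurable[OF nested_kernels_grid assms, of \<sigma> m 0]
  by (simp add: grid_avg_eq_E)

lemma nn_integral_grid_avg_le:
  assumes "1 \<le> p" "f \<in> borel_measurable lborel"
  shows "(\<integral>\<^sup>+x. ennpow (grid_avg \<sigma> m f x) p \<partial>lborel) \<le> (\<integral>\<^sup>+x. ennpow (f x) p \<partial>lborel)"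
  using nested_kernels.nn_integral_ennpow_E_le[OF nested_kernels_grid assms, of \<sigma> m 0]
  by (simp add: grid_avg_eq_E)

section \<open>From finitely many levels to all integers\<close>

lemma sum_nat_eq_sum_int:
  fixes f :: "int \<Rightarrow> 'b::comm_monoid_add"
  shows "(\<Sum>k<2 * N. f (int k - int N)) = sum f {- int N..<int N}"
  by (rule sum.reindex_bij_witness[of _ "\<lambda>j. nat (j + int N)" "\<lambda>k. int k - int N"]) auto

lemma finite_int_subset_interval:
  assumes "finite (F :: int set)"
  shows "\<exists>N. F \<subseteq> {- int N..<int N}"
proof (intro exI subsetI)
  fix j assume "j \<in> F"
  then have "\<bar>j\<bar> \<le> (\<Sum>j\<in>F. \<bar>j\<bar>)" using assms by (intro member_le_sum) auto
  then show "j \<in> {- int (nat (1 + (\<Sum>j\<in>F. \<bar>j\<bar>)))..<int (nat (1 + (\<Sum>j\<in>F. \<bar>j\<bar>)))}" by auto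
qed

lemma nn_integral_int_eq_SUP:
  "(\<integral>\<^sup>+j. f j \<partial>count_space UNIV) = (SUP N. \<Sum>k<2 * N. f (int k - int N))"
  unfolding sum_nat_eq_sum_int nn_integral_count_space_eq_SUP[OF countableI_type]
proof (rule SUP_eq)
  fix F :: "int set" assume "F \<in> {F. finite F \<and> F \<subseteq> UNIV}"
  then obtain N where "F \<subseteq> {- int N..<int N}" using finite_int_subset_interval[of F] by auto
  then show "\<exists>N\<in>UNIV. sum f F \<le> sum f {- int N..<int N}"
    by (auto intro!: exI[of _ N] sum_mono2)
qed auto

lemma SUP_int_eq_SUP:
  fixes f :: "int \<Rightarrow> ennreal"
  shows "(SUP j. f j) = (SUP N. SUP k\<in>{..<2 * N}. f (int k - int N))"
proof (rule antisym)
  show "(SUP j. f j) \<le> (SUP N. SUP k\<in>{..<2 * N}. f (int k - int N))"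
  proof (rule SUP_least)
    fix j :: int
    define N where "N = nat (\<bar>j\<bar> + 1)"
    have "f j = f (int (nat (j + int N)) - int N)" "nat (j + int N) < 2 * N"
      by (auto simp: N_def)
    then have "f j \<le> (SUP k\<in>{..<2 * N}. f (int k - int N))"
      by (metis SUP_upper lessThan_iff)
    also have "\<dots> \<le> (SUP N. SUP k\<in>{..<2 * N}. f (int k - int N))"
      by (intro SUP_upper) auto
    finally show "f j \<le> (SUP N. SUP k\<in>{..<2 * N}. f (int k - int N))" .
  qed
qed (intro SUP_least SUP_upper, auto)

lemma incseq_sum_int:
  fixes f :: "int \<Rightarrow> ennreal"
  shows "incseq (\<lambda>N. \<Sum>k<2 * N. f (int k - int N))"
  unfolding sum_nat_eq_sum_int by (intro monoI sum_mono2) auto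

lemma incseq_SUP_int:
  fixes f :: "int \<Rightarrow> ennreal"
  shows "incseq (\<lambda>N. SUP k\<in>{..<2 * N}. f (int k - int N))"
proof (intro monoI SUP_least)
  fix N N' :: nat and k assume "N \<le> N'" "k \<in> {..<2 * N}"
  then show "f (int k - int N) \<le> (SUP k\<in>{..<2 * N'}. f (int k - int N'))"
    by (intro SUP_upper2[of "k + (N' - N)"]) auto
qed

text \<open>Each window of 2 * N levels is an instance of the locale with coarsest level m - N. Its
  constant does not depend on N, so monotone convergence exhausts the integers.\<close>

lemma nn_integral_lq_grid_avg_le:
  fixes h :: "int \<Rightarrow> real ^ 'n \<Rightarrow> ennreal"
  assumes pq: "1 < p" "1 < q" and [measurable]: "\<And>j. h j \<in> borel_measurable lborel"
  shows "(\<integral>\<^sup>+x. ennpow (\<integral>\<^sup>+j. ennpow (grid_avg \<sigma> (j + m) (h j) x) q \<partial>count_space UNIV) (p / q) \<partial>lborel) \<le>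
    ennreal (lq_const p q) *
    (\<integral>\<^sup>+x. ennpow (\<integral>\<^sup>+j. ennpow (h j x) q \<partial>count_space UNIV) (p / q) \<partial>lborel)" (is "?L \<le> ?R")
proof -
  let ?S = "\<lambda>N x. \<Sum>k<2 * N. ennpow (grid_avg \<sigma> (int k - int N + m) (h (int k - int N)) x) q"
  have pq': "0 < p / q" using pq by simp
  have "?L = (\<integral>\<^sup>+x. (SUP N. ennpow (?S N x) (p / q)) \<partial>lborel)"
    using pq' by (simp add: nn_integral_int_eq_SUP ennpow_SUP)
  also have "\<dots> = (SUP N. \<integral>\<^sup>+x. ennpow (?S N x) (p / q) \<partial>lborel)"
  proof (intro nn_integral_monotone_convergence_SUP)
    show "incseq (\<lambda>N x. ennpow (?S N x) (p / q))"
      using incseqD[OF incseq_sum_int] pq' by (intro monoI le_funI ennpow_mono) auto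
  qed measurable
  also have "\<dots> \<le> ?R"
  proof (rule SUP_least)
    fix N
    interpret K: nested_kernels "lborel :: (real ^ 'n) measure" "\<lambda>k. grid_kernel \<sigma> (int k + (m - int N))"
      by (rule nested_kernels_grid)
    have eq: "int k + (m - int N) = int k - int N + m" for k by simp
    have "(\<integral>\<^sup>+x. ennpow (?S N x) (p / q) \<partial>lborel) \<le>
      ennreal (lq_const p q) * (\<integral>\<^sup>+x. ennpow (\<Sum>k<2 * N. ennpow (h (int k - int N) x) q) (p / q) \<partial>lborel)"
      using K.nn_integral_lq_E_le[OF pq, of "\<lambda>k. h (int k - int N)" "2 * N"]
      unfolding grid_avg_eq_E unfolding eq by simp
    also have "\<dots> \<le> ?R"
      using pq' by (intro mult_left_mono nn_integral_mono ennpow_mono)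
        (auto simp: nn_integral_int_eq_SUP intro: SUP_upper)
    finally show "(\<integral>\<^sup>+x. ennpow (?S N x) (p / q) \<partial>lborel) \<le> ?R" .
  qed
  finally show ?thesis .
qed

lemma nn_integral_SUP_grid_avg_le:
  fixes h :: "int \<Rightarrow> real ^ 'n \<Rightarrow> ennreal"
  assumes p: "1 < p" and [measurable]: "\<And>j. h j \<in> borel_measurable lborel"
  shows "(\<integral>\<^sup>+x. ennpow (SUP j. grid_avg \<sigma> (j + m) (h j) x) p \<partial>lborel) \<le>
    ennreal (SUP_const p) * (\<integral>\<^sup>+x. ennpow (SUP j. h j x) p \<partial>lborel)" (is "?L \<le> ?R")
proof -
  let ?S = "\<lambda>N x. SUP k\<in>{..<2 * N}. grid_avg \<sigma> (int k - int N + m) (h (int k - int N)) x"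
  have "?L = (\<integral>\<^sup>+x. (SUP N. ennpow (?S N x) p) \<partial>lborel)"
    using p by (simp only: SUP_int_eq_SUP ennpow_SUP)
  also have "\<dots> = (SUP N. \<integral>\<^sup>+x. ennpow (?S N x) p \<partial>lborel)"
  proof (intro nn_integral_monotone_convergence_SUP)
    show "incseq (\<lambda>N x. ennpow (?S N x) p)"
      using incseqD[OF incseq_SUP_int] p by (intro monoI le_funI ennpow_mono) auto
  qed measurable
  also have "\<dots> \<le> ?R"
  proof (rule SUP_least)
    fix N
    interpret K: nested_kernels "lborel :: (real ^ 'n) measure" "\<lambda>k. grid_kernel \<sigma> (int k + (m - int N))"
      by (rule nested_kernels_grid)
    have eq: "int k + (m - int N) = int k - int N + m" for k by simp
    have "(\<integral>\<^sup>+x. ennpow (?S N x) p \<partial>lborel) \<le>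
      ennreal (SUP_const p) * (\<integral>\<^sup>+x. ennpow (SUP k\<in>{..<2 * N}. h (int k - int N) x) p \<partial>lborel)"
      using K.nn_integral_SUP_E_le[OF p, of "\<lambda>k. h (int k - int N)" "2 * N"]
      unfolding grid_avg_eq_E unfolding eq by simp
    also have "\<dots> \<le> ?R"
      using p by (intro mult_left_mono nn_integral_mono ennpow_mono SUP_least SUP_upper) auto
    finally show "(\<integral>\<^sup>+x. ennpow (?S N x) p \<partial>lborel) \<le> ?R" .
  qed
  finally show ?thesis .
qed

section \<open>The smoothing operator\<close>

text \<open>In the index (d, l, \<sigma>), d is the source level minus the target level, l the
  rounded binary logarithm of the distance measured in sides of the larger cube, and \<sigma> the
  grid. The grids are finite in number and get no decay.\<close>

definition decay :: "real \<Rightarrow> int \<times> nat \<times> ('n::finite \<Rightarrow> bool) \<Rightarrow> real" where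
  "decay \<delta> = (\<lambda>(d, l, \<sigma>). 2 powr (- \<delta> * (\<bar>of_int d\<bar> + real l)))"

lemma decay_pos [simp]: "0 < decay \<delta> \<tau>"
  by (simp add: decay_def split: prod.split)

lemma decay_powr: "decay \<delta> \<tau> powr e = decay (\<delta> * e) \<tau>"
  by (simp add: decay_def powr_powr mult_ac split: prod.split)

lemma nn_integral_geometric_nat:
  assumes "0 < \<delta>"
  shows "(\<integral>\<^sup>+l. ennreal (2 powr (- \<delta> * real l)) \<partial>count_space UNIV) < top"
proof -
  have eq: "2 powr (- \<delta> * real l) = (2 powr - \<delta>) ^ l" for l
    by (simp add: powr_powr flip: powr_realpow)
  have "2 powr - \<delta> < (1 :: real)" using assms by (simp add: powr_less_one)
  then have "summable (\<lambda>l. 2 powr (- \<delta> * real l))"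
    unfolding eq by (intro summable_geometric) simp
  then show ?thesis
    unfolding nn_integral_count_space_nat by (simp add: suminf_ennreal2 less_top)
qed

text \<open>Sum over l = \<bar>d\<bar> instead; at most two integers share an absolute
  value.\<close>

lemma nn_integral_geometric_int:
  assumes "0 < \<delta>"
  shows "(\<integral>\<^sup>+d. ennreal (2 powr (- \<delta> * \<bar>of_int d\<bar>)) \<partial>count_space (UNIV :: int set)) < top"
proof -
  let ?g = "\<integral>\<^sup>+l. ennreal (2 powr (- \<delta> * real l)) \<partial>count_space UNIV"
  have "(\<integral>\<^sup>+d. ennreal (2 powr (- \<delta> * \<bar>of_int d\<bar>)) \<partial>count_space (UNIV :: int set)) \<le>
      (\<integral>\<^sup>+d. (\<integral>\<^sup>+l. ennreal (2 powr (- \<delta> * real l)) * indicator {int l, - int l} d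
        \<partial>count_space UNIV) \<partial>count_space UNIV)"
  proof (intro nn_integral_mono)
    fix d :: int
    have "d = int (nat \<bar>d\<bar>) \<or> d = - int (nat \<bar>d\<bar>)" by arith
    moreover have "\<bar>real_of_int d\<bar> = real (nat \<bar>d\<bar>)" by simp
    ultimately have "ennreal (2 powr (- \<delta> * \<bar>of_int d\<bar>)) =
        ennreal (2 powr (- \<delta> * real (nat \<bar>d\<bar>))) * indicator {int (nat \<bar>d\<bar>), - int (nat \<bar>d\<bar>)} d"
      by (simp only: indicator_def) simp
    also have "\<dots> \<le> (\<integral>\<^sup>+l. ennreal (2 powr (- \<delta> * real l)) * indicator {int l, - int l} d
        \<partial>count_space UNIV)"
      by (rule nn_integral_ge_point) simp
    finally show "ennreal (2 powr (- \<delta> * \<bar>of_int d\<bar>)) \<le> \<dots>" .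
  qed
  also have "\<dots> = (\<integral>\<^sup>+l. (\<integral>\<^sup>+d. ennreal (2 powr (- \<delta> * real l)) * indicator {int l, - int l} d
        \<partial>count_space UNIV) \<partial>count_space UNIV)"
    by (intro nn_integral_count_space_nn_integral) auto
  also have "\<dots> \<le> (\<integral>\<^sup>+l. ennreal (2 powr (- \<delta> * real l)) * 2 \<partial>count_space UNIV)"
  proof (intro nn_integral_mono)
    fix l
    have "card {int l, - int l} \<le> 2" by (simp add: card_insert_if)
    then have "(of_nat (card {int l, - int l}) :: ennreal) \<le> of_nat 2"
      by (simp only: of_nat_le_iff)
    then show "(\<integral>\<^sup>+d. ennreal (2 powr (- \<delta> * real l)) * indicator {int l, - int l} d
        \<partial>count_space UNIV) \<le> ennreal (2 powr (- \<delta> * real l)) * 2"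
      by (simp add: nn_integral_cmult mult_left_mono)
  qed
  also have "\<dots> = ?g * 2" by (simp add: nn_integral_multc)
  also have "\<dots> < top" using nn_integral_geometric_nat[OF assms] by (simp add: ennreal_mult_less_top)
  finally show ?thesis .
qed

lemma nn_integral_decay:
  assumes "0 < \<delta>"
  shows "(\<integral>\<^sup>+\<tau>. ennreal (decay \<delta> (\<tau> :: int \<times> nat \<times> ('n::finite \<Rightarrow> bool))) \<partial>count_space UNIV) < top"
proof -
  let ?D = "\<lambda>d :: int. ennreal (2 powr (- \<delta> * \<bar>of_int d\<bar>))"
  let ?L = "\<lambda>l :: nat. ennreal (2 powr (- \<delta> * real l))"
  have "(\<integral>\<^sup>+\<tau>. ennreal (decay \<delta> (\<tau> :: int \<times> nat \<times> ('n::finite \<Rightarrow> bool))) \<partial>count_space UNIV) =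
      (\<integral>\<^sup>+d. \<integral>\<^sup>+l. \<integral>\<^sup>+\<sigma>. ?D d * ?L l \<partial>count_space (UNIV :: ('n \<Rightarrow> bool) set)
        \<partial>count_space UNIV \<partial>count_space UNIV)"
    unfolding nn_integral_fst_count_space[symmetric]
    by (simp add: decay_def algebra_simps powr_add powr_diff powr_minus ennreal_mult' divide_inverse
        del: nn_integral_const)
  also have "\<dots> = (\<integral>\<^sup>+d. ?D d * ((\<integral>\<^sup>+l. ?L l \<partial>count_space UNIV) * of_nat (card (UNIV :: ('n \<Rightarrow> bool) set)))
        \<partial>count_space UNIV)"
    by (simp add: nn_integral_cmult nn_integral_multc mult.assoc)
  also have "\<dots> = (\<integral>\<^sup>+d. ?D d \<partial>count_space UNIV) *
      ((\<integral>\<^sup>+l. ?L l \<partial>count_space UNIV) * of_nat (card (UNIV :: ('n \<Rightarrow> bool) set)))"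
    by (rule nn_integral_multc) simp
  also have "\<dots> < top"
    using nn_integral_geometric_int[OF assms] nn_integral_geometric_nat[OF assms]
    by (simp add: ennreal_mult_less_top of_nat_less_top)
  finally show ?thesis .
qed

lemma nn_integral_decay_powr:
  assumes "0 < \<delta>" "0 < e"
  shows "(\<integral>\<^sup>+\<tau>. ennreal (decay \<delta> (\<tau> :: int \<times> nat \<times> ('n::finite \<Rightarrow> bool)) powr e) \<partial>count_space UNIV) < top"
  unfolding decay_powr using assms by (intro nn_integral_decay) simp

text \<open>\<open>min j (j + d)\<close> is the level of the larger cube. Going l levels up covers
  the distance to the other cube, and two further levels provide the margin 1/4 of the one-third
  trick.\<close>

definition smoothing_term ::
  "(int \<Rightarrow> real ^ 'n \<Rightarrow> ennreal) \<Rightarrow> int \<times> nat \<times> ('n \<Rightarrow> bool) \<Rightarrow> int \<Rightarrow> real ^ 'n \<Rightarrow> ennreal" where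
  "smoothing_term h = (\<lambda>(d, l, \<sigma>) j. grid_avg \<sigma> (min j (j + d) - int l - 2) (h (j + d)))"

definition smoothing :: "real \<Rightarrow> (int \<Rightarrow> real ^ 'n \<Rightarrow> ennreal) \<Rightarrow> int \<Rightarrow> real ^ 'n \<Rightarrow> ennreal" where
  "smoothing \<delta> h j x = (\<integral>\<^sup>+\<tau>. ennreal (decay \<delta> \<tau>) * smoothing_term h \<tau> j x \<partial>count_space UNIV)"

text \<open>Seen from the source level j + d, the averaging level differs by an offset that does not
  depend on j. After a translation of j every term has the form already bounded, with a constant
  free of d, l and \<sigma>.\<close>

lemma smoothing_term_shift:
  "smoothing_term h (d, l, \<sigma>) j = grid_avg \<sigma> ((j + d) + (min (- d) 0 - int l - 2)) (h (j + d))"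
proof -
  have "min j (j + d) - int l - 2 = (j + d) + (min (- d) 0 - int l - 2)" by (simp add: min_def)
  then show ?thesis by (simp only: smoothing_term_def prod.case)
qed

lemma smoothing_term_measurable [measurable]:
  assumes "\<And>j. h j \<in> borel_measurable lborel"
  shows "smoothing_term h \<tau> j \<in> borel_measurable lborel"
  unfolding smoothing_term_def using grid_avg_measurable[OF assms] by (cases \<tau>) simp

lemma smoothing_measurable [measurable]:
  assumes [measurable]: "\<And>j. h j \<in> borel_measurable lborel"
  shows "smoothing \<delta> h j \<in> borel_measurable lborel"
  unfolding smoothing_def by measurable

lemma nn_integral_int_shift:
  "(\<integral>\<^sup>+j. f (j + d) \<partial>count_space UNIV) = (\<integral>\<^sup>+j. f j \<partial>count_space (UNIV :: int set))"
  by (rule nn_integral_bij_count_space) (auto intro: bij_betw_byWitness[where f' = "\<lambda>j. j - d"])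

lemma SUP_int_shift: "(SUP j :: int. f (j + d)) = (SUP j. f j :: ennreal)"
proof (rule antisym)
  show "(SUP j. f j) \<le> (SUP j. f (j + d))"
  proof (rule SUP_least)
    fix j
    show "f j \<le> (SUP j. f (j + d))"
      using SUP_upper[of "j - d" UNIV "\<lambda>j. f (j + d)"] by simp
  qed
  show "(SUP j. f (j + d)) \<le> (SUP j. f j)"
    by (rule SUP_least, rule SUP_upper[of _ UNIV f], rule UNIV_I)
qed

lemma smoothing_lq:
  assumes \<delta>: "0 < \<delta>" and pq: "1 < p" "1 < q"
  obtains C where "0 < C"
    "\<And>h :: int \<Rightarrow> real ^ 'n \<Rightarrow> ennreal. (\<And>j. h j \<in> borel_measurable lborel) \<Longrightarrow>
      (\<integral>\<^sup>+x. ennpow (\<integral>\<^sup>+j. ennpow (smoothing \<delta> h j x) q \<partial>count_space UNIV) (p / q) \<partial>lborel) \<le>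
      ennreal C * (\<integral>\<^sup>+x. ennpow (\<integral>\<^sup>+j. ennpow (h j x) q \<partial>count_space UNIV) (p / q) \<partial>lborel)"
proof (rule superposition_mixed[where c = "decay \<delta> :: int \<times> nat \<times> ('n \<Rightarrow> bool) \<Rightarrow> real"
      and ?'x = "real ^ 'n" and ?'y = int and q = q and r = "p / q"])
  fix C
  assume C: "0 < C" "\<And>(M :: (real ^ 'n) measure) (N :: int measure)
      (a :: int \<times> nat \<times> ('n \<Rightarrow> bool) \<Rightarrow> int \<Rightarrow> real ^ 'n \<Rightarrow> ennreal) B.
      (\<And>i x. (\<lambda>y. a i y x) \<in> borel_measurable N) \<Longrightarrow>
      (\<And>i. (\<lambda>x. \<integral>\<^sup>+y. ennpow (a i y x) q \<partial>N) \<in> borel_measurable M) \<Longrightarrow>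
      (\<And>i. (\<integral>\<^sup>+x. ennpow (\<integral>\<^sup>+y. ennpow (a i y x) q \<partial>N) (p / q) \<partial>M) \<le> B) \<Longrightarrow>
      (\<integral>\<^sup>+x. ennpow (\<integral>\<^sup>+y. ennpow (\<integral>\<^sup>+i. ennreal (decay \<delta> i) * a i y x \<partial>count_space UNIV) q \<partial>N) (p / q) \<partial>M)
        \<le> ennreal C * B"
  show ?thesis
  proof (rule that[of "C * lq_const p q"])
    fix h :: "int \<Rightarrow> real ^ 'n \<Rightarrow> ennreal"
    assume [measurable]: "\<And>j. h j \<in> borel_measurable lborel"
    let ?B = "ennreal (lq_const p q) *
      (\<integral>\<^sup>+x. ennpow (\<integral>\<^sup>+j. ennpow (h j x) q \<partial>count_space UNIV) (p / q) \<partial>lborel)"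
    have "(\<integral>\<^sup>+x. ennpow (\<integral>\<^sup>+j. ennpow (smoothing_term h \<tau> j x) q \<partial>count_space UNIV) (p / q) \<partial>lborel) \<le> ?B" for \<tau>
    proof (cases \<tau>)
      case (fields d l \<sigma>)
      show ?thesis
        unfolding fields smoothing_term_shift
          nn_integral_int_shift[of "\<lambda>j. ennpow (grid_avg \<sigma> (j + _) (h j) _) q"]
        by (intro nn_integral_lq_grid_avg_le pq) measurable
    qed
    then have "(\<integral>\<^sup>+x. ennpow (\<integral>\<^sup>+j. ennpow (smoothing \<delta> h j x) q \<partial>count_space UNIV) (p / q) \<partial>lborel) \<le>
        ennreal C * ?B"
      unfolding smoothing_def by (intro C) measurable
    then show "(\<integral>\<^sup>+x. ennpow (\<integral>\<^sup>+j. ennpow (smoothing \<delta> h j x) q \<partial>count_space UNIV) (p / q) \<partial>lborel) \<le>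
      ennreal (C * lq_const p q) * (\<integral>\<^sup>+x. ennpow (\<integral>\<^sup>+j. ennpow (h j x) q \<partial>count_space UNIV) (p / q) \<partial>lborel)"
      using C(1) lq_const_pos[OF pq] by (simp add: ennreal_mult mult.assoc)
  qed (use C(1) lq_const_pos[OF pq] in simp)
qed (use pq \<delta> nn_integral_decay_powr in auto)

text \<open>Both forms of q = \<infinity>. The supremum inside the integral serves Triebel--Lizorkin
  spaces and rests on the bound for suprema of nested averages; the one outside serves Besov spaces
  and rests on contractivity at a single level.\<close>

lemma smoothing_Lp:
  assumes \<delta>: "0 < \<delta>" and p: "1 < p"
  obtains C where "0 < C"
    "\<And>(h :: int \<Rightarrow> real ^ 'n \<Rightarrow> ennreal). (\<And>j. h j \<in> borel_measurable lborel) \<Longrightarrow>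
      (\<integral>\<^sup>+x. ennpow (SUP j. smoothing \<delta> h j x) p \<partial>lborel) \<le>
      ennreal C * (\<integral>\<^sup>+x. ennpow (SUP j. h j x) p \<partial>lborel)"
    "\<And>(h :: int \<Rightarrow> real ^ 'n \<Rightarrow> ennreal) j. (\<And>j. h j \<in> borel_measurable lborel) \<Longrightarrow>
      (\<integral>\<^sup>+x. ennpow (smoothing \<delta> h j x) p \<partial>lborel) \<le>
      ennreal C * (SUP j. \<integral>\<^sup>+x. ennpow (h j x) p \<partial>lborel)"
proof (rule superposition_Lp[where c = "decay \<delta> :: int \<times> nat \<times> ('n \<Rightarrow> bool) \<Rightarrow> real"
      and ?'x = "real ^ 'n" and p = p])
  fix C
  assume C: "0 < C" "\<And>(M :: (real ^ 'n) measure)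
      (a :: int \<times> nat \<times> ('n \<Rightarrow> bool) \<Rightarrow> real ^ 'n \<Rightarrow> ennreal) B.
      (\<And>i. a i \<in> borel_measurable M) \<Longrightarrow>
      (\<And>i. (\<integral>\<^sup>+x. ennpow (a i x) p \<partial>M) \<le> B) \<Longrightarrow>
      (\<integral>\<^sup>+x. ennpow (\<integral>\<^sup>+i. ennreal (decay \<delta> i) * a i x \<partial>count_space UNIV) p \<partial>M) \<le> ennreal C * B"
  define K where "K = C * max 1 (SUP_const p)"
  have K: "ennreal C * ennreal (SUP_const p) \<le> ennreal K" "C \<le> K"
    using C(1) by (auto simp: K_def simp flip: ennreal_mult' intro!: ennreal_leI mult_left_mono)
  show ?thesis
  proof (rule that[of K])
    show "0 < K" using C(1) by (simp add: K_def)
    fix h :: "int \<Rightarrow> real ^ 'n \<Rightarrow> ennreal"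
    assume [measurable]: "\<And>j. h j \<in> borel_measurable lborel"
    let ?B = "\<integral>\<^sup>+x. ennpow (SUP j. h j x) p \<partial>lborel"
    have B: "(\<integral>\<^sup>+x. ennpow (SUP j. smoothing_term h \<tau> j x) p \<partial>lborel) \<le> ennreal (SUP_const p) * ?B" for \<tau>
    proof (cases \<tau>)
      case (fields d l \<sigma>)
      show ?thesis
        unfolding fields smoothing_term_shift
          SUP_int_shift[of "\<lambda>j. grid_avg \<sigma> (j + _) (h j) _"]
        by (intro nn_integral_SUP_grid_avg_le p) measurable
    qed
    have "(\<integral>\<^sup>+x. ennpow (SUP j. smoothing \<delta> h j x) p \<partial>lborel) \<le>
      (\<integral>\<^sup>+x. ennpow (\<integral>\<^sup>+\<tau>. ennreal (decay \<delta> \<tau>) * (SUP j. smoothing_term h \<tau> j x) \<partial>count_space UNIV) p \<partial>lborel)"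
      unfolding smoothing_def using p
      by (intro nn_integral_mono ennpow_mono SUP_least mult_left_mono SUP_upper) auto
    also have "\<dots> \<le> ennreal C * (ennreal (SUP_const p) * ?B)"
      by (rule C(2)[OF _ B]) measurable
    also have "\<dots> \<le> ennreal K * ?B"
      using mult_right_mono[OF K(1)] by (simp add: mult.assoc)
    finally show "(\<integral>\<^sup>+x. ennpow (SUP j. smoothing \<delta> h j x) p \<partial>lborel) \<le> ennreal K * ?B" .
    fix j
    have "(\<integral>\<^sup>+x. ennpow (smoothing_term h \<tau> j x) p \<partial>lborel) \<le> (SUP j. \<integral>\<^sup>+x. ennpow (h j x) p \<partial>lborel)" for \<tau>
    proof (cases \<tau>)
      case (fields d l \<sigma>)
      show ?thesis
        unfolding fields smoothing_term_shift using p
        by (intro order.trans[OF nn_integral_grid_avg_le] SUP_upper) auto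
    qed
    then have "(\<integral>\<^sup>+x. ennpow (smoothing \<delta> h j x) p \<partial>lborel) \<le>
        ennreal C * (SUP j. \<integral>\<^sup>+x. ennpow (h j x) p \<partial>lborel)"
      unfolding smoothing_def by (intro C(2)) measurable
    also have "\<dots> \<le> ennreal K * (SUP j. \<integral>\<^sup>+x. ennpow (h j x) p \<partial>lborel)"
      by (intro mult_right_mono ennreal_leI K) auto
    finally show "(\<integral>\<^sup>+x. ennpow (smoothing \<delta> h j x) p \<partial>lborel) \<le>
        ennreal K * (SUP j. \<integral>\<^sup>+x. ennpow (h j x) p \<partial>lborel)" .
  qed
qed (use p \<delta> nn_integral_decay_powr in auto)

text \<open>The levels do not interact: each average contracts L^p by Jensen's inequality, so the
  outer exponent q may be any positive number, also below 1.\<close>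

lemma smoothing_besov:
  assumes \<delta>: "0 < \<delta>" and pq: "1 < p" "0 < q"
  obtains C where "0 < C"
    "\<And>h :: int \<Rightarrow> real ^ 'n \<Rightarrow> ennreal. (\<And>j. h j \<in> borel_measurable lborel) \<Longrightarrow>
      (\<integral>\<^sup>+j. ennpow (\<integral>\<^sup>+x. ennpow (smoothing \<delta> h j x) p \<partial>lborel) (q / p) \<partial>count_space UNIV) \<le>
      ennreal C * (\<integral>\<^sup>+j. ennpow (\<integral>\<^sup>+x. ennpow (h j x) p \<partial>lborel) (q / p) \<partial>count_space UNIV)"
proof (rule superposition_mixed[where c = "decay \<delta> :: int \<times> nat \<times> ('n \<Rightarrow> bool) \<Rightarrow> real"
      and ?'y = "real ^ 'n" and ?'x = int and q = p and r = "q / p"])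
  fix C
  assume C: "0 < C" "\<And>(M :: int measure) (N :: (real ^ 'n) measure)
      (a :: int \<times> nat \<times> ('n \<Rightarrow> bool) \<Rightarrow> real ^ 'n \<Rightarrow> int \<Rightarrow> ennreal) B.
      (\<And>i x. (\<lambda>y. a i y x) \<in> borel_measurable N) \<Longrightarrow>
      (\<And>i. (\<lambda>x. \<integral>\<^sup>+y. ennpow (a i y x) p \<partial>N) \<in> borel_measurable M) \<Longrightarrow>
      (\<And>i. (\<integral>\<^sup>+x. ennpow (\<integral>\<^sup>+y. ennpow (a i y x) p \<partial>N) (q / p) \<partial>M) \<le> B) \<Longrightarrow>
      (\<integral>\<^sup>+x. ennpow (\<integral>\<^sup>+y. ennpow (\<integral>\<^sup>+i. ennreal (decay \<delta> i) * a i y x \<partial>count_space UNIV) p \<partial>N) (q / p) \<partial>M)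
        \<le> ennreal C * B"
  show ?thesis
  proof (rule that[OF C(1)])
    fix h :: "int \<Rightarrow> real ^ 'n \<Rightarrow> ennreal"
    assume [measurable]: "\<And>j. h j \<in> borel_measurable lborel"
    let ?B = "\<integral>\<^sup>+j. ennpow (\<integral>\<^sup>+x. ennpow (h j x) p \<partial>lborel) (q / p) \<partial>count_space UNIV"
    have "(\<integral>\<^sup>+j. ennpow (\<integral>\<^sup>+x. ennpow (smoothing_term h \<tau> j x) p \<partial>lborel) (q / p) \<partial>count_space UNIV) \<le> ?B" for \<tau>
    proof (cases \<tau>)
      case (fields d l \<sigma>)
      have "(\<integral>\<^sup>+j. ennpow (\<integral>\<^sup>+x. ennpow (smoothing_term h \<tau> j x) p \<partial>lborel) (q / p) \<partial>count_space UNIV) \<le>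
        (\<integral>\<^sup>+j. ennpow (\<integral>\<^sup>+x. ennpow (h (j + d) x) p \<partial>lborel) (q / p) \<partial>count_space UNIV)"
        unfolding fields smoothing_term_shift using pq
        by (intro nn_integral_mono ennpow_mono nn_integral_grid_avg_le) auto
      also have "\<dots> = ?B"
        by (rule nn_integral_int_shift[of "\<lambda>j. ennpow (\<integral>\<^sup>+x. ennpow (h j x) p \<partial>lborel) (q / p)"])
      finally show ?thesis .
    qed
    then show "(\<integral>\<^sup>+j. ennpow (\<integral>\<^sup>+x. ennpow (smoothing \<delta> h j x) p \<partial>lborel) (q / p) \<partial>count_space UNIV) \<le>
        ennreal C * ?B"
      unfolding smoothing_def by (intro C(2)[of "\<lambda>\<tau> x j. smoothing_term h \<tau> j x"]) measurable
  qed
qed (use pq \<delta> nn_integral_decay_powr in auto)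

section \<open>Mixed norms\<close>

definition mixed_norm :: "space_type \<Rightarrow> real \<Rightarrow> ennreal \<Rightarrow> (int \<Rightarrow> real ^ 'n \<Rightarrow> ennreal) \<Rightarrow> ennreal" where
  "mixed_norm ty p q g = (case ty of
     Triebel_Lizorkin \<Rightarrow> Lp_norm p (\<lambda>x. lq_norm q (\<lambda>j. g j x))
   | Besov \<Rightarrow> lq_norm q (\<lambda>j. Lp_norm p (g j)))"

lemma seq_norm_eq_mixed_norm: "seq_norm ty s p q \<rho> t = mixed_norm ty p q (level_fun s \<rho> t)"
  by (simp add: seq_norm_def mixed_norm_def)

lemma lq_norm_alt:
  "lq_norm q f = (if q = top then SUP j. f j
    else ennpow (\<integral>\<^sup>+j. ennpow (f j) (enn2real q) \<partial>count_space UNIV) (1 / enn2real q))"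
  by (simp add: lq_norm_def infsum_eq_nn_integral)

lemma Lp_norm_mono:
  assumes "0 < p" "\<And>x. f x \<le> g x"
  shows "Lp_norm p f \<le> Lp_norm p g"
  unfolding Lp_norm_def using assms by (intro ennpow_mono nn_integral_mono) auto

lemma lq_norm_mono:
  assumes "0 < q" "\<And>j. f j \<le> g j"
  shows "lq_norm q f \<le> lq_norm q g"
proof (cases "q = top")
  case False
  then have "0 < enn2real q" using assms(1) by (simp add: enn2real_positive_iff less_top)
  then show ?thesis
    unfolding lq_norm_alt using assms False by (auto intro!: ennpow_mono nn_integral_mono)
qed (use assms(2) in \<open>auto simp: lq_norm_alt intro!: SUP_mono\<close>)

lemma mixed_norm_mono:
  assumes "0 < p" "0 < q" "\<And>j x. g j x \<le> g' j x"
  shows "mixed_norm ty p q g \<le> mixed_norm ty p q g'"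
  unfolding mixed_norm_def using assms
  by (cases ty) (auto intro!: Lp_norm_mono lq_norm_mono)

lemma Lp_norm_cmult:
  assumes "0 < p" and [measurable]: "f \<in> borel_measurable lborel"
  shows "Lp_norm p (\<lambda>x. k * f x) = k * Lp_norm p f"
  using assms(1) by (simp add: Lp_norm_def ennpow_mult nn_integral_cmult)

lemma lq_norm_cmult:
  assumes "0 < q"
  shows "lq_norm q (\<lambda>j. k * f j) = k * lq_norm q f"
proof (cases "q = top")
  case False
  then have "0 < enn2real q" using assms by (simp add: enn2real_positive_iff less_top)
  then show ?thesis
    using False by (simp add: lq_norm_alt ennpow_mult nn_integral_cmult)
qed (simp add: lq_norm_alt SUP_mult_left_ennreal)

lemma lq_norm_measurable [measurable]:
  assumes [measurable]: "\<And>j. f j \<in> borel_measurable M"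
  shows "(\<lambda>x. lq_norm q (\<lambda>j. f j x)) \<in> borel_measurable M"
  unfolding lq_norm_alt by (cases "q = top") simp_all

lemma mixed_norm_cmult:
  assumes "0 < p" "0 < q" and [measurable]: "\<And>j. g j \<in> borel_measurable lborel"
  shows "mixed_norm ty p q (\<lambda>j x. k * g j x) = k * mixed_norm ty p q g"
  unfolding mixed_norm_def using assms
  by (cases ty) (simp_all add: Lp_norm_cmult lq_norm_cmult)

text \<open>The r-th power of the norm of g is the norm of the r-th powers of g for the exponents p
  / r and q / r. The hypotheses on r place these in the range of the smoothing bounds.\<close>

lemma mixed_norm_smoothing:
  assumes \<delta>: "0 < \<delta>" and r: "0 < r" "r < p" and q: "0 < q"
    and rq: "ty = Triebel_Lizorkin \<Longrightarrow> ennreal r < q"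
  obtains C where "0 < C"
    "\<And>g :: int \<Rightarrow> real ^ 'n \<Rightarrow> ennreal. (\<And>j. g j \<in> borel_measurable lborel) \<Longrightarrow>
      mixed_norm ty p q (\<lambda>j x. ennpow (smoothing \<delta> (\<lambda>j x. ennpow (g j x) r) j x) (1 / r)) \<le>
      ennreal C * mixed_norm ty p q g"
proof -
  define p' where "p' = p / r"
  define q' where "q' = enn2real q / r"
  have p': "1 < p'" using r by (simp add: p'_def)
  have p0: "0 < p" using r by simp
  have ennpow_p: "ennpow x p = ennpow (ennpow x r) p'" for x
    using r by (simp add: ennpow_ennpow p'_def)
  have ennpow_q: "ennpow x (enn2real q) = ennpow (ennpow x r) q'" for x
    using r by (simp add: ennpow_ennpow q'_def)
  have q'_pos: "0 < q'" "0 < enn2real q" if "q \<noteq> top"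
    using that q r by (auto simp: q'_def enn2real_positive_iff less_top)
  have root: "ennpow X (1 / e) \<le> ennreal (C powr (1 / e)) * ennpow Y (1 / e)"
    if "X \<le> ennreal C * Y" "0 < C" "0 < e" for X Y C e
    using ennpow_mono[of "1 / e" X "ennreal C * Y"] that by (simp add: ennpow_mult ennpow_ennreal)
  show ?thesis
  proof (cases ty)
    case Triebel_Lizorkin
    show ?thesis
    proof (cases "q = top")
      case True
      show ?thesis
      proof (rule smoothing_Lp[where ?'n = 'n, OF \<delta> p'])
        fix C
        assume C: "0 < C" "\<And>h :: int \<Rightarrow> real ^ 'n \<Rightarrow> ennreal. (\<And>j. h j \<in> borel_measurable lborel) \<Longrightarrow>
          (\<integral>\<^sup>+x. ennpow (SUP j. smoothing \<delta> h j x) p' \<partial>lborel) \<le>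
          ennreal C * (\<integral>\<^sup>+x. ennpow (SUP j. h j x) p' \<partial>lborel)"
        show ?thesis
        proof (rule that[of "C powr (1 / p)"])
          fix g :: "int \<Rightarrow> real ^ 'n \<Rightarrow> ennreal"
          assume [measurable]: "\<And>j. g j \<in> borel_measurable lborel"
          show "mixed_norm ty p q (\<lambda>j x. ennpow (smoothing \<delta> (\<lambda>j x. ennpow (g j x) r) j x) (1 / r)) \<le>
            ennreal (C powr (1 / p)) * mixed_norm ty p q g"
            unfolding mixed_norm_def Triebel_Lizorkin lq_norm_alt True Lp_norm_def
            using r C by (simp add: ennpow_p ennpow_SUP) (intro root C; simp)
        qed (use C in simp)
      qed
    next
      case False
      then have "ennreal r < ennreal (enn2real q)"
        using rq[OF Triebel_Lizorkin] by (simp add: less_top)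
      then have q'1: "1 < q'" using r by (simp add: q'_def ennreal_less_iff)
      have pq: "ennpow X (p / enn2real q) = ennpow X (p' / q')" for X
        using r by (simp add: p'_def q'_def)
      show ?thesis
      proof (rule smoothing_lq[where ?'n = 'n, OF \<delta> p' q'1])
        fix C
        assume C: "0 < C" "\<And>h :: int \<Rightarrow> real ^ 'n \<Rightarrow> ennreal. (\<And>j. h j \<in> borel_measurable lborel) \<Longrightarrow>
          (\<integral>\<^sup>+x. ennpow (\<integral>\<^sup>+j. ennpow (smoothing \<delta> h j x) q' \<partial>count_space UNIV) (p' / q') \<partial>lborel) \<le>
          ennreal C * (\<integral>\<^sup>+x. ennpow (\<integral>\<^sup>+j. ennpow (h j x) q' \<partial>count_space UNIV) (p' / q') \<partial>lborel)"
        show ?thesis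
        proof (rule that[of "C powr (1 / p)"])
          fix g :: "int \<Rightarrow> real ^ 'n \<Rightarrow> ennreal"
          assume [measurable]: "\<And>j. g j \<in> borel_measurable lborel"
          show "mixed_norm ty p q (\<lambda>j x. ennpow (smoothing \<delta> (\<lambda>j x. ennpow (g j x) r) j x) (1 / r)) \<le>
            ennreal (C powr (1 / p)) * mixed_norm ty p q g"
            unfolding mixed_norm_def Triebel_Lizorkin lq_norm_alt Lp_norm_def ennpow_q
            using r C False by (simp add: ennpow_ennpow[of _ "1 / enn2real q"] pq) (intro root C; simp)
        qed (use C in simp)
      qed
    qed
  next
    case Besov
    show ?thesis
    proof (cases "q = top")
      case True
      show ?thesis
      proof (rule smoothing_Lp[where ?'n = 'n, OF \<delta> p'])
        fix C
        assume C: "0 < C" "\<And>(h :: int \<Rightarrow> real ^ 'n \<Rightarrow> ennreal) j. (\<And>j. h j \<in> borel_measurable lborel) \<Longrightarrow>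
          (\<integral>\<^sup>+x. ennpow (smoothing \<delta> h j x) p' \<partial>lborel) \<le>
          ennreal C * (SUP j. \<integral>\<^sup>+x. ennpow (h j x) p' \<partial>lborel)"
        show ?thesis
        proof (rule that[of "C powr (1 / p)"])
          fix g :: "int \<Rightarrow> real ^ 'n \<Rightarrow> ennreal"
          assume [measurable]: "\<And>j. g j \<in> borel_measurable lborel"
          show "mixed_norm ty p q (\<lambda>j x. ennpow (smoothing \<delta> (\<lambda>j x. ennpow (g j x) r) j x) (1 / r)) \<le>
            ennreal (C powr (1 / p)) * mixed_norm ty p q g"
            unfolding mixed_norm_def Besov lq_norm_alt True Lp_norm_def ennpow_p
            using r C p0 by (simp flip: ennpow_SUP) (intro SUP_least root C; simp)
        qed (use C in simp)
      qed
    next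
      case False
      note q0 = q'_pos(2)[OF False]
      have pq: "ennpow X (enn2real q / p) = ennpow X (q' / p')" for X
        using r by (simp add: p'_def q'_def)
      show ?thesis
      proof (rule smoothing_besov[where ?'n = 'n, OF \<delta> p' q'_pos(1)[OF False]])
        fix C
        assume C: "0 < C" "\<And>h :: int \<Rightarrow> real ^ 'n \<Rightarrow> ennreal. (\<And>j. h j \<in> borel_measurable lborel) \<Longrightarrow>
          (\<integral>\<^sup>+j. ennpow (\<integral>\<^sup>+x. ennpow (smoothing \<delta> h j x) p' \<partial>lborel) (q' / p') \<partial>count_space UNIV) \<le>
          ennreal C * (\<integral>\<^sup>+j. ennpow (\<integral>\<^sup>+x. ennpow (h j x) p' \<partial>lborel) (q' / p') \<partial>count_space UNIV)"
        show ?thesis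
        proof (rule that[of "C powr (1 / enn2real q)"])
          fix g :: "int \<Rightarrow> real ^ 'n \<Rightarrow> ennreal"
          assume [measurable]: "\<And>j. g j \<in> borel_measurable lborel"
          show "mixed_norm ty p q (\<lambda>j x. ennpow (smoothing \<delta> (\<lambda>j x. ennpow (g j x) r) j x) (1 / r)) \<le>
            ennreal (C powr (1 / enn2real q)) * mixed_norm ty p q g"
            unfolding mixed_norm_def Besov lq_norm_alt Lp_norm_def ennpow_p
            using r C False q0 by (simp add: ennpow_ennpow[of _ "1 / p"] pq) (intro root C; simp)
        qed (use C in simp)
      qed
    qed
  qed
qed

section \<open>Sums over dyadic cubes\<close>

definition cube_at :: "int \<Rightarrow> real ^ 'n \<Rightarrow> (real ^ 'n) set" where
  "cube_at j x = dyadic_cube j (grid_cell (\<lambda>_. False) j x)"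

lemma mem_dyadic_cube_iff_cell: "x \<in> dyadic_cube j k \<longleftrightarrow> grid_cell (\<lambda>_. False) j x = k"
proof -
  define c :: real where "c = 2 powi j"
  have c: "c > 0" "2 powi (- j) = 1 / c" by (simp_all add: c_def power_int_minus field_simps)
  have "(1 / c * of_int m \<le> z \<and> z < 1 / c * (of_int m + 1)) \<longleftrightarrow> \<lfloor>c * z\<rfloor> = m" for z :: real and m
    using c by (simp add: floor_eq_iff field_simps)
  then show ?thesis
    by (simp add: mem_dyadic_cube c grid_cell_def vec_eq_iff flip: c_def)
qed

lemma mem_cube_at [simp]: "x \<in> cube_at j x"
  by (simp add: cube_at_def mem_dyadic_cube_iff_cell)

lemma cube_at_eq: "x \<in> dyadic_cube j k \<Longrightarrow> cube_at j x = dyadic_cube j k"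
  by (simp add: cube_at_def mem_dyadic_cube_iff_cell)

lemma dyadic_cube_mem [simp]: "dyadic_cube j k \<in> dyadic"
  by (auto simp: dyadic_def dyadic_level_def)

lemma cube_at_dyadic [simp]: "cube_at j x \<in> dyadic"
  by (simp add: cube_at_def)

lemma dyadicE:
  assumes "Q \<in> dyadic"
  obtains j k where "Q = dyadic_cube j k"
  using assms by (auto simp: dyadic_def dyadic_level_def)

lemma powi_eq_powr: "(2 :: real) powi m = 2 powr (of_int m)"
  by (simp add: powr_real_of_int')

lemma inj_dyadic_cube: "inj (\<lambda>(j, k). dyadic_cube j (k :: int ^ 'n))"
proof (rule injI, clarsimp)
  fix j j' and k k' :: "int ^ 'n"
  assume eq: "dyadic_cube j k = dyadic_cube j' k'"
  have "(2 :: real) powi (- j) = 2 powi (- j')"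
    using eq side_length_dyadic_cube[of j k] side_length_dyadic_cube[of j' k'] by simp
  then have j: "j = j'"
    by (simp add: powi_eq_powr powr_inj)
  have "2 powi (- j) *\<^sub>R (\<chi> i. of_int (k $ i) :: real ^ 'n) = 2 powi (- j) *\<^sub>R (\<chi> i. of_int (k' $ i))"
    using eq j lower_left_dyadic_cube[of j k] lower_left_dyadic_cube[of j' k'] by simp
  then have "k = k'" by (simp add: vec_eq_iff)
  with j show "j = j' \<and> k = k'" ..
qed

lemma bij_dyadic_cube:
  "bij_betw (\<lambda>(j, k). dyadic_cube j k) UNIV (dyadic :: (real ^ 'n) set set)"
  using inj_dyadic_cube by (auto simp: bij_betw_def elim!: dyadicE)

lemma countable_dyadic: "countable (dyadic :: (real ^ 'n) set set)"
  using bij_dyadic_cube by (metis bij_betw_imp_surj_on countable_image countableI_type)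

lemma sets_dyadic_cube [measurable]: "dyadic_cube j k \<in> sets borel"
proof -
  have "dyadic_cube j k = {x \<in> space borel. \<forall>i. \<lfloor>2 powi j * x $ i\<rfloor> = k $ i}"
    by (auto simp: mem_dyadic_cube_iff_cell grid_cell_def vec_eq_iff)
  also have "\<dots> \<in> sets borel" by measurable
  finally show ?thesis .
qed

lemma emeasure_dyadic_cube:
  fixes k :: "int ^ 'n"
  shows "emeasure lborel (dyadic_cube j k) = ennreal ((2 powi (- j)) ^ CARD('n))"
proof -
  define c :: real where "c = 2 powi (- j)"
  have c: "c > 0" by (simp add: c_def)
  define l :: "real ^ 'n" where "l = (\<chi> i. c * of_int (k $ i))"
  define u :: "real ^ 'n" where "u = l + (\<chi> i. c)"
  have inner: "((\<chi> i. c) :: real ^ 'n) \<bullet> b = c" if "b \<in> Basis" for b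
    using that by (auto simp: Basis_vec_def inner_axis)
  have vol: "emeasure lborel (box l u) = ennreal (c ^ CARD('n))" "emeasure lborel (cbox l u) = ennreal (c ^ CARD('n))"
    using c by (simp_all add: u_def inner_add_left inner)
  have "box l u \<subseteq> dyadic_cube j k" "dyadic_cube j k \<subseteq> cbox l u"
    by (auto simp: mem_box_cart mem_dyadic_cube l_def u_def less_imp_le distrib_left simp flip: c_def)
  then have "emeasure lborel (box l u) \<le> emeasure lborel (dyadic_cube j k)"
    "emeasure lborel (dyadic_cube j k) \<le> emeasure lborel (cbox l u)"
    by (auto intro!: emeasure_mono)
  then show ?thesis unfolding vol c_def by (rule antisym[rotated])
qed

text \<open>This form gives measurability and integrals of arbitrary functions of the cube: the
  right-hand side is a countable sum of multiples of indicators.\<close>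

lemma cell_fun_eq_sum:
  fixes \<phi> :: "(real ^ 'n) set \<Rightarrow> ennreal"
  shows "\<phi> (cube_at j x) = (\<integral>\<^sup>+k. \<phi> (dyadic_cube j k) * indicator (dyadic_cube j k) x \<partial>count_space UNIV)"
proof -
  have "(\<integral>\<^sup>+k. \<phi> (dyadic_cube j k) * indicator (dyadic_cube j k) x \<partial>count_space UNIV) =
    (\<Sum>k\<in>{grid_cell (\<lambda>_. False) j x}. \<phi> (dyadic_cube j k) * indicator (dyadic_cube j k) x)"
    by (intro nn_integral_count_space') (auto simp: mem_dyadic_cube_iff_cell)
  then show ?thesis by (simp add: cube_at_def mem_dyadic_cube_iff_cell)
qed

lemma cell_fun_measurable [measurable]:
  fixes \<phi> :: "(real ^ 'n) set \<Rightarrow> ennreal"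
  shows "(\<lambda>x. \<phi> (cube_at j x)) \<in> borel_measurable lborel"
  unfolding cell_fun_eq_sum by measurable

text \<open>The factor is the reciprocal volume of a cube. Writing sums over cubes as integrals
  turns the matrix into an integral kernel, which can be compared with the kernels of the grid
  averages.\<close>

lemma sum_level_eq_nn_integral:
  fixes \<phi> :: "(real ^ 'n) set \<Rightarrow> ennreal"
  shows "(\<integral>\<^sup>+k. \<phi> (dyadic_cube j k) \<partial>count_space UNIV) =
    (\<integral>\<^sup>+y. ennreal ((2 powi j) ^ CARD('n)) * \<phi> (cube_at j y) \<partial>lborel)"
proof -
  let ?c = "ennreal ((2 powi j) ^ CARD('n))"
  have 1: "?c * ennreal ((2 powi (- j)) ^ CARD('n)) = 1"
    by (simp add: power_int_minus flip: ennreal_mult power_mult_distrib)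
  have "(\<integral>\<^sup>+y. ?c * \<phi> (cube_at j y) \<partial>lborel) = ?c * (\<integral>\<^sup>+y. \<phi> (cube_at j y) \<partial>lborel)"
    by (simp add: nn_integral_cmult)
  also have "(\<integral>\<^sup>+y. \<phi> (cube_at j y) \<partial>lborel) =
      (\<integral>\<^sup>+k. \<phi> (dyadic_cube j k) * ennreal ((2 powi (- j)) ^ CARD('n)) \<partial>count_space UNIV)"
    unfolding cell_fun_eq_sum
    by (subst nn_integral_count_space_nn_integral) (simp_all add: nn_integral_cmult emeasure_dyadic_cube)
  also have "?c * \<dots> = (\<integral>\<^sup>+k. (?c * ennreal ((2 powi (- j)) ^ CARD('n))) * \<phi> (dyadic_cube j k) \<partial>count_space UNIV)"
    by (simp add: mult_ac flip: nn_integral_cmult)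
  finally show ?thesis by (simp add: 1)
qed

lemma sum_dyadic_eq_nn_integral:
  fixes \<phi> :: "(real ^ 'n) set \<Rightarrow> ennreal"
  shows "(\<integral>\<^sup>+R. \<phi> R \<partial>count_space dyadic) =
    (\<integral>\<^sup>+j. \<integral>\<^sup>+y. ennreal ((2 powi j) ^ CARD('n)) * \<phi> (cube_at j y) \<partial>lborel \<partial>count_space UNIV)"
proof -
  have "(\<integral>\<^sup>+R. \<phi> R \<partial>count_space dyadic) = (\<integral>\<^sup>+jk. \<phi> (case jk of (j, k) \<Rightarrow> dyadic_cube j k) \<partial>count_space UNIV)"
    by (rule nn_integral_bij_count_space[OF bij_dyadic_cube, symmetric])
  also have "\<dots> = (\<integral>\<^sup>+j. \<integral>\<^sup>+k. \<phi> (dyadic_cube j k) \<partial>count_space UNIV \<partial>count_space UNIV)"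
    by (simp flip: nn_integral_fst_count_space)
  finally show ?thesis by (simp only: sum_level_eq_nn_integral)
qed

text \<open>One cube of level j contains x, and its factor \<bar>Q\<bar> powr (-1/2) = 2 powr (j * n
  / 2) merges with the weight of the level. This is the origin of the exponent s + n / 2, called
  \<open>g\<close> in the final proof.\<close>

lemma level_fun_eq:
  fixes t :: "(real ^ 'n) set \<Rightarrow> 'a" 
  shows "level_fun s \<rho> t j x =
    ennreal (2 powr (of_int j * (s + real CARD('n) / 2)) * \<rho> (cube_at j x) (t (cube_at j x)))"
proof -
  define Q where "Q = cube_at j x"
  have Q: "Q \<in> dyadic_level j" by (auto simp: Q_def cube_at_def dyadic_level_def)
  have other: "x \<notin> R" if "R \<in> dyadic_level j" "R \<noteq> Q" for R
    using that cube_at_eq[of x j] by (auto simp: dyadic_level_def Q_def)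
  have "countable (dyadic_level j :: (real ^ 'n) set set)"
    by (simp add: dyadic_level_def)
  then have "level_fun s \<rho> t j x = ennreal (2 powr (of_int j * s)) *
      (\<integral>\<^sup>+Q. ennreal (\<rho> Q (t Q) * measure lborel Q powr (- 1 / 2)) * indicator Q x \<partial>count_space (dyadic_level j))"
    unfolding level_fun_def by (subst infsum_eq_nn_integral) auto
  also have "(\<integral>\<^sup>+Q. ennreal (\<rho> Q (t Q) * measure lborel Q powr (- 1 / 2)) * indicator Q x \<partial>count_space (dyadic_level j)) =
      (\<Sum>Q\<in>{Q}. ennreal (\<rho> Q (t Q) * measure lborel Q powr (- 1 / 2)) * indicator Q x)"
    using Q other by (intro nn_integral_count_space') auto
  also have "ennreal (2 powr (of_int j * s)) * \<dots> = ennreal (2 powr (of_int j * s) * (\<rho> Q (t Q) * measure lborel Q powr (- 1 / 2)))"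
    by (simp add: Q_def ennreal_mult')
  also have "measure lborel Q = 2 powr (- of_int j * real CARD('n))"
    by (simp add: Q_def cube_at_def measure_def emeasure_dyadic_cube powi_eq_powr powr_powr flip: powr_realpow)
  also have "(2 powr (- of_int j * real CARD('n))) powr (- 1 / 2) = 2 powr (of_int j * (real CARD('n) / 2))"
    by (simp add: powr_powr)
  also have "2 powr (of_int j * s) * (\<rho> Q (t Q) * 2 powr (of_int j * (real CARD('n) / 2))) =
      2 powr (of_int j * (s + real CARD('n) / 2)) * \<rho> Q (t Q)"
    by (simp add: distrib_left powr_add)
  finally show ?thesis by (simp add: Q_def)
qed

section \<open>The kernel of an almost diagonal matrix\<close>

text \<open>Both points lie within 1/4 of an integer k between them. As 1/4 < 1/3 and 1/4 + 1/3 < 1,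
  adding 1/3 puts both into (k, k + 1), and subtracting 1/3 puts both into (k - 1, k).\<close>

lemma floor_shift_eq_aux:
  fixes a b :: real
  assumes "a \<le> b" "b - a < 1 / 4" "\<lfloor>a\<rfloor> \<noteq> \<lfloor>b\<rfloor>"
  shows "\<lfloor>a + grid_shift m\<rfloor> = \<lfloor>b + grid_shift m\<rfloor>"
proof -
  define k where "k = \<lfloor>b\<rfloor>"
  have "\<lfloor>a\<rfloor> < k" using assms floor_mono[of a b] by (simp add: k_def)
  then have "a < of_int k" "of_int k \<le> b" by (auto simp: k_def floor_less_iff)
  then have *: "of_int k - 1 / 4 < a" "a < of_int k" "of_int k \<le> b" "b < of_int k + 1 / 4"
    using assms by auto
  show ?thesis
  proof (cases "even m")
    case True
    have "\<lfloor>a + 1 / 3\<rfloor> = k" "\<lfloor>b + 1 / 3\<rfloor> = k" using * by (auto intro!: floor_unique)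
    then show ?thesis using True by (simp add: grid_shift_def)
  next
    case False
    have "\<lfloor>a - 1 / 3\<rfloor> = k - 1" "\<lfloor>b - 1 / 3\<rfloor> = k - 1" using * by (auto intro!: floor_unique)
    then show ?thesis using False by (simp add: grid_shift_def)
  qed
qed

lemma floor_shift_eq:
  fixes a b :: real
  assumes "\<bar>a - b\<bar> < 1 / 4" "\<lfloor>a\<rfloor> \<noteq> \<lfloor>b\<rfloor>"
  shows "\<lfloor>a + grid_shift m\<rfloor> = \<lfloor>b + grid_shift m\<rfloor>"
proof (cases "a \<le> b")
  case True
  show ?thesis by (rule floor_shift_eq_aux) (use True assms in linarith)+
next
  case False
  show ?thesis by (rule floor_shift_eq_aux[symmetric]) (use False assms in linarith)+
qed

text \<open>The one-third trick: two nearby reals that are separated by an integer are not separated by an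
  element of \<open>\<int> \<plusminus> 1/3\<close>, so the shift can be chosen in each coordinate.\<close>

lemma close_points_share_cell:
  fixes x y :: "real ^ 'n"
  assumes "\<And>i. 2 powi m * \<bar>x $ i - y $ i\<bar> < 1 / 4"
  shows "\<exists>\<sigma>. grid_cell \<sigma> m x = grid_cell \<sigma> m y"
proof
  let ?\<sigma> = "\<lambda>i. \<lfloor>2 powi m * x $ i\<rfloor> \<noteq> \<lfloor>2 powi m * y $ i\<rfloor>"
  have "\<bar>2 powi m * x $ i - 2 powi m * y $ i\<bar> < 1 / 4" for i
    using assms[of i] by (simp add: abs_mult flip: right_diff_distrib)
  then show "grid_cell ?\<sigma> m x = grid_cell ?\<sigma> m y"
    unfolding grid_cell_eq_iff by (auto intro!: floor_shift_eq)
qed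

lemma cube_distance_scale:
  fixes x y :: "real ^ 'n" and i j :: int
  defines "X \<equiv> 1 + norm (lower_left (cube_at j x) - lower_left (cube_at i y)) /
    max (side_length (cube_at j x)) (side_length (cube_at i y))"
  obtains l \<sigma> where "2 ^ l \<le> 2 * X"
    "grid_cell \<sigma> (min i j - int l - 2) x = grid_cell \<sigma> (min i j - int l - 2) y"
proof -
  define M :: real where "M = 2 powi (- min i j)"
  have M: "M > 0" by (simp add: M_def)
  have max: "max (2 powi (- j)) (2 powi (- i)) = M"
    unfolding M_def powi_eq_powr by (cases "i \<le> j") (auto simp: max_def min_def)
  have le: "2 powi (- j) \<le> M" "2 powi (- i) \<le> M"
    by (simp_all flip: max)
  have X: "X = 1 + norm (lower_left (cube_at j x) - lower_left (cube_at i y)) / M"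
    by (simp add: X_def cube_at_def side_length_dyadic_cube max)
  then have X1: "X \<ge> 1" using M by simp
  have ll: "0 \<le> z $ m - lower_left (cube_at k z) $ m" "z $ m - lower_left (cube_at k z) $ m < 2 powi (- k)"
    for z :: "real ^ 'n" and k m
    using mem_cube_at[of z k] unfolding cube_at_def mem_dyadic_cube lower_left_dyadic_cube
    by (auto simp: algebra_simps dest!: spec[of _ m])
  \<comment> \<open>The offsets of x and y from their lower-left corners both lie in [0, M), so
    their difference costs a single \<open>M\<close>, the 1 in \<open>X\<close>.\<close>
  have dist: "\<bar>x $ m - y $ m\<bar> < M * X" for m
  proof -
    have "\<bar>x $ m - y $ m\<bar> < \<bar>(lower_left (cube_at j x) - lower_left (cube_at i y)) $ m\<bar> + M"
      using ll[of x m j] ll[of y m i] le by simp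
    also have "\<dots> \<le> norm (lower_left (cube_at j x) - lower_left (cube_at i y)) + M"
      by (intro add_right_mono component_le_norm_cart)
    also have "\<dots> = M * X" using M by (simp add: X field_simps)
    finally show ?thesis .
  qed
  \<comment> \<open>The smallest exponent with X \<le> 2 ^ l; rounding up costs the factor 2 in the
    conclusion.\<close>
  define l where "l = nat \<lceil>log 2 X\<rceil>"
  have log: "0 \<le> log 2 X" using X1 by simp
  have l_eq: "real l = of_int \<lceil>log 2 X\<rceil>" using log by (simp add: l_def)
  have "2 ^ l = 2 powr real l" by (simp add: powr_realpow)
  also have "\<dots> \<le> 2 powr (log 2 X + 1)" unfolding l_eq by (intro powr_mono) linarith+
  also have "\<dots> = 2 * X" using X1 by (simp add: powr_add)
  finally have l2: "2 ^ l \<le> 2 * X" .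
  have "X = 2 powr log 2 X" using X1 by simp
  also have "\<dots> \<le> 2 powr real l" unfolding l_eq by (intro powr_mono) linarith+
  finally have lX: "X \<le> 2 powr real l" .
  have scale: "2 powi (min i j - int l - 2) * (M * 2 powr real l) = 1 / 4"
  proof -
    have "2 powi (min i j - int l - 2) * (M * 2 powr real l) =
        2 powr (of_int (min i j - int l - 2) + (of_int (- min i j) + real l))"
      by (simp only: M_def powi_eq_powr powr_add)
    also have "\<dots> = 2 powr (- 2)" by simp
    also have "\<dots> = 1 / 4" by (simp add: powr_minus_divide)
    finally show ?thesis .
  qed
  have "2 powi (min i j - int l - 2) * \<bar>x $ m - y $ m\<bar> < 1 / 4" for m
  proof -
    have "\<bar>x $ m - y $ m\<bar> < M * 2 powr real l"
      using dist[of m] lX M by (smt (verit) mult_left_mono)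
    then show ?thesis
      unfolding scale[symmetric] by (intro mult_strict_left_mono) auto
  qed
  from close_points_share_cell[OF this] l2 that show ?thesis by blast
qed

text \<open>1 + 2 powr t lies between M and 2 * M for M = 2 powr max t 0; the sign of
  \<open>e\<close> decides which of the two bounds is used.\<close>

lemma one_plus_powr_le:
  fixes t e :: real
  shows "(1 + 2 powr t) powr e \<le> 2 powr \<bar>e\<bar> * 2 powr (e * max t 0)"
proof -
  define M :: real where "M = 2 powr max t 0"
  have M: "M > 0" "1 \<le> M" "2 powr t \<le> M" "M \<le> 1 + 2 powr t"
    by (auto simp: M_def max_def intro: ge_one_powr_ge_zero)
  have "(1 + 2 powr t) powr e \<le> 2 powr \<bar>e\<bar> * M powr e"
  proof (cases "0 \<le> e")
    case True
    have "(1 + 2 powr t) powr e \<le> (2 * M) powr e"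
      using M True by (intro powr_mono2) auto
    then show ?thesis using True M by (simp add: powr_mult)
  next
    case False
    have "(1 + 2 powr t) powr e \<le> M powr e"
      using M False by (intro powr_mono2') auto
    also have "1 * M powr e \<le> 2 powr \<bar>e\<bar> * M powr e"
      by (intro mult_right_mono ge_one_powr_ge_zero) auto
    finally show ?thesis by simp
  qed
  then show ?thesis by (simp add: M_def powr_powr mult.commute)
qed

text \<open>On the left, the first factor is the density from
  \<open>sum_level_eq_nn_integral\<close> and the second the quotient of the r-th powers of the
  level weights. On the right stand the coefficient and the density of a single average.\<close>

lemma almost_diagonal_kernel:
  fixes E F D g r \<delta> :: real
  assumes r: "0 < r" and \<delta>: "0 < \<delta>"
    and E: "\<delta> \<le> (E - g) * r" and F: "real CARD('n) + \<delta> \<le> (F + g) * r"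
    and D: "real CARD('n) + \<delta> \<le> D * r"
  obtains C where "0 < C"
    "\<And>i j (x :: real ^ 'n) y. \<exists>l \<sigma>.
      grid_cell \<sigma> (min j i - int l - 2) x = grid_cell \<sigma> (min j i - int l - 2) y \<and>
      (2 powi i) ^ CARD('n) * 2 powr (of_int (j - i) * g * r) *
        B_fun (- E) (- F) (- D) (cube_at j x) (cube_at i y) powr r \<le>
      C * (decay \<delta> (i - j, l, \<sigma>) * (2 powi (min j i - int l - 2)) ^ CARD('n))"
proof -
  define n where "n = real CARD('n)"
  \<comment> \<open>The first two factors come from \<open>one_plus_powr_le\<close>, the third from
    2 ^ l \<le> 2 * X, the last from the two extra levels of the averaging cells.\<close>
  define C where "C = 2 powr \<bar>- E * r\<bar> * 2 powr \<bar>- F * r\<bar> * 2 powr (n + \<delta>) * 2 powr (2 * n)"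
  have pn: "(2 powi m) ^ CARD('n) = 2 powr (of_int m * n)" for m
    by (simp add: powi_eq_powr powr_powr n_def flip: powr_realpow)
  show ?thesis
  proof (rule that[of C])
    show "0 < C" by (simp add: C_def)
    fix i j :: int and x y :: "real ^ 'n"
    define X where "X = 1 + norm (lower_left (cube_at j x) - lower_left (cube_at i y)) /
      max (side_length (cube_at j x)) (side_length (cube_at i y))"
    obtain l \<sigma> where l: "2 ^ l \<le> 2 * X"
      and cell: "grid_cell \<sigma> (min i j - int l - 2) x = grid_cell \<sigma> (min i j - int l - 2) y"
      unfolding X_def by (rule cube_distance_scale)
    have X1: "1 \<le> X"
      by (simp add: X_def cube_at_def side_length_dyadic_cube le_max_iff_disj)
    have ratio: "2 powi (- i) / 2 powi (- j) = 2 powr (of_int (j - i) :: real)" for i j :: int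
      by (simp add: powi_eq_powr flip: powr_diff)
    have "B_fun (- E) (- F) (- D) (cube_at j x) (cube_at i y) powr r =
      (1 + 2 powr of_int (j - i)) powr (- E * r) * (1 + 2 powr of_int (i - j)) powr (- F * r) * X powr (- D * r)"
      unfolding B_fun_def X_def[symmetric]
      by (simp add: cube_at_def side_length_dyadic_cube ratio powr_mult powr_powr)
    also have "\<dots> \<le> (2 powr \<bar>- E * r\<bar> * 2 powr (- E * r * max (of_int (j - i)) 0)) *
        (2 powr \<bar>- F * r\<bar> * 2 powr (- F * r * max (of_int (i - j)) 0)) *
        (2 powr (n + \<delta>) * 2 powr (- (n + \<delta>) * l))"
    proof (intro mult_mono one_plus_powr_le)
      have "X powr (- D * r) \<le> X powr (- (n + \<delta>))"
        using X1 D by (intro powr_mono) (auto simp: n_def)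
      also have "\<dots> \<le> (2 ^ l / 2) powr (- (n + \<delta>))"
        using l \<delta> by (intro powr_mono2') (auto simp: n_def)
      also have "\<dots> = 2 powr (n + \<delta>) * 2 powr (- (n + \<delta>) * l)"
      proof -
        have "(2 ^ l / 2 :: real) = 2 powr (real l - 1)" by (simp add: powr_diff powr_realpow)
        then have "(2 ^ l / 2) powr (- (n + \<delta>)) = 2 powr ((real l - 1) * - (n + \<delta>))"
          by (simp only: powr_powr)
        also have "(real l - 1) * - (n + \<delta>) = (n + \<delta>) + - (n + \<delta>) * l" by (simp add: algebra_simps)
        finally show ?thesis by (simp only: powr_add)
      qed
      finally show "X powr (- D * r) \<le> 2 powr (n + \<delta>) * 2 powr (- (n + \<delta>) * l)" .
    qed auto
    finally have "(2 powi i) ^ CARD('n) * 2 powr (of_int (j - i) * g * r) *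
        B_fun (- E) (- F) (- D) (cube_at j x) (cube_at i y) powr r \<le>
      2 powr (of_int i * n) * 2 powr (of_int (j - i) * g * r) *
      ((2 powr \<bar>- E * r\<bar> * 2 powr (- E * r * max (of_int (j - i)) 0)) *
        (2 powr \<bar>- F * r\<bar> * 2 powr (- F * r * max (of_int (i - j)) 0)) *
        (2 powr (n + \<delta>) * 2 powr (- (n + \<delta>) * l)))"
      unfolding pn by (intro mult_left_mono) auto
    also have "\<dots> = 2 powr \<bar>- E * r\<bar> * 2 powr \<bar>- F * r\<bar> * 2 powr (n + \<delta>) *
      2 powr (of_int i * n + of_int (j - i) * g * r + - E * r * max (of_int (j - i)) 0
        + - F * r * max (of_int (i - j)) 0 + - (n + \<delta>) * l)"
      by (simp only: powr_add mult_ac)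
    also have "\<dots> \<le> 2 powr \<bar>- E * r\<bar> * 2 powr \<bar>- F * r\<bar> * 2 powr (n + \<delta>) *
      2 powr (2 * n + - \<delta> * (\<bar>of_int (i - j)\<bar> + real l) + of_int (min j i - int l - 2) * n)"
    proof (intro mult_left_mono powr_mono)
      have "of_int i * n + of_int (j - i) * g * r + - E * r * max (of_int (j - i)) 0
        + - F * r * max (of_int (i - j)) 0 \<le> - \<delta> * \<bar>of_int (i - j)\<bar> + of_int (min j i) * n"
      \<comment> \<open>For a coarser source min j i = i and the densities cancel; for a finer one
        the excess 2 powr ((i - j) * n) is paid for by \<open>F\<close>.\<close>
      proof (cases "i \<le> j")
        case True
        have "\<delta> * of_int (j - i) \<le> (E - g) * r * of_int (j - i)"
          using True by (intro mult_right_mono E) auto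
        then show ?thesis using True by (simp add: algebra_simps)
      next
        case False
        have "(n + \<delta>) * of_int (i - j) \<le> (F + g) * r * of_int (i - j)"
          using False F by (intro mult_right_mono) (auto simp: n_def)
        then show ?thesis using False by (simp add: algebra_simps)
      qed
      then show "of_int i * n + of_int (j - i) * g * r + - E * r * max (of_int (j - i)) 0
        + - F * r * max (of_int (i - j)) 0 + - (n + \<delta>) * l
        \<le> 2 * n + - \<delta> * (\<bar>of_int (i - j)\<bar> + real l) + of_int (min j i - int l - 2) * n"
        by (simp add: algebra_simps)
    qed auto
    also have "\<dots> = C * (decay \<delta> (i - j, l, \<sigma>) * (2 powi (min j i - int l - 2)) ^ CARD('n))"
      unfolding pn C_def decay_def prod.case by (simp only: powr_add mult_ac)
    finally show "\<exists>l \<sigma>. grid_cell \<sigma> (min j i - int l - 2) x = grid_cell \<sigma> (min j i - int l - 2) y \<and>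
      (2 powi i) ^ CARD('n) * 2 powr (of_int (j - i) * g * r) *
        B_fun (- E) (- F) (- D) (cube_at j x) (cube_at i y) powr r \<le>
      C * (decay \<delta> (i - j, l, \<sigma>) * (2 powi (min j i - int l - 2)) ^ CARD('n))"
      using cell by (auto simp: min.commute)
  qed
qed

lemma grid_kernel_section [measurable]: "grid_kernel \<sigma> m x \<in> borel_measurable lborel"
  using measurable_Pair2[OF grid_kernel_measurable, of x \<sigma> m] by simp

lemma B_fun_nonneg: "0 \<le> B_fun a b c Q R"
  by (simp add: B_fun_def)

lemma almost_diagonal_le_smoothing:
  fixes E F D g r \<delta> :: real
  assumes r: "0 < r" and \<delta>: "0 < \<delta>"
    and E: "\<delta> \<le> (E - g) * r" and F: "real CARD('n) + \<delta> \<le> (F + g) * r"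
    and D: "real CARD('n) + \<delta> \<le> D * r"
  obtains C where "0 < C"
    "\<And>(w :: (real ^ 'n) set \<Rightarrow> real) j x. (\<And>R. R \<in> dyadic \<Longrightarrow> 0 \<le> w R) \<Longrightarrow>
      (\<integral>\<^sup>+R. ennreal ((2 powr (of_int j * g) * (B_fun (- E) (- F) (- D) (cube_at j x) R * w R)) powr r) \<partial>count_space dyadic) \<le>
      ennreal C * smoothing \<delta> (\<lambda>i y. ennpow (ennreal (2 powr (of_int i * g) * w (cube_at i y))) r) j x"
proof (rule almost_diagonal_kernel[where ?'n = 'n, OF r \<delta> E F D])
  fix C
  assume C: "0 < C" and ker: "\<And>i j (x :: real ^ 'n) y. \<exists>l \<sigma>.
      grid_cell \<sigma> (min j i - int l - 2) x = grid_cell \<sigma> (min j i - int l - 2) y \<and>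
      (2 powi i) ^ CARD('n) * 2 powr (of_int (j - i) * g * r) *
        B_fun (- E) (- F) (- D) (cube_at j x) (cube_at i y) powr r \<le>
      C * (decay \<delta> (i - j, l, \<sigma>) * (2 powi (min j i - int l - 2)) ^ CARD('n))"
  show ?thesis
  proof (rule that[OF C])
    fix w :: "(real ^ 'n) set \<Rightarrow> real" and j and x :: "real ^ 'n"
    assume w: "\<And>R. R \<in> dyadic \<Longrightarrow> 0 \<le> w R"
    define h where "h i y = ennpow (ennreal (2 powr (of_int i * g) * w (cube_at i y))) r" for i y
    have h_meas [measurable]: "h i \<in> borel_measurable lborel" for i
      unfolding h_def by (rule cell_fun_measurable[of "\<lambda>R. ennpow (ennreal (2 powr (of_int i * g) * w R)) r"])
    define G where "G \<tau> = ennreal (decay \<delta> \<tau>) * smoothing_term h \<tau> j x" for \<tau>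
    let ?K = "\<lambda>i y ls. ennreal (decay \<delta> (i - j, ls)) * grid_kernel (snd ls) (min j i - int (fst ls) - 2) x y"
    let ?\<phi> = "\<lambda>R. ennreal ((2 powr (of_int j * g) * (B_fun (- E) (- F) (- D) (cube_at j x) R * w R)) powr r)"
    have point: "ennreal ((2 powi i) ^ CARD('n)) * ?\<phi> (cube_at i y) \<le>
        ennreal C * (\<integral>\<^sup>+ls. ?K i y ls * h i y \<partial>count_space UNIV)" for i y
    proof -
      let ?B = "B_fun (- E) (- F) (- D) (cube_at j x) (cube_at i y)"
      obtain l \<sigma> where cell: "grid_cell \<sigma> (min j i - int l - 2) x = grid_cell \<sigma> (min j i - int l - 2) y"
        and le: "(2 powi i) ^ CARD('n) * 2 powr (of_int (j - i) * g * r) * ?B powr r \<le>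
          C * (decay \<delta> (i - j, l, \<sigma>) * (2 powi (min j i - int l - 2)) ^ CARD('n))"
        using ker by blast
      have h: "h i y = ennreal (2 powr (of_int i * g * r) * w (cube_at i y) powr r)"
        using w by (simp add: h_def ennpow_ennreal powr_mult powr_powr)
      have eq: "2 powr (of_int j * g * r) = 2 powr (of_int (j - i) * g * r) * 2 powr (of_int i * g * r)"
        by (simp add: algebra_simps flip: powr_add)
      have "ennreal ((2 powi i) ^ CARD('n)) * ?\<phi> (cube_at i y) =
          ennreal ((2 powi i) ^ CARD('n) * (2 powr (of_int j * g * r) * (?B powr r * w (cube_at i y) powr r)))"
        using w B_fun_nonneg by (simp add: powr_mult powr_powr flip: ennreal_mult')
      also have "\<dots> = ennreal ((2 powi i) ^ CARD('n) * 2 powr (of_int (j - i) * g * r) * ?B powr r) * h i y"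
        unfolding h eq by (subst ennreal_mult'[symmetric]) (simp_all add: mult_ac)
      also have "\<dots> \<le> ennreal (C * (decay \<delta> (i - j, l, \<sigma>) * (2 powi (min j i - int l - 2)) ^ CARD('n))) * h i y"
        by (intro mult_right_mono ennreal_leI le) auto
      also have "\<dots> = ennreal C * (?K i y (l, \<sigma>) * h i y)"
        using C cell by (simp add: grid_kernel_def ennreal_mult less_imp_le mult.assoc)
      \<comment> \<open>\<open>l\<close> and \<open>\<sigma>\<close> depend on y. Replacing the one
        valid pair by the sum over all pairs avoids a measurable choice and leaves genuine grid
        averages.\<close>
      also have "\<dots> \<le> ennreal C * (\<integral>\<^sup>+ls. ?K i y ls * h i y \<partial>count_space UNIV)"
        by (intro mult_left_mono nn_integral_ge_point) auto
      finally show ?thesis .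
    qed
    have int: "(\<integral>\<^sup>+y. (\<integral>\<^sup>+ls. ?K i y ls * h i y \<partial>count_space UNIV) \<partial>lborel) =
        (\<integral>\<^sup>+ls. G (i - j, ls) \<partial>count_space UNIV)" for i
    proof -
      have "(\<integral>\<^sup>+y. (\<integral>\<^sup>+ls. ?K i y ls * h i y \<partial>count_space UNIV) \<partial>lborel) =
          (\<integral>\<^sup>+ls. (\<integral>\<^sup>+y. ?K i y ls * h i y \<partial>lborel) \<partial>count_space UNIV)"
        by (intro nn_integral_count_space_nn_integral) auto
      also have "\<dots> = (\<integral>\<^sup>+ls. G (i - j, ls) \<partial>count_space UNIV)"
      proof (intro nn_integral_cong)
        fix ls :: "nat \<times> ('n \<Rightarrow> bool)"
        show "(\<integral>\<^sup>+y. ?K i y ls * h i y \<partial>lborel) = G (i - j, ls)"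
          by (cases ls) (simp add: G_def smoothing_term_def grid_avg_def mult.assoc nn_integral_cmult)
      qed
      finally show ?thesis .
    qed
    have "(\<integral>\<^sup>+R. ?\<phi> R \<partial>count_space dyadic) \<le>
        (\<integral>\<^sup>+i. \<integral>\<^sup>+y. ennreal C * (\<integral>\<^sup>+ls. ?K i y ls * h i y \<partial>count_space UNIV) \<partial>lborel \<partial>count_space UNIV)"
      unfolding sum_dyadic_eq_nn_integral by (intro nn_integral_mono point)
    also have "\<dots> = ennreal C * (\<integral>\<^sup>+i. \<integral>\<^sup>+ls. G (i - j, ls) \<partial>count_space UNIV \<partial>count_space UNIV)"
      by (simp add: nn_integral_cmult int)
    also have "(\<integral>\<^sup>+i. \<integral>\<^sup>+ls. G (i - j, ls) \<partial>count_space UNIV \<partial>count_space UNIV) =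
        (\<integral>\<^sup>+d. \<integral>\<^sup>+ls. G (d, ls) \<partial>count_space UNIV \<partial>count_space UNIV)"
      using nn_integral_int_shift[of "\<lambda>d. \<integral>\<^sup>+ls. G (d, ls) \<partial>count_space UNIV" "- j"] by simp
    also have "\<dots> = smoothing \<delta> h j x"
      unfolding smoothing_def G_def
      by (rule nn_integral_fst_count_space[of "\<lambda>\<tau>. ennreal (decay \<delta> \<tau>) * smoothing_term h \<tau> j x"])
    finally show "(\<integral>\<^sup>+R. ?\<phi> R \<partial>count_space dyadic) \<le> ennreal C *
        smoothing \<delta> (\<lambda>i y. ennpow (ennreal (2 powr (of_int i * g) * w (cube_at i y))) r) j x"
      by (simp add: h_def[abs_def])
  qed
qed

section \<open>Series in a \<open>u\<close>-normed space\<close>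

text \<open>The r-th power is the (r / u)-th power of the u-th power, and powers with exponent at
  most 1 are subadditive.\<close>

lemma u_norm_powr_add_le:
  assumes "u_norm smul u N" "0 < r" "r \<le> u"
  shows "N (e + e') powr r \<le> N e powr r + N e' powr r"
proof -
  have N: "0 \<le> N e" for e using assms(1) by (simp add: u_norm_def)
  have "ennreal (N (e + e') powr r) = ennpow (ennreal (N (e + e') powr u)) (r / u)"
    using assms N by (simp add: ennpow_ennreal powr_powr)
  also have "\<dots> \<le> ennpow (ennreal (N e powr u) + ennreal (N e' powr u)) (r / u)"
    using assms by (intro ennpow_mono) (auto simp: u_norm_def ennreal_plus[symmetric] simp del: ennreal_plus)
  also have "\<dots> \<le> ennpow (ennreal (N e powr u)) (r / u) + ennpow (ennreal (N e' powr u)) (r / u)"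
    using assms by (intro ennpow_add_le) auto
  also have "\<dots> = ennreal (N e powr r + N e' powr r)"
    using assms N by (simp add: ennpow_ennreal powr_powr)
  finally have "ennreal (N (e + e') powr r) \<le> ennreal (N e powr r + N e' powr r)" .
  then show ?thesis by (subst (asm) ennreal_le_iff) auto
qed

text \<open>Since r \<le> 1, summable r-th powers give a summable series, and equivalence of
  \<open>N\<close> to the norm makes the series absolutely convergent.\<close>

lemma u_norm_infsum:
  fixes f :: "'i \<Rightarrow> 'a::banach"
  assumes N: "u_norm smul u N" and u: "0 < r" "r \<le> u" "u \<le> 1" and eq: "equivalent_to_norm N"
    and A: "countable A"
    and fin: "(\<integral>\<^sup>+i. ennreal (N (f i) powr r) \<partial>count_space A) < top"
  shows "f summable_on A"
    and "ennreal (N (infsum f A) powr r) \<le> (\<integral>\<^sup>+i. ennreal (N (f i) powr r) \<partial>count_space A)"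
proof -
  obtain m M where mM: "0 < m" "0 < M" "\<And>e. m * norm e \<le> N e" "\<And>e. N e \<le> M * norm e"
    using eq by (auto simp: equivalent_to_norm_def)
  have N0: "0 \<le> N e" for e using N by (simp add: u_norm_def)
  have N_0: "N 0 = 0" using N by (simp add: u_norm_def)
  obtain T where T: "(\<integral>\<^sup>+i. ennreal (N (f i) powr r) \<partial>count_space A) = ennreal T" "0 \<le> T"
    using fin by (cases "\<integral>\<^sup>+i. ennreal (N (f i) powr r) \<partial>count_space A") auto
  have sumT: "(\<Sum>i\<in>I. N (f i) powr r) \<le> T" if "finite I" "I \<subseteq> A" for I
  proof -
    have "ennreal (\<Sum>i\<in>I. N (f i) powr r) = (\<Sum>i\<in>I. ennreal (N (f i) powr r))"
      by simp
    also have "\<dots> \<le> ennreal T"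
      unfolding T(1)[symmetric] nn_integral_count_space_eq_SUP[OF A] using that by (intro SUP_upper) auto
    finally show ?thesis using T by (simp add: ennreal_le_iff)
  qed
  have bound: "(\<Sum>i\<in>I. norm (f i)) \<le> T powr (1 / r) / m" if "finite I" "I \<subseteq> A" for I
  proof -
    have "ennpow (ennreal (\<Sum>i\<in>I. N (f i))) r = ennpow (\<Sum>i\<in>I. ennreal (N (f i))) r"
      using N0 by (simp add: sum_ennreal)
    also have "\<dots> \<le> (\<Sum>i\<in>I. ennpow (ennreal (N (f i))) r)"
      using u by (intro ennpow_sum_le) auto
    also have "\<dots> = ennreal (\<Sum>i\<in>I. N (f i) powr r)"
      using N0 by (simp add: ennpow_ennreal)
    also have "\<dots> \<le> ennreal T" by (intro ennreal_leI sumT that)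
    finally have "ennreal (\<Sum>i\<in>I. N (f i)) \<le> ennreal (T powr (1 / r))"
      using u T by (simp add: ennpow_le_swap ennpow_ennreal)
    then have "(\<Sum>i\<in>I. N (f i)) \<le> T powr (1 / r)" by (simp add: ennreal_le_iff)
    moreover have "m * (\<Sum>i\<in>I. norm (f i)) \<le> (\<Sum>i\<in>I. N (f i))"
      unfolding sum_distrib_left by (intro sum_mono mM)
    ultimately show ?thesis using mM(1) by (simp add: field_simps)
  qed
  have "(\<lambda>i. norm (f i)) summable_on A"
    by (rule nonneg_bdd_above_summable_on) (use bound in \<open>auto intro!: bdd_aboveI[of _ "T powr (1 / r) / m"]\<close>)
  then show summ: "f summable_on A" by (rule abs_summable_summable)
  define S where "S = infsum f A"
  have lim: "(sum f \<longlongrightarrow> S) (finite_subsets_at_top A)"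
    using summ by (simp add: S_def has_sum_infsum flip: has_sum_def)
  have fin_sum: "N (sum f I) powr r \<le> (\<Sum>i\<in>I. N (f i) powr r)" if "finite I" for I
    using that
  proof (induction I)
    case (insert i I)
    then show ?case using u_norm_powr_add_le[OF N u(1,2), of "f i" "sum f I"] by simp
  qed (simp add: N_0)
  \<comment> \<open>The r-triangle inequality for S = (S - sum f I) + sum f I takes the place of
    continuity of \<open>N\<close>; the remainder tends to 0 through the upper bound of
    \<open>N\<close> by the norm.\<close>
  have ev: "\<forall>\<^sub>F I in finite_subsets_at_top A. N S powr r \<le> (M * norm (S - sum f I)) powr r + T"
  proof (rule eventually_finite_subsets_at_top_weakI)
    fix I assume I: "finite I" "I \<subseteq> A"
    have "N S powr r \<le> N (S - sum f I) powr r + N (sum f I) powr r"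
      using u_norm_powr_add_le[OF N u(1,2), of "S - sum f I" "sum f I"] by simp
    also have "N (S - sum f I) powr r \<le> (M * norm (S - sum f I)) powr r"
      using u N0 mM by (intro powr_mono2) auto
    also have "N (sum f I) powr r \<le> T" using fin_sum[OF I(1)] sumT[OF I] by simp
    finally show "N S powr r \<le> (M * norm (S - sum f I)) powr r + T" by simp
  qed
  have "((\<lambda>I. M * norm (S - sum f I)) \<longlongrightarrow> M * norm (S - S)) (finite_subsets_at_top A)"
    by (intro tendsto_intros lim)
  then have "((\<lambda>I. (M * norm (S - sum f I)) powr r) \<longlongrightarrow> 0) (finite_subsets_at_top A)"
    using u mM by (intro tendsto_zero_powrI[where b = r]) auto
  then have "((\<lambda>I. (M * norm (S - sum f I)) powr r + T) \<longlongrightarrow> 0 + T) (finite_subsets_at_top A)"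
    by (intro tendsto_intros)
  then have "N S powr r \<le> 0 + T"
    by (rule tendsto_lowerbound[OF _ ev]) simp
  then show "ennreal (N (infsum f A) powr r) \<le> (\<integral>\<^sup>+i. ennreal (N (f i) powr r) \<partial>count_space A)"
    unfolding T S_def by (intro ennreal_leI) simp
qed

text \<open>A cube has positive measure, so an infinite value on it would make the norm infinite.
  This turns the norm estimate into convergence of the series at every single cube.\<close>

lemma mixed_norm_finite_imp:
  fixes G :: "int \<Rightarrow> real ^ 'n \<Rightarrow> ennreal"
  assumes fin: "mixed_norm ty p q G < top" and p: "0 < p" and q: "0 < q"
    and c: "\<And>y. y \<in> dyadic_cube j k \<Longrightarrow> G j y = c"
  shows "c < top"
proof (rule ccontr)
  assume "\<not> c < top"
  then have c: "G j y = top" if "y \<in> dyadic_cube j k" for y using c[OF that] \<open>\<not> c < top\<close> by (simp add: not_less top_unique)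
  have Lp: "Lp_norm p f = top" if "\<And>y. y \<in> dyadic_cube j k \<Longrightarrow> f y = top" for f :: "real ^ 'n \<Rightarrow> ennreal"
  proof -
    have "top = (\<integral>\<^sup>+y. top * indicator (dyadic_cube j k) y \<partial>lborel)"
      by (subst nn_integral_cmult_indicator) (simp_all add: emeasure_dyadic_cube ennreal_top_mult)
    also have "\<dots> \<le> (\<integral>\<^sup>+y. ennpow (f y) p \<partial>lborel)"
      using that by (intro nn_integral_mono) (auto simp: indicator_def)
    finally show ?thesis by (simp add: Lp_norm_def top_unique)
  qed
  have lq: "lq_norm q f = top" if "f j = top" for f :: "int \<Rightarrow> ennreal"
  proof (cases "q = top")
    case True
    have "f j \<le> (SUP j. f j)" by (rule SUP_upper) simp
    then show ?thesis using that True by (simp add: lq_norm_alt top_unique)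
  next
    case False
    have "ennpow (f j) (enn2real q) \<le> (\<integral>\<^sup>+j. ennpow (f j) (enn2real q) \<partial>count_space UNIV)"
      by (rule nn_integral_ge_point) simp
    then show ?thesis using that False by (simp add: lq_norm_alt top_unique)
  qed
  have "mixed_norm ty p q G = top"
    unfolding mixed_norm_def by (cases ty) (auto intro!: Lp lq c)
  with fin show False by simp
qed

section \<open>Boundedness on the sequence spaces\<close>

lemma B_fun_mult: "B_fun a b c Q R * B_fun a' b' c' Q R = B_fun (a + a') (b + b') (c + c') Q R"
  by (simp add: B_fun_def powr_add)

lemma J_index_cases:
  assumes "0 < p" "0 < q" "0 < u" "0 < n"
  obtains r0 where "0 < r0" "J_index ty n p q u = real n / r0" "r0 \<le> p" "r0 \<le> u"
    "ty = Triebel_Lizorkin \<Longrightarrow> ennreal r0 \<le> q"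
proof (cases ty)
  case Besov
  then show ?thesis using assms that[of "min p u"] by (simp add: J_index_def)
next
  case Triebel_Lizorkin
  define m where "m = min (ennreal p) (min q (ennreal u))"
  have "m \<noteq> top" "0 < m" using assms by (auto simp: m_def min_def)
  then obtain r0 where r0: "m = ennreal r0" "0 < r0" by (cases m) auto
  have "ennreal r0 \<le> ennreal p" "ennreal r0 \<le> q" "ennreal r0 \<le> ennreal u"
    unfolding r0(1)[symmetric] by (auto simp: m_def min.coboundedI2)
  then show ?thesis
    using that[of r0] r0 assms Triebel_Lizorkin
    by (simp add: J_index_def m_def[symmetric] ennreal_le_iff)
qed

theorem theorem17p5:
  fixes smul :: "'k::real_normed_field \<Rightarrow> 'a::banach \<Rightarrow> 'a"
    and B :: "(real ^ 'n) set \<Rightarrow> (real ^ 'n) set \<Rightarrow> 'k"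
    and \<rho> :: "(real ^ 'n) set \<Rightarrow> 'a \<Rightarrow> real"
    and ty :: space_type
    and p s u a b c D E F :: real
    and q :: ennreal
  assumes "banach_over smul"
    and "0 < p" and "0 < q"
    and "0 < u" and "u \<le> 1"
    and "0 \<le> a" and "0 \<le> b" and "0 \<le> c"
    and "uabc_norms smul u a b c \<rho>"
    and "almost_diagonal D E F B"
    and "D > J_index ty CARD('n) p q u + c"
    and "E > real CARD('n) / 2 + s + a"
    and "F > J_index ty CARD('n) p q u - real CARD('n) / 2 - s + b"
  shows "bounded_on_seq_space smul B ty s p q \<rho>"
proof -
  define n where "n = real CARD('n)"
  have n: "0 < n" by (simp add: n_def)
  define g where "g = s + n / 2"
  obtain r0 where r0: "0 < r0" "J_index ty CARD('n) p q u = n / r0" "r0 \<le> p" "r0 \<le> u"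
    "ty = Triebel_Lizorkin \<Longrightarrow> ennreal r0 \<le> q"
    using J_index_cases[OF assms(2-4), of "CARD('n)" ty] by (auto simp: n_def)
  \<comment> \<open>The smaller of the two exponents that have to exceed J = n / r0.\<close>
  define \<mu> where "\<mu> = min (D - c) (F - b + g)"
  have \<mu>: "n / r0 < \<mu>" using assms(11,13) by (auto simp: \<mu>_def g_def n_def r0(2))
  then have \<mu>0: "0 < \<mu>" using n r0(1) by (smt (verit) divide_pos_pos)
  have "n / \<mu> < r0" using \<mu> \<mu>0 r0(1) by (simp add: field_simps)
  \<comment> \<open>Lowering \<open>r0\<close> slightly preserves n < \<mu> * r and makes
    \<open>r\<close> strictly smaller than \<open>p\<close>, and than \<open>q\<close> in the
    Triebel--Lizorkin case.\<close>
  then obtain r where r: "n / \<mu> < r" "r < r0" using dense by blast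
  have r_pos: "0 < r" using r n \<mu>0 by (smt (verit) divide_pos_pos)
  have \<mu>r: "n < \<mu> * r" using r \<mu>0 by (simp add: field_simps)
  define \<delta> where "\<delta> = min ((E - a - g) * r) (\<mu> * r - n)"
  have \<delta>: "0 < \<delta>" using assms(12) r_pos \<mu>r by (simp add: \<delta>_def g_def n_def)
  have rp: "r < p" "r \<le> u" "r \<le> 1" using r r0 assms(5) by auto
  have rq: "ennreal r < q" if "ty = Triebel_Lizorkin"
  proof -
    have "ennreal r < ennreal r0" using r r_pos by (simp add: ennreal_less_iff)
    also have "\<dots> \<le> q" using r0(5)[OF that] .
    finally show ?thesis .
  qed
  have E': "\<delta> \<le> ((E - a) - g) * r" by (simp add: \<delta>_def)
  have F': "real CARD('n) + \<delta> \<le> ((F - b) + g) * r"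
  proof -
    have "\<mu> * r \<le> (F - b + g) * r" using r_pos by (intro mult_right_mono) (auto simp: \<mu>_def)
    then show ?thesis by (simp add: \<delta>_def n_def)
  qed
  have D': "real CARD('n) + \<delta> \<le> (D - c) * r"
  proof -
    have "\<mu> * r \<le> (D - c) * r" using r_pos by (intro mult_right_mono) (auto simp: \<mu>_def)
    then show ?thesis by (simp add: \<delta>_def n_def)
  qed
  \<comment> \<open>The comparison factor of \<open>\<rho>\<close> multiplies the bound of the
    matrix entry and the exponents add; this is where a, b and c are lost.\<close>
  define B' :: "(real ^ 'n) set \<Rightarrow> (real ^ 'n) set \<Rightarrow> real" where "B' = B_fun (- (E - a)) (- (F - b)) (- (D - c))"
  have B'_nonneg: "0 \<le> B' Q R" for Q R by (simp add: B'_def B_fun_nonneg)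
  have \<rho>: "u_norm smul u (\<rho> Q)" "equivalent_to_norm (\<rho> Q)" if "Q \<in> dyadic" for Q
    using assms(9) that by (auto simp: uabc_norms_def)
  have \<rho>_nonneg: "0 \<le> \<rho> Q e" if "Q \<in> dyadic" for Q e
    using \<rho>(1)[OF that] by (simp add: u_norm_def)
  obtain C1 where C1: "\<And>Q R e. Q \<in> dyadic \<Longrightarrow> R \<in> dyadic \<Longrightarrow> \<rho> Q e \<le> C1 * B_fun a b c Q R * \<rho> R e"
    using assms(9) unfolding uabc_norms_def by blast
  obtain C2 where C2: "\<And>Q R. Q \<in> dyadic \<Longrightarrow> R \<in> dyadic \<Longrightarrow> norm (B Q R) \<le> C2 * B_fun (- E) (- F) (- D) Q R"
    using assms(10) by (auto simp: almost_diagonal_def)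
  \<comment> \<open>The constants supplied by the hypotheses carry no sign; the maxima make
    \<open>C3\<close> positive.\<close>
  define C3 where "C3 = max 1 \<bar>C2\<bar> * max 1 \<bar>C1\<bar>"
  have C3: "0 < C3" by (simp add: C3_def)
  have entry: "\<rho> Q (smul (B Q R) e) \<le> C3 * (B' Q R * \<rho> R e)" if "Q \<in> dyadic" "R \<in> dyadic" for Q R e
  proof -
    have "\<rho> Q (smul (B Q R) e) = norm (B Q R) * \<rho> Q e"
      using \<rho>(1)[OF that(1)] by (simp add: u_norm_def)
    also have "\<dots> \<le> (max 1 \<bar>C2\<bar> * B_fun (- E) (- F) (- D) Q R) * (max 1 \<bar>C1\<bar> * B_fun a b c Q R * \<rho> R e)"
    proof (intro mult_mono)
      show "norm (B Q R) \<le> max 1 \<bar>C2\<bar> * B_fun (- E) (- F) (- D) Q R"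
        by (rule order.trans[OF C2[OF that]]) (intro mult_right_mono B_fun_nonneg, auto)
      show "\<rho> Q e \<le> max 1 \<bar>C1\<bar> * B_fun a b c Q R * \<rho> R e"
        by (rule order.trans[OF C1[OF that]])
           (intro mult_right_mono B_fun_nonneg \<rho>_nonneg that, auto)
    qed (use \<rho>_nonneg that B_fun_nonneg in \<open>auto intro!: mult_nonneg_nonneg\<close>)
    also have "\<dots> = C3 * ((B_fun (- E) (- F) (- D) Q R * B_fun a b c Q R) * \<rho> R e)"
      by (simp add: C3_def)
    also have "B_fun (- E) (- F) (- D) Q R * B_fun a b c Q R = B' Q R"
      unfolding B_fun_mult B'_def by simp
    finally show ?thesis .
  qed
  show ?thesis
  proof (rule almost_diagonal_le_smoothing[where ?'n = 'n, OF r_pos \<delta> E' F' D'])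
    fix C4
    assume C4: "0 < C4" and le_smoothing: "\<And>(w :: (real ^ 'n) set \<Rightarrow> real) j x. (\<And>R. R \<in> dyadic \<Longrightarrow> 0 \<le> w R) \<Longrightarrow>
      (\<integral>\<^sup>+R. ennreal ((2 powr (of_int j * g) * (B_fun (- (E - a)) (- (F - b)) (- (D - c)) (cube_at j x) R * w R)) powr r) \<partial>count_space dyadic) \<le>
      ennreal C4 * smoothing \<delta> (\<lambda>i y. ennpow (ennreal (2 powr (of_int i * g) * w (cube_at i y))) r) j x"
    show ?thesis
    proof (rule mixed_norm_smoothing[where ?'n = 'n, OF \<delta> r_pos rp(1) assms(3) rq])
      fix C5
      assume C5: "0 < C5" and smoothing_bound: "\<And>f :: int \<Rightarrow> real ^ 'n \<Rightarrow> ennreal. (\<And>j. f j \<in> borel_measurable lborel) \<Longrightarrow>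
        mixed_norm ty p q (\<lambda>j x. ennpow (smoothing \<delta> (\<lambda>j x. ennpow (f j x) r) j x) (1 / r)) \<le>
        ennreal C5 * mixed_norm ty p q f"
      define K where "K = C4 powr (1 / r) * C5"
      have K: "0 < K" using C4 C5 by (simp add: K_def)
      show ?thesis
        unfolding bounded_on_seq_space_def
      proof (intro exI[of _ "C3 * K"] ballI)
        fix t assume t: "t \<in> seq_space ty s p q \<rho>"
        define L where "L = level_fun s \<rho> t"
        have L: "L j x = ennreal (2 powr (of_int j * g) * \<rho> (cube_at j x) (t (cube_at j x)))" for j x
          by (simp add: L_def level_fun_eq g_def n_def)
        have L_meas [measurable]: "L j \<in> borel_measurable lborel" for j
          unfolding L[abs_def] by (rule cell_fun_measurable[of "\<lambda>R. ennreal (2 powr (of_int j * g) * \<rho> R (t R))"])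
        have L_fin: "mixed_norm ty p q L < top"
          using t by (simp add: seq_space_def seq_norm_eq_mixed_norm L_def)
        \<comment> \<open>\<open>Z j Q\<close> adds the r-th powers of the weighted majorants of row
          \<open>Q\<close>. It makes sense before any series is known to converge, and the bound for
          \<open>G\<close> derived from it yields the convergence.\<close>
        define Z where "Z j Q = (\<integral>\<^sup>+R. ennreal ((2 powr (of_int j * g) * (B' Q R * \<rho> R (t R))) powr r) \<partial>count_space dyadic)"
          for j :: int and Q
        define G where "G j x = ennpow (Z j (cube_at j x)) (1 / r)" for j x
        have G_meas [measurable]: "G j \<in> borel_measurable lborel" for j
          unfolding G_def by (rule cell_fun_measurable[of "\<lambda>Q. ennpow (Z j Q) (1 / r)"])
        have G_le: "G j x \<le> ennreal (C4 powr (1 / r)) * ennpow (smoothing \<delta> (\<lambda>j x. ennpow (L j x) r) j x) (1 / r)" for j x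
        proof -
          have "Z j (cube_at j x) \<le> ennreal C4 * smoothing \<delta> (\<lambda>j x. ennpow (L j x) r) j x"
            using le_smoothing[of "\<lambda>R. \<rho> R (t R)" j x] \<rho>_nonneg by (simp add: Z_def B'_def L)
          then have "G j x \<le> ennpow (ennreal C4 * smoothing \<delta> (\<lambda>j x. ennpow (L j x) r) j x) (1 / r)"
            unfolding G_def using r_pos by (intro ennpow_mono) auto
          then show ?thesis using C4 by (simp add: ennpow_mult ennpow_ennreal)
        qed
        have "mixed_norm ty p q G \<le> mixed_norm ty p q (\<lambda>j x. ennreal (C4 powr (1 / r)) *
            ennpow (smoothing \<delta> (\<lambda>j x. ennpow (L j x) r) j x) (1 / r))"
          using assms by (intro mixed_norm_mono G_le) auto
        also have "\<dots> = ennreal (C4 powr (1 / r)) *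
            mixed_norm ty p q (\<lambda>j x. ennpow (smoothing \<delta> (\<lambda>j x. ennpow (L j x) r) j x) (1 / r))"
          using assms by (intro mixed_norm_cmult) measurable
        also have "\<dots> \<le> ennreal (C4 powr (1 / r)) * (ennreal C5 * mixed_norm ty p q L)"
          by (intro mult_left_mono smoothing_bound) auto
        also have "\<dots> = ennreal K * mixed_norm ty p q L"
          using C5 by (simp add: K_def ennreal_mult mult.assoc)
        finally have G_bound: "mixed_norm ty p q G \<le> ennreal K * mixed_norm ty p q L" .
        also have "\<dots> < top" using L_fin by (simp add: ennreal_mult_less_top)
        finally have G_fin: "mixed_norm ty p q G < top" .
        have Z_fin: "Z j Q < top" if "Q = dyadic_cube j k" for j k Q
        proof -
          have "ennpow (Z j Q) (1 / r) < top"
            using G_fin assms(2,3) by (rule mixed_norm_finite_imp[of _ _ _ _ j k]) (simp add: G_def cube_at_eq that)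
          then show ?thesis by simp
        qed
        define y where "y Q R = \<rho> Q (smul (B Q R) (t R))" for Q R
        have y_sum: "ennreal (2 powr (of_int j * g * r)) * (\<integral>\<^sup>+R. ennreal (y Q R powr r) \<partial>count_space dyadic) \<le>
            ennreal (C3 powr r) * Z j Q" if Q: "Q \<in> dyadic" for j Q
        proof -
          have "ennreal (2 powr (of_int j * g * r)) * (\<integral>\<^sup>+R. ennreal (y Q R powr r) \<partial>count_space dyadic) =
              (\<integral>\<^sup>+R. ennreal (2 powr (of_int j * g * r) * y Q R powr r) \<partial>count_space dyadic)"
            by (simp add: nn_integral_cmult ennreal_mult)
          also have "\<dots> \<le> (\<integral>\<^sup>+R. ennreal (C3 powr r) *
              ennreal ((2 powr (of_int j * g) * (B' Q R * \<rho> R (t R))) powr r) \<partial>count_space dyadic)"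
          proof (intro nn_integral_mono)
            fix R :: "(real ^ 'n) set" assume "R \<in> space (count_space dyadic)"
            then have R: "R \<in> dyadic" by simp
            have "y Q R powr r \<le> (C3 * (B' Q R * \<rho> R (t R))) powr r"
              using r_pos entry[OF Q R] \<rho>_nonneg[OF Q] by (intro powr_mono2) (auto simp: y_def)
            then have "2 powr (of_int j * g * r) * y Q R powr r \<le>
                2 powr (of_int j * g * r) * (C3 * (B' Q R * \<rho> R (t R))) powr r"
              by (intro mult_left_mono) auto
            also have "\<dots> = C3 powr r * (2 powr (of_int j * g) * (B' Q R * \<rho> R (t R))) powr r"
              using C3 B'_nonneg \<rho>_nonneg[OF R] by (simp add: powr_mult powr_powr)
            finally show "ennreal (2 powr (of_int j * g * r) * y Q R powr r) \<le> ennreal (C3 powr r) *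
                ennreal ((2 powr (of_int j * g) * (B' Q R * \<rho> R (t R))) powr r)"
              by (simp add: ennreal_leI flip: ennreal_mult)
          qed
          also have "\<dots> = ennreal (C3 powr r) * Z j Q"
            by (simp add: Z_def nn_integral_cmult)
          finally show ?thesis .
        qed
        have y_fin: "(\<integral>\<^sup>+R. ennreal (y Q R powr r) \<partial>count_space dyadic) < top" if Q: "Q \<in> dyadic" for Q
        proof -
          obtain j k where jk: "Q = dyadic_cube j k" using Q by (rule dyadicE)
          have "ennreal (2 powr (of_int j * g * r)) * (\<integral>\<^sup>+R. ennreal (y Q R powr r) \<partial>count_space dyadic) < top"
            by (rule le_less_trans[OF y_sum[OF Q]]) (use Z_fin[OF jk] in \<open>simp add: ennreal_mult_less_top\<close>)
          then show ?thesis by (auto simp: ennreal_mult_less_top)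
        qed
        note series = u_norm_infsum[OF \<rho>(1) r_pos rp(2) assms(5) \<rho>(2) countable_dyadic, OF _ _ y_fin[unfolded y_def]]
        have out: "level_fun s \<rho> (matrix_action smul B t) j x \<le> ennreal C3 * G j x" for j x
        proof -
          define Q where "Q = cube_at j x"
          have Q: "Q \<in> dyadic" by (simp add: Q_def)
          let ?v = "matrix_action smul B t Q"
          have "ennpow (level_fun s \<rho> (matrix_action smul B t) j x) r =
              ennreal (2 powr (of_int j * g * r)) * ennreal (\<rho> Q ?v powr r)"
            using \<rho>_nonneg[OF Q]
            by (simp add: level_fun_eq ennpow_ennreal powr_mult powr_powr g_def n_def flip: Q_def ennreal_mult)
          also have "\<dots> \<le> ennreal (2 powr (of_int j * g * r)) * (\<integral>\<^sup>+R. ennreal (y Q R powr r) \<partial>count_space dyadic)"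
            unfolding matrix_action_def y_def using Q by (intro mult_left_mono series(2)) auto
          also have "\<dots> \<le> ennreal (C3 powr r) * Z j Q" by (rule y_sum[OF Q])
          finally have "level_fun s \<rho> (matrix_action smul B t) j x \<le> ennpow (ennreal (C3 powr r) * Z j Q) (1 / r)"
            using r_pos by (simp add: ennpow_le_swap)
          also have "\<dots> = ennreal C3 * G j x"
            using r_pos C3 by (simp add: ennpow_mult ennpow_ennreal powr_powr G_def Q_def)
          finally show ?thesis .
        qed
        have "seq_norm ty s p q \<rho> (matrix_action smul B t) \<le> mixed_norm ty p q (\<lambda>j x. ennreal C3 * G j x)"
          unfolding seq_norm_eq_mixed_norm using assms by (intro mixed_norm_mono out) auto
        also have "\<dots> = ennreal C3 * mixed_norm ty p q G"
          using assms by (intro mixed_norm_cmult) measurable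
        also have "\<dots> \<le> ennreal C3 * (ennreal K * mixed_norm ty p q L)"
          by (intro mult_left_mono G_bound) auto
        also have "\<dots> = ennreal (C3 * K) * seq_norm ty s p q \<rho> t"
          using C3 K by (simp add: ennreal_mult mult.assoc seq_norm_eq_mixed_norm L_def)
        finally have bound: "seq_norm ty s p q \<rho> (matrix_action smul B t) \<le> ennreal (C3 * K) * seq_norm ty s p q \<rho> t" .
        also have "\<dots> < top"
          using t by (simp add: seq_space_def ennreal_mult_less_top)
        finally have "matrix_action smul B t \<in> seq_space ty s p q \<rho>"
          by (simp add: seq_space_def)
        with bound series(1)
        show "(\<forall>Q\<in>dyadic. (\<lambda>R. smul (B Q R) (t R)) summable_on dyadic) \<and>
          matrix_action smul B t \<in> seq_space ty s p q \<rho> \<and>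
          seq_norm ty s p q \<rho> (matrix_action smul B t) \<le> ennreal (C3 * K) * seq_norm ty s p q \<rho> t"
          by blast
      qed
    qed
  qed
qed

end
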